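(* For rational $x\in[0,1)$ let $\ell(x)$ be the length of its minus continued fraction expansion. Let $\mathscr{F}(Q)=\{a/b\in\mathbb{Q}:\gcd(a,b)=1,\ 0\le a\le b\le Q\}$ and $\mathscr{F}_0(Q)=\mathscr{F}(Q)\cap[0,1/2)$. Then, as $Q\to\infty$, \[ \frac{1}{\#\mathscr{F}(Q)}\sum_{x\in\mathscr{F}_0(Q)}\ell(x)=c_1(\log Q)^2+c_2\log Q+O(1), \] where \[ c_1=\frac{1}{4\zeta(2)},\qquad c_2=\frac{1}{2\zeta(2)}\Big(2\gamma-\frac32-2\frac{\zeta'(2)}{\zeta(2)}+\frac{3\zeta(2)}{4}\Big). \] Equivalently, $2c_1=C_1$ and $c_2=C_2/2+3/8$ (so $2c_2>C_2$), where $C_1=\frac{1}{2\zeta(2)}$ and $C_2=\frac{1}{\zeta(2)}\big(2\gamma-\frac32-2\frac{\zeta'(2)}{\zeta(2)}\big)$.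
   Context: Every rational $x\in(0,1)$ has a unique minus continued fraction expansion \[ x=1-\cfrac{1}{b_1-\cfrac{1}{b_2-\cdots-\cfrac{1}{b_m}}}, \] with $m\in\mathbb{N}$ and integers $b_1,\dots,b_m\ge2$. One sets $\ell(x)=m$. The single term $x=0$ contributes a bounded amount to the sum, which is negligible. Here $\gamma$ is the Euler–Mascheroni constant and $\zeta$ is the Riemann zeta function. *)

theory Defs
  imports "HOL-Analysis.Analysis" "HOL-Library.Landau_Symbols"
begin

fun mcf :: "int list \<Rightarrow> rat" where
  "mcf [] = 0"
| "mcf [b] = of_int b"
| "mcf (b # c # bs) = of_int b - 1 / mcf (c # bs)"

definition is_mcf_expansion :: "rat \<Rightarrow> int list \<Rightarrow> bool" where
  "is_mcf_expansion x bs \<longleftrightarrow> bs \<noteq> [] \<and> (\<forall>b\<in>set bs. b \<ge> 2) \<and> x = 1 - 1 / mcf bs"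

text \<open>
  The number 0 has no minus continued fraction expansion, so \<open>mcf_length 0\<close> is an
  unspecified natural number; whatever is proved about it holds for every convention.
\<close>
definition mcf_length :: "rat \<Rightarrow> nat" where
  "mcf_length x = length (THE bs. is_mcf_expansion x bs)"

lemma mcf_gt_1:
  assumes "bs \<noteq> []" "\<forall>b\<in>set bs. b \<ge> 2"
  shows "mcf bs > 1"
  using assms
proof (induction bs rule: mcf.induct)
  case (3 b c bs)
  then have "mcf (c # bs) > 1" by simp
  then have "1 / mcf (c # bs) < 1" by simp
  moreover have "of_int b \<ge> (2 :: rat)" using 3 by simp
  ultimately show ?case by (simp only: mcf.simps)
qed auto

lemma mcf_inj:
  assumes "as \<noteq> []" "\<forall>b\<in>set as. b \<ge> 2" "bs \<noteq> []" "\<forall>b\<in>set bs. b \<ge> 2" "mcf as = mcf bs"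
  shows "as = bs"
  using assms
proof (induction as arbitrary: bs rule: mcf.induct)
  case 1
  then show ?case by simp
next
  case (2 a)
  obtain b cs where bs: "bs = b # cs" using 2 by (cases bs) auto
  show ?case
  proof (cases cs)
    case Nil
    then show ?thesis using 2 bs by simp
  next
    case (Cons c ds)
    have m: "mcf cs > 1" by (rule mcf_gt_1) (use 2 bs Cons in auto)
    have e: "(of_int a :: rat) = of_int b - 1 / mcf cs" using 2 bs Cons by simp
    have "0 < 1 / mcf cs" "1 / mcf cs < 1" using m by auto
    then have "(of_int a :: rat) < of_int b" "(of_int b :: rat) < of_int (a + 1)"
      using e by (auto simp del: zero_less_divide_1_iff)
    then have "a < b" "b < a + 1" by (simp_all only: of_int_less_iff)
    then show ?thesis by linarith
  qed
next
  case (3 a a' as)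
  have m1: "mcf (a' # as) > 1" by (rule mcf_gt_1) (use 3 in auto)
  have r1: "0 < 1 / mcf (a' # as)" "1 / mcf (a' # as) < 1" using m1 by auto
  have e1: "mcf (a # a' # as) = of_int a - 1 / mcf (a' # as)" by simp
  obtain b cs where bs: "bs = b # cs" using 3 by (cases bs) auto
  show ?case
  proof (cases cs)
    case Nil
    then have "(of_int b :: rat) = of_int a - 1 / mcf (a' # as)" using 3 bs by simp
    then have "(of_int b :: rat) < of_int a" "(of_int a :: rat) < of_int (b + 1)"
      using r1 by (auto simp del: zero_less_divide_1_iff)
    then have "b < a" "a < b + 1" by (simp_all only: of_int_less_iff)
    then show ?thesis by linarith
  next
    case (Cons c ds)
    have m: "mcf cs > 1" by (rule mcf_gt_1) (use 3 bs Cons in auto)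
    have r: "0 < 1 / mcf cs" "1 / mcf cs < 1" using m by auto
    have e: "of_int a - 1 / mcf (a' # as) = of_int b - 1 / mcf cs" using 3 bs Cons by simp
    then have "(of_int a :: rat) < of_int (b + 1)" "(of_int b :: rat) < of_int (a + 1)"
      using r r1 by (simp_all del: zero_less_divide_1_iff)
    then have "a < b + 1" "b < a + 1" by (simp_all only: of_int_less_iff)
    then have ab: "a = b" by linarith
    then have "mcf (a' # as) = mcf cs" using e m m1 by simp
    then have "a' # as = cs"
      by (intro 3) (use 3 bs Cons in auto)
    then show ?thesis using ab bs by simp
  qed
qed

lemma mcf_exists:
  fixes p q :: int
  assumes "0 < q" "q < p"
  shows "\<exists>bs. bs \<noteq> [] \<and> (\<forall>b\<in>set bs. b \<ge> 2) \<and> mcf bs = of_int p / of_int q"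
  using assms
proof (induction "nat q" arbitrary: p q rule: less_induct)
  case less
  define b where "b = (p - 1) div q + 1"
  define r where "r = b * q - p"
  have r: "r = q - 1 - (p - 1) mod q"
    using div_mult_mod_eq[of "p - 1" q] by (simp add: r_def b_def algebra_simps)
  have "0 \<le> (p - 1) mod q" "(p - 1) mod q < q" using less.prems by auto
  then have r0: "0 \<le> r" "r < q" using r by linarith+
  have "(p - 1) div q \<ge> 1"
    using zdiv_mono1[of q "p - 1" q] less.prems by simp
  then have b: "b \<ge> 2" by (simp add: b_def)
  have q0: "(of_int q :: rat) \<noteq> 0" using less.prems by simp
  have p: "(of_int p :: rat) = of_int b * of_int q - of_int r"
    by (simp add: r_def)
  have pq: "(of_int p :: rat) / of_int q = of_int b - of_int r / of_int q"
    using q0 by (simp add: p field_simps)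
  show ?case
  proof (cases "r = 0")
    case True
    then show ?thesis using b pq by (intro exI[of _ "[b]"]) simp
  next
    case False
    then obtain cs where cs: "cs \<noteq> []" "\<forall>b\<in>set cs. b \<ge> 2" "mcf cs = of_int q / of_int r"
      using less.hyps[of r q] r0 less.prems by auto
    then have "mcf (b # cs) = of_int b - of_int r / of_int q"
      by (cases cs) auto
    then show ?thesis using b cs pq by (intro exI[of _ "b # cs"]) simp
  qed
qed

lemma mcf_expansion_ex1:
  assumes "0 < x" "x < 1"
  shows "\<exists>!bs. is_mcf_expansion x bs"
proof -
  obtain a c :: int where x: "x = of_int a / of_int c" "c > 0"
    by (cases x) (auto simp: Fract_of_int_quotient)
  have ac: "0 < a" "a < c" using assms x by (auto simp: field_simps)
  obtain bs where bs: "bs \<noteq> []" "\<forall>b\<in>set bs. b \<ge> 2" "mcf bs = of_int c / of_int (c - a)"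
    using mcf_exists[of "c - a" c] ac by auto
  have "is_mcf_expansion x bs"
    unfolding is_mcf_expansion_def
  proof (intro conjI)
    show "x = 1 - 1 / mcf bs"
      unfolding bs(3) using ac x by (simp add: field_simps)
  qed (use bs in auto)
  moreover have "as = bs" if "is_mcf_expansion x as" for as
  proof (rule mcf_inj)
    have "1 / mcf as = 1 / mcf bs"
      using that \<open>is_mcf_expansion x bs\<close> unfolding is_mcf_expansion_def by linarith
    then have "inverse (mcf as) = inverse (mcf bs)" by (simp only: inverse_eq_divide)
    then show "mcf as = mcf bs" by (simp only: inverse_eq_iff_eq)
  qed (use bs that in \<open>auto simp: is_mcf_expansion_def\<close>)
  ultimately show ?thesis by blast
qed

lemma no_mcf_expansion_0: "\<not> is_mcf_expansion 0 bs"
  using mcf_gt_1[of bs] by (auto simp: is_mcf_expansion_def)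

definition farey :: "real \<Rightarrow> rat set" where
  "farey Q = {of_int a / of_int b | a b :: int. gcd a b = 1 \<and> 0 \<le> a \<and> a \<le> b \<and> of_int b \<le> Q}"

definition farey0 :: "real \<Rightarrow> rat set" where
  "farey0 Q = farey Q \<inter> {0..<1/2}"

lemma finite_farey: "finite (farey Q)"
proof (rule finite_subset)
  show "farey Q \<subseteq> (\<lambda>(a, b). of_int a / of_int b) ` ({0..\<lfloor>Q\<rfloor>} \<times> {0..\<lfloor>Q\<rfloor>})"
    by (force simp: farey_def le_floor_iff)
qed auto

text \<open>The Riemann zeta function on the half-line \<open>s > 1\<close>, where the Dirichlet series converges.\<close>
definition zeta :: "real \<Rightarrow> real" where
  "zeta s = (\<Sum>n. 1 / real (Suc n) powr s)"

end

theory Submission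
  imports Defs "HOL-Number_Theory.Number_Theory" "HOL-Computational_Algebra.Squarefree"
    "HOL-Real_Asymp.Real_Asymp"
begin

text \<open>
  The length of the minus continued fraction of \<open>m / (m + k)\<close> is the number of steps of the
  subtractive Euclidean algorithm on \<open>(m, k)\<close> at which the first entry is the smaller one. Such a step
  is the same as a factorisation of the column \<open>(m, k)\<close> as \<open>A (r, s)\<close> with \<open>A\<close> in
  \<open>SL\<^sub>2(\<nat>)\<close> and \<open>1 \<le> r \<le> s\<close>. The matrix \<open>A\<close> is determined by its column sums \<open>u, v\<close>, which are
  coprime, and \<open>m + k = u r + v s\<close>. Hence the sum over fractions below \<open>1/2\<close> counts the coprime
  solutions of \<open>u r + v s \<le> n\<close>, \<open>r \<le> s\<close>, for which the inverse of \<open>u\<close> modulo \<open>v\<close> lies in the upper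
  half of the residues modulo \<open>v\<close>. Replacing this condition by the weight \<open>1/2\<close> leaves Ingham's
  problem for \<open>\<Sum> \<tau>(i) \<tau>(j)\<close> over \<open>i + j \<le> n\<close>, combined with two Moebius inversions. The
  condition is biased only for \<open>v = 1\<close> and \<open>v = 2\<close>, which yields the extra term \<open>3/8 log Q\<close>. For
  \<open>v \<ge> 3\<close> the bias is odd and periodic in \<open>u\<close>, and its partial sums are bounded by a power of \<open>v\<close> below
  the first, by Kloosterman's fourth moment estimate; this is just enough for a total of \<open>O(n\<^sup>2)\<close>.
\<close>

subsection \<open>Kloosterman sums\<close>

text \<open>Only an error of O(n^2) is affordable in the sum of the lengths. For fixed
  \<open>v\<close> there are at most (n / v)^2 pairs \<open>r\<close>, \<open>s\<close>, so a bias
  of order \<open>v\<close> in the sums over \<open>u\<close> would cost n^2 times the sum of 1 / v,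
  one logarithm too much. A saving of any fixed power of \<open>v\<close> makes the sum over
  \<open>v\<close> converge; the fourth moment gives the exponent 3/4 up to logarithms and divisor
  functions. Origin of 3/8: about n^2 log n / (2 zeta(2)) solutions have v = 1, and they count with
  weight 1 instead of 1/2; about n^2 log n / (8 zeta(2)) have v = 2, and they count with weight 0.
  The surplus is half the difference, 3 n^2 log n / (16 zeta(2)), and it is divided by the number of
  Farey fractions, about n^2 / (2 zeta(2)). The condition r <= s halves the count, because
  exchanging (u, r) with (v, s) is a symmetry and r = s forces r = s = 1. As the average has size
  (log n)^2, the number of Farey fractions is needed with relative error O(1 / (log n)^2).\<close>

definition add_char :: "int \<Rightarrow> int \<Rightarrow> complex" where
  "add_char v x = cis (2 * pi * of_int x / of_int v)"

lemma add_char_0 [simp]: "add_char v 0 = 1"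
  by (simp add: add_char_def)

lemma norm_add_char [simp]: "norm (add_char v x) = 1"
  by (simp add: add_char_def)

lemma add_char_add: "add_char v (x + y) = add_char v x * add_char v y"
  by (simp add: add_char_def cis_mult add_divide_distrib distrib_left)

lemma add_char_minus: "add_char v (- x) = cnj (add_char v x)"
  by (simp add: add_char_def cis_cnj)

lemma add_char_diff: "add_char v (x - y) = add_char v x * cnj (add_char v y)"
  using add_char_add[of v x "-y"] by (simp add: add_char_minus)

lemma add_char_power: "add_char v (int n * x) = add_char v x ^ n"
  by (simp add: add_char_def Complex.DeMoivre mult_ac)

lemma add_char_eq_1_iff:
  assumes "v > 0"
  shows "add_char v x = 1 \<longleftrightarrow> v dvd x"
proof
  assume "v dvd x"
  then obtain k where "x = v * k" by blast
  then show "add_char v x = 1" using assms cis_multiple_2pi[of "of_int k"] by (simp add: add_char_def mult_ac)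
next
  assume "add_char v x = 1"
  then have "cos (2 * pi * of_int x / of_int v) = 1" by (simp add: add_char_def complex_eq_iff)
  then obtain n :: int where "2 * pi * of_int x / of_int v = of_int n * 2 * pi"
    using cos_one_2pi_int by blast
  then have "of_int x = (of_int (n * v) :: real)" using assms by (simp add: field_simps)
  then have "x = n * v" by (simp only: of_int_eq_iff)
  then show "v dvd x" by simp
qed

lemma add_char_cong:
  assumes "v > 0" "[x = y] (mod v)"
  shows "add_char v x = add_char v y"
proof -
  have "add_char v (x - y) = 1" using assms by (simp add: add_char_eq_1_iff cong_iff_dvd_diff)
  then show ?thesis using add_char_add[of v "x - y" y] by simp
qed

lemma sum_int_lessThan: "(\<Sum>h\<in>{0..<v::int}. f h) = (\<Sum>h<nat v. f (int h))"
  by (rule sum.reindex_bij_witness[of _ int nat]) auto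

lemma add_char_orthogonality:
  assumes "v > 0"
  shows "(\<Sum>h\<in>{0..<v}. add_char v (h * x)) = (if v dvd x then of_int v else 0)"
proof -
  have "(\<Sum>h\<in>{0..<v}. add_char v (h * x)) = (\<Sum>h<nat v. add_char v x ^ h)"
    by (simp add: sum_int_lessThan add_char_power)
  also have "\<dots> = (if v dvd x then of_int v else 0)"
  proof (cases "v dvd x")
    case False
    have "add_char v x ^ nat v = add_char v (v * x)" using assms add_char_power[of v "nat v" x] by simp
    also have "\<dots> = 1" using assms by (simp add: add_char_eq_1_iff)
    finally show ?thesis using False add_char_eq_1_iff[OF assms, of x] by (simp add: geometric_sum)
  qed (use assms in \<open>simp add: add_char_eq_1_iff[symmetric]\<close>)
  finally show ?thesis .
qed

text \<open>Expanding the squared modulus gives a sum over pairs x, y. Once the two frequency sums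
  are moved inside, orthogonality in \<open>h\<close> and in \<open>k\<close> keeps exactly the
  pairs that agree modulo \<open>v\<close> under both \<open>f\<close> and \<open>g\<close>.\<close>

lemma parseval_two:
  fixes f g :: "'a \<Rightarrow> int"
  assumes "v > 0" "finite X"
  shows "(\<Sum>h\<in>{0..<v}. \<Sum>k\<in>{0..<v}. (norm (\<Sum>x\<in>X. add_char v (h * f x + k * g x)))\<^sup>2)
       = (of_int v)\<^sup>2 * real (card {(x, y). x \<in> X \<and> y \<in> X \<and> [f x = f y] (mod v) \<and> [g x = g y] (mod v)})"
    (is "_ = _ * real (card ?P)")
proof -
  have "complex_of_real (\<Sum>h\<in>{0..<v}. \<Sum>k\<in>{0..<v}. (norm (\<Sum>x\<in>X. add_char v (h * f x + k * g x)))\<^sup>2)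
     = (\<Sum>h\<in>{0..<v}. \<Sum>k\<in>{0..<v}. \<Sum>x\<in>X. \<Sum>y\<in>X. add_char v (h * (f x - f y)) * add_char v (k * (g x - g y)))"
    by (simp add: complex_norm_square sum_product add_char_diff[symmetric] add_char_add[symmetric] algebra_simps
             del: of_real_power)
  also have "\<dots> = (\<Sum>h\<in>{0..<v}. \<Sum>x\<in>X. \<Sum>k\<in>{0..<v}. \<Sum>y\<in>X. add_char v (h * (f x - f y)) * add_char v (k * (g x - g y)))"
    by (rule sum.cong[OF refl], rule sum.swap)
  also have "\<dots> = (\<Sum>x\<in>X. \<Sum>h\<in>{0..<v}. \<Sum>k\<in>{0..<v}. \<Sum>y\<in>X. add_char v (h * (f x - f y)) * add_char v (k * (g x - g y)))"
    by (rule sum.swap)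
  also have "\<dots> = (\<Sum>x\<in>X. \<Sum>h\<in>{0..<v}. \<Sum>y\<in>X. \<Sum>k\<in>{0..<v}. add_char v (h * (f x - f y)) * add_char v (k * (g x - g y)))"
    by (rule sum.cong[OF refl], rule sum.cong[OF refl], rule sum.swap)
  also have "\<dots> = (\<Sum>x\<in>X. \<Sum>y\<in>X. \<Sum>h\<in>{0..<v}. \<Sum>k\<in>{0..<v}. add_char v (h * (f x - f y)) * add_char v (k * (g x - g y)))"
    by (rule sum.cong[OF refl], rule sum.swap)
  also have "\<dots> = (\<Sum>x\<in>X. \<Sum>y\<in>X. (\<Sum>h\<in>{0..<v}. add_char v (h * (f x - f y))) * (\<Sum>k\<in>{0..<v}. add_char v (k * (g x - g y))))"
    by (simp add: sum_product)
  also have "\<dots> = (\<Sum>x\<in>X. \<Sum>y\<in>X. if [f x = f y] (mod v) \<and> [g x = g y] (mod v) then (of_int v)\<^sup>2 else 0)"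
    by (intro sum.cong refl) (simp add: add_char_orthogonality assms cong_iff_dvd_diff power2_eq_square)
  also have "\<dots> = (\<Sum>z\<in>X \<times> X. if [f (fst z) = f (snd z)] (mod v) \<and> [g (fst z) = g (snd z)] (mod v)
                    then (of_int v)\<^sup>2 else 0)"
    by (simp add: sum.cartesian_product case_prod_unfold)
  also have "\<dots> = (\<Sum>z\<in>?P. (of_int v)\<^sup>2)"
    by (rule sum.mono_neutral_cong_right) (use assms in auto)
  also have "\<dots> = complex_of_real ((of_int v)\<^sup>2 * real (card ?P))"
    by simp
  finally show ?thesis by (simp only: of_real_eq_iff)
qed

text \<open>Members of one class modulo \<open>n\<close> are separated by their quotients, and these
  lie in \<open>{0..<q}\<close>.\<close>

lemma card_cong_class:
  fixes n q :: int
  assumes "n > 0" "q \<ge> 0" "A \<subseteq> {0..<n * q}" "\<And>x y. x \<in> A \<Longrightarrow> y \<in> A \<Longrightarrow> [x = y] (mod n)"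
  shows "int (card A) \<le> q"
proof -
  have "inj_on (\<lambda>x. x div n) A"
    using assms(4) by (auto simp: inj_on_def Cong.cong_def) (metis mult_div_mod_eq)
  moreover have "(\<lambda>x. x div n) ` A \<subseteq> {0..<q}"
  proof safe
    fix x assume "x \<in> A"
    then have x: "0 \<le> x" "x < n * q" using assms(3) by auto
    then have "n * (x div n) < n * q" using mult_div_mod_eq[of n x] pos_mod_sign[OF assms(1), of x] by linarith
    then show "x div n \<in> {0..<q}" using assms(1) x by (simp add: pos_imp_zdiv_nonneg_iff)
  qed
  ultimately have "card A \<le> card {0..<q}" by (metis card_inj_on_le finite_atLeastLessThan_int)
  then show ?thesis using assms by simp
qed

lemma card_cong_class_dvd:
  fixes n v :: int
  assumes "v > 0" "n dvd v" "n > 0" "A \<subseteq> {0..<v}" "\<And>x y. x \<in> A \<Longrightarrow> y \<in> A \<Longrightarrow> [x = y] (mod n)"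
  shows "int (card A) \<le> v div n"
  by (rule card_cong_class[of n]) (use assms in \<open>auto simp: pos_imp_zdiv_nonneg_iff\<close>)

section \<open>Units modulo v and complete Kloosterman sums\<close>

definition units_mod :: "int \<Rightarrow> int set" where
  "units_mod v = {a \<in> {0..<v}. coprime a v}"

lemma finite_units_mod [simp]: "finite (units_mod v)"
  by (rule finite_subset[of _ "{0..<v}"]) (auto simp: units_mod_def)

lemma modular_inverse_in_units:
  assumes "v > 0" "a \<in> units_mod v"
  shows "modular_inverse v a \<in> units_mod v"
  using assms by (auto simp: units_mod_def modular_inverse_int_nonneg modular_inverse_int_less)

lemma modular_inverse_units_eqI:
  fixes a b v :: int
  assumes "v > 0" "[a * b = 1] (mod v)" "0 \<le> b" "b < v"
  shows "modular_inverse v a = b"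
  using assms by (intro modular_inverse_int_eqI) auto

lemma modular_inverse_involution:
  assumes "v > 0" "a \<in> units_mod v"
  shows "modular_inverse v (modular_inverse v a) = a"
  using assms cong_modular_inverse1[of a v]
  by (intro modular_inverse_units_eqI) (auto simp: units_mod_def mult.commute)

lemma bij_betw_modular_inverse:
  assumes "v > 0"
  shows "bij_betw (modular_inverse v) (units_mod v) (units_mod v)"
  by (rule bij_betw_byWitness[where f' = "modular_inverse v"])
     (use assms modular_inverse_involution modular_inverse_in_units in auto)

lemma bij_betw_mult_units:
  assumes "v > 0" "t \<in> units_mod v"
  shows "bij_betw (\<lambda>a. a * t mod v) (units_mod v) (units_mod v)"
proof (rule bij_betw_byWitness[where f' = "\<lambda>a. a * modular_inverse v t mod v"])
  have *: "a * s mod v * t mod v = a" if "[s * t = 1] (mod v)" "a \<in> units_mod v" for a s t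
  proof -
    have "a * s mod v * t mod v = (a * (s * t)) mod v" by (simp add: mod_simps mult_ac)
    also have "\<dots> = (a * 1) mod v"
      using that by (metis Cong.cong_def cong_scalar_left)
    finally show ?thesis using that by (simp add: units_mod_def)
  qed
  have t: "coprime t v" using assms by (simp add: units_mod_def)
  show "\<forall>a\<in>units_mod v. a * t mod v * modular_inverse v t mod v = a"
    using *[OF cong_modular_inverse1[OF t]] by blast
  show "\<forall>a\<in>units_mod v. a * modular_inverse v t mod v * t mod v = a"
    using *[OF cong_modular_inverse2[OF t]] by blast
qed (use assms modular_inverse_in_units in \<open>auto simp: units_mod_def\<close>)

definition kloosterman :: "int \<Rightarrow> int \<Rightarrow> int \<Rightarrow> complex" where
  "kloosterman v h k = (\<Sum>a\<in>units_mod v. add_char v (h * a + k * modular_inverse v a))"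

lemma kloosterman_cong:
  assumes "v > 0" "[h = h'] (mod v)" "[k = k'] (mod v)"
  shows "kloosterman v h k = kloosterman v h' k'"
  unfolding kloosterman_def
  by (intro sum.cong add_char_cong cong_add cong_mult assms cong_refl) auto

text \<open>The summation variable \<open>a\<close> is replaced by \<open>a * t mod v\<close>, whose
  inverse is the product of the inverses.\<close>

lemma kloosterman_dilate:
  assumes "v > 0" "t \<in> units_mod v"
  shows "kloosterman v (h * t) (k * modular_inverse v t) = kloosterman v h k"
proof -
  have "kloosterman v h k = (\<Sum>a\<in>units_mod v. add_char v (h * (a * t mod v) + k * modular_inverse v (a * t mod v)))"
    unfolding kloosterman_def by (rule sum.reindex_bij_betw[OF bij_betw_mult_units[OF assms], symmetric])
  also have "\<dots> = kloosterman v (h * t) (k * modular_inverse v t)"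
    unfolding kloosterman_def
  proof (rule sum.cong[OF refl], rule add_char_cong[OF assms(1)], rule cong_add)
    fix a assume a: "a \<in> units_mod v"
    show "[h * (a * t mod v) = h * t * a] (mod v)"
      by (simp add: Cong.cong_def mod_simps mult_ac)
    have "modular_inverse v (a * t mod v) = modular_inverse v a * modular_inverse v t mod v"
    proof (rule modular_inverse_units_eqI)
      have "[a * t mod v * (modular_inverse v a * modular_inverse v t mod v)
             = (a * t) * (modular_inverse v a * modular_inverse v t)] (mod v)"
        by (intro cong_mult) (simp_all add: Cong.cong_def)
      also have "(a * t) * (modular_inverse v a * modular_inverse v t) =
          (a * modular_inverse v a) * (t * modular_inverse v t)" by (simp add: mult_ac)
      also have "[(a * modular_inverse v a) * (t * modular_inverse v t) = 1 * 1] (mod v)"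
        using a assms by (intro cong_mult cong_modular_inverse1) (auto simp: units_mod_def)
      finally show "[a * t mod v * (modular_inverse v a * modular_inverse v t mod v) = 1] (mod v)" by simp
    qed (use assms in auto)
    then show "[k * modular_inverse v (a * t mod v) = k * modular_inverse v t * modular_inverse v a] (mod v)"
      by (simp add: Cong.cong_def mod_simps mult_ac)
  qed
  finally show ?thesis ..
qed

definition pair_coincidences :: "int \<Rightarrow> ((int \<times> int) \<times> int \<times> int) set" where
  "pair_coincidences v = {((a, b), (c, d)). a \<in> units_mod v \<and> b \<in> units_mod v \<and> c \<in> units_mod v \<and> d \<in> units_mod v \<and>
      [a + b = c + d] (mod v) \<and>
      [modular_inverse v a + modular_inverse v b = modular_inverse v c + modular_inverse v d] (mod v)}"

text \<open>The square of a Kloosterman sum is an exponential sum over pairs of units, so its second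
  moment is given by \<open>parseval_two\<close> and becomes a counting problem.\<close>

lemma kloosterman_fourth_moment:
  assumes "v > 0"
  shows "(\<Sum>h\<in>{0..<v}. \<Sum>k\<in>{0..<v}. norm (kloosterman v h k) ^ 4)
       = (of_int v)\<^sup>2 * real (card (pair_coincidences v))"
proof -
  let ?X = "units_mod v \<times> units_mod v"
  have sq: "norm (kloosterman v h k) ^ 4 = (norm (\<Sum>x\<in>?X. add_char v (h * (fst x + snd x)
       + k * (modular_inverse v (fst x) + modular_inverse v (snd x)))))\<^sup>2" for h k
  proof -
    have "(kloosterman v h k)\<^sup>2 = (\<Sum>x\<in>?X. add_char v (h * (fst x + snd x)
       + k * (modular_inverse v (fst x) + modular_inverse v (snd x))))"
      by (simp add: kloosterman_def power2_eq_square sum_product sum.cartesian_product case_prod_unfold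
            add_char_add[symmetric] algebra_simps)
    then show ?thesis
      by (metis norm_power power_mult numeral_Bit0 mult_2 mult.commute mult_2_right)
  qed
  have "{(x, y). x \<in> ?X \<and> y \<in> ?X \<and> [fst x + snd x = fst y + snd y] (mod v) \<and>
     [modular_inverse v (fst x) + modular_inverse v (snd x) = modular_inverse v (fst y) + modular_inverse v (snd y)] (mod v)}
     = pair_coincidences v"
    by (auto simp: pair_coincidences_def)
  then show ?thesis
    unfolding sq using parseval_two[OF assms, of ?X "\<lambda>x. fst x + snd x"
       "\<lambda>x. modular_inverse v (fst x) + modular_inverse v (snd x)"] by simp
qed

section \<open>Counting the coincidences in the fourth moment\<close>

lemma card_simultaneous_cong:
  fixes v d e x y :: int
  assumes "v > 0" "d > 0" "e > 0" "lcm d e dvd v"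
  shows "int (card {z \<in> {0..<v}. d dvd z - x \<and> e dvd z - y}) \<le> v div lcm d e"
proof (rule card_cong_class_dvd)
  show "[z = w] (mod lcm d e)" if "z \<in> {z \<in> {0..<v}. d dvd z - x \<and> e dvd z - y}"
    "w \<in> {z \<in> {0..<v}. d dvd z - x \<and> e dvd z - y}" for z w
  proof -
    have "d dvd z - w" "e dvd z - w"
      using that dvd_diff[of d "z - x" "w - x"] dvd_diff[of e "z - y" "w - y"] by auto
    then show ?thesis by (simp add: cong_iff_dvd_diff)
  qed
qed (use assms in \<open>auto intro: lcm_pos_int\<close>)

definition coincidence_class :: "int \<Rightarrow> int \<Rightarrow> int \<Rightarrow> int \<Rightarrow> (int \<times> int) set" where
  "coincidence_class D e f a = {(b, c). b \<in> {0..<D * e * f} \<and> c \<in> {0..<D * e * f} \<and>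
     D dvd a + b \<and> e dvd c - a \<and> f dvd c - b}"

lemma finite_coincidence_class [simp]: "finite (coincidence_class D e f a)"
  by (rule finite_subset[of _ "{0..<D * e * f} \<times> {0..<D * e * f}"]) (auto simp: coincidence_class_def)

text \<open>Put g = gcd(e, f). The last two conditions imply that g divides b - a, so
  \<open>b\<close> is fixed modulo lcm(D, g) and then \<open>c\<close> modulo lcm(e, f). As gcd(D,
  g) <= 2, the product of the two moduli is at least (D g / 2) (e f / g), which is half of
  \<open>D * e * f\<close>.\<close>

lemma card_coincidence_class:
  fixes D e f a :: int
  assumes "D > 0" "e > 0" "f > 0" "coprime a (D * e * f)"
  shows "int (card (coincidence_class D e f a)) \<le> 2 * (D * e * f)"
proof (cases "coincidence_class D e f a = {}")
  case False
  define v where "v = D * e * f"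
  define g where "g = gcd e f"
  have v: "v > 0" using assms by (simp add: v_def)
  have g: "g > 0" "g dvd e" "g dvd f" using assms by (auto simp: g_def gcd_pos_int)
  have l1: "lcm D g dvd v"
    unfolding v_def mult.assoc by (intro lcm_least) (use g in auto)
  have l2: "lcm e f dvd v"
    unfolding v_def by (intro lcm_least) auto
  have lp: "lcm D g > 0" "lcm e f > 0" using assms g by (auto intro: lcm_pos_int)
  let ?B = "{b \<in> {0..<v}. D dvd b - (- a) \<and> g dvd b - a}"
  let ?C = "\<lambda>b. {c \<in> {0..<v}. e dvd c - a \<and> f dvd c - b}"
  have sub: "coincidence_class D e f a \<subseteq> (SIGMA b:?B. ?C b)"
  proof
    fix z assume "z \<in> coincidence_class D e f a"
    moreover obtain b c where z: "z = (b, c)" by (cases z)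
    ultimately have H: "b \<in> {0..<v}" "c \<in> {0..<v}" "D dvd a + b" "e dvd c - a" "f dvd c - b"
      by (auto simp: coincidence_class_def v_def)
    have "g dvd (c - a) - (c - b)" using H g by (meson dvd_diff dvd_trans)
    then show "z \<in> (SIGMA b:?B. ?C b)" using H z by (auto simp: add.commute)
  qed
  \<comment> \<open>One admissible \<open>b\<close> suffices: it is -a modulo \<open>D\<close> and a
    modulo \<open>g\<close>, so gcd(D, g) divides 2 a. It is coprime to \<open>a\<close>, hence
    divides 2.\<close>
  have "?B \<noteq> {}" using False sub by auto
  then obtain b where b: "D dvd b - (- a)" "g dvd b - a" by blast
  have "gcd D g dvd (b - (- a)) - (b - a)"
    using b by (meson dvd_diff dvd_trans gcd_dvd1 gcd_dvd2)
  then have "gcd D g dvd 2 * a" by simp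
  moreover have "gcd D g dvd D * e * f" by (simp add: mult.assoc)
  then have "coprime (gcd D g) a" using assms(4) by (metis coprime_commute coprime_divisors dvd_refl)
  ultimately have "gcd D g dvd 2" by (simp add: coprime_dvd_mult_left_iff)
  then have g2: "gcd D g \<le> 2" by (rule zdvd_imp_le) simp
  have cC: "int (card (?C b)) \<le> v div lcm e f" for b
    by (rule card_simultaneous_cong) (use v assms l2 in auto)
  have fin: "finite {z \<in> {0..<v}. P z}" for P by (rule finite_subset[of _ "{0..<v}"]) auto
  have "card (coincidence_class D e f a) \<le> card (SIGMA b:?B. ?C b)"
    by (rule card_mono[OF _ sub]) (intro finite_SigmaI fin)
  then have "int (card (coincidence_class D e f a)) \<le> int (card (SIGMA b:?B. ?C b))" by simp
  also have "card (SIGMA b:?B. ?C b) = (\<Sum>b\<in>?B. card (?C b))"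
    by (rule card_SigmaI) (intro fin ballI)+
  also have "int \<dots> = (\<Sum>b\<in>?B. int (card (?C b)))" by (rule of_nat_sum)
  also have "\<dots> \<le> (\<Sum>b\<in>?B. v div lcm e f)" by (rule sum_mono) (rule cC)
  also have "\<dots> = int (card ?B) * (v div lcm e f)" by simp
  also have "\<dots> \<le> (v div lcm D g) * (v div lcm e f)"
    by (intro mult_right_mono card_simultaneous_cong)
       (use v assms g l1 lp in \<open>auto simp: pos_imp_zdiv_nonneg_iff\<close>)
  finally have 1: "int (card (coincidence_class D e f a)) \<le> (v div lcm D g) * (v div lcm e f)" .
  have "lcm D g * 2 \<ge> lcm D g * gcd D g" using g2 lp by (intro mult_left_mono) auto
  also have "lcm D g * gcd D g = D * g" using assms g by (simp add: lcm_gcd_prod[symmetric] mult.commute abs_mult)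
  finally have "(D * g) * lcm e f \<le> lcm D g * 2 * lcm e f" using lp by (intro mult_right_mono) auto
  moreover have "g * lcm e f = e * f" using assms by (simp add: g_def prod_gcd_lcm_int[symmetric] abs_mult)
  ultimately have 2: "v \<le> 2 * (lcm D g * lcm e f)" by (simp add: v_def mult_ac)
  obtain p q where pq: "v = lcm D g * p" "v = lcm e f * q" using l1 l2 by (meson dvdE)
  have "p > 0" "q > 0" using pq v lp by (metis zero_less_mult_pos)+
  have "v * (p * q) \<le> 2 * (lcm D g * lcm e f) * (p * q)"
    using 2 \<open>p > 0\<close> \<open>q > 0\<close> by (intro mult_right_mono) auto
  also have "\<dots> = 2 * (lcm D g * p) * (lcm e f * q)" by (simp add: mult_ac)
  also have "\<dots> = v * (2 * v)" using pq by simp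
  finally have "p * q \<le> 2 * v" using v by simp
  moreover have "v div lcm D g = p" "v div lcm e f = q"
    using pq lp by (metis less_numeral_extra(3) nonzero_mult_div_cancel_left)+
  ultimately show ?thesis using 1 by (simp add: v_def)
qed (use assms in simp)

definition pos_divisors :: "int \<Rightarrow> int set" where
  "pos_divisors v = {d. d > 0 \<and> d dvd v}"

lemma finite_pos_divisors [simp]: "v > 0 \<Longrightarrow> finite (pos_divisors v)"
  by (rule finite_subset[of _ "{1..v}"]) (auto simp: pos_divisors_def zdvd_imp_le)

text \<open>
  The two congruences give \<open>(a + b) (c d - a b) = 0\<close> modulo \<open>v\<close>. Dividing by
  \<open>D = gcd (a + b) v\<close> and inserting \<open>d = a + b - c\<close> yields \<open>(c - a) (c - b) = 0\<close> modulo \<open>v / D\<close>.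
\<close>
lemma pair_coincidence_factors:
  assumes v: "v > 0" and H: "((a, b), (c, d)) \<in> pair_coincidences v"
  shows "\<exists>D\<in>pos_divisors v. \<exists>e\<in>pos_divisors v. \<exists>f>0. v = D * e * f \<and> (b, c) \<in> coincidence_class D e f a"
proof -
  define D where "D = gcd (a + b) v"
  have D: "D > 0" "D dvd v" "D dvd a + b" using v by (auto simp: D_def gcd_pos_int)
  obtain n where n: "v = D * n" using D by blast
  have n0: "n > 0" using n v D by (metis zero_less_mult_pos)
  \<comment> \<open>The factors of n = e f will share the divisibility of (c - a) (c - b) by
    \<open>n\<close>: \<open>e\<close> takes all that c - a can contribute, and \<open>f\<close>
    must then divide c - b.\<close>
  define e where "e = gcd (c - a) n"
  have e: "e > 0" "e dvd n" "e dvd c - a" using n0 by (auto simp: e_def gcd_pos_int)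
  obtain f where f: "n = e * f" using e by blast
  have f0: "f > 0" using f n0 e by (metis zero_less_mult_pos)
  let ?i = "modular_inverse v"
  have U: "a \<in> {0..<v}" "b \<in> {0..<v}" "c \<in> {0..<v}" "d \<in> {0..<v}"
      "coprime a v" "coprime b v" "coprime c v" "coprime d v"
    and s1: "[a + b = c + d] (mod v)" and s2: "[?i a + ?i b = ?i c + ?i d] (mod v)"
    using H by (auto simp: pair_coincidences_def units_mod_def)
  have inv: "[a * ?i a = 1] (mod v)" "[b * ?i b = 1] (mod v)" "[c * ?i c = 1] (mod v)" "[d * ?i d = 1] (mod v)"
    using U by (auto intro: cong_modular_inverse1)
  \<comment> \<open>Multiplying the congruence between the inverses by a b c d clears all of
    them.\<close>
  have "[(a + b) * (c * d) = (a * b * c * d) * (?i a + ?i b)] (mod v)"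
  proof -
    have "[(b * c * d) * (a * ?i a) + (a * c * d) * (b * ?i b) = (b * c * d) * 1 + (a * c * d) * 1] (mod v)"
      by (intro cong_add cong_mult inv cong_refl)
    then show ?thesis by (simp add: algebra_simps cong_sym)
  qed
  also have "[(a * b * c * d) * (?i a + ?i b) = (a * b * c * d) * (?i c + ?i d)] (mod v)"
    by (intro cong_mult cong_refl s2)
  also have "[(a * b * c * d) * (?i c + ?i d) = (c + d) * (a * b)] (mod v)"
  proof -
    have "[(a * b * d) * (c * ?i c) + (a * b * c) * (d * ?i d) = (a * b * d) * 1 + (a * b * c) * 1] (mod v)"
      by (intro cong_add cong_mult inv cong_refl)
    then show ?thesis by (simp add: algebra_simps cong_sym)
  qed
  also have "[(c + d) * (a * b) = (a + b) * (a * b)] (mod v)"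
    by (intro cong_mult cong_refl cong_sym[OF s1])
  finally have "v dvd (a + b) * (c * d) - (a + b) * (a * b)" by (simp add: cong_iff_dvd_diff)
  then have "v dvd (a + b) * (c * d - a * b)" by (simp add: right_diff_distrib)
  obtain k where k: "a + b = D * k" using D by blast
  have "D * gcd k n = gcd (D * k) (D * n)" using D gcd_mult_distrib_int[of D k n] by simp
  also have "\<dots> = D" by (simp only: k[symmetric] n[symmetric] D_def[symmetric])
  finally have "coprime k n" using D by (simp add: coprime_iff_gcd_eq_1)
  have "D * n dvd D * (k * (c * d - a * b))"
    using \<open>v dvd (a + b) * (c * d - a * b)\<close> by (simp only: k n[symmetric] mult.assoc[symmetric])
  then have "n dvd k * (c * d - a * b)" using D by simp
  then have n1: "n dvd c * d - a * b" using \<open>coprime k n\<close> by (simp add: coprime_commute coprime_dvd_mult_right_iff)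
  have "n dvd (a + b) - (c + d)" using s1 n by (metis cong_iff_dvd_diff dvd_trans dvd_triv_right)
  then have "n dvd c * ((a + b) - (c + d)) + (c * d - a * b)" using n1 by (intro dvd_add dvd_mult)
  then have "n dvd - ((c - a) * (c - b))" by (simp add: algebra_simps)
  then have n2: "n dvd (c - a) * (c - b)" by simp
  obtain l where l: "c - a = e * l" using e by blast
  have "e * gcd l f = gcd (e * l) (e * f)" using e gcd_mult_distrib_int[of e l f] by simp
  also have "\<dots> = e" by (simp only: l[symmetric] f[symmetric] e_def[symmetric])
  finally have "coprime l f" using e by (simp add: coprime_iff_gcd_eq_1)
  have "e * f dvd e * (l * (c - b))" using n2 unfolding l f by (simp add: mult.assoc)
  then have "f dvd l * (c - b)" using e by simp
  then have "f dvd c - b" using \<open>coprime l f\<close> by (simp add: coprime_commute coprime_dvd_mult_right_iff)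
  then have "(b, c) \<in> coincidence_class D e f a"
    using U D e by (auto simp: coincidence_class_def n f mult.assoc)
  moreover have "e dvd v" using e n by simp
  moreover have "v = D * e * f" using n f by (simp add: mult.assoc)
  ultimately show ?thesis using D e f0 by (intro bexI[of _ D] bexI[of _ e] exI[of _ f]) (auto simp: pos_divisors_def)
qed

text \<open>The entry \<open>d\<close> is determined by the other three. The factorisation v = D e f
  is determined by two divisors of \<open>v\<close>, \<open>a\<close> has at most \<open>v\<close>
  values, and (b, c) has at most 2 v by \<open>card_coincidence_class\<close>.\<close>

lemma card_pair_coincidences:
  assumes "v > 0"
  shows "int (card (pair_coincidences v)) \<le> 2 * v\<^sup>2 * (int (card (pos_divisors v)))\<^sup>2"
proof -
  let ?P = "{(D, e). D \<in> pos_divisors v \<and> e \<in> pos_divisors v \<and> D * e dvd v}"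
  let ?T = "\<lambda>(D, e). (SIGMA a:units_mod v. coincidence_class D e (v div (D * e)) a)"
  let ?f = "\<lambda>((a::int, b::int), (c::int, d::int)). (a, (b, c))"
  have finP: "finite ?P"
    by (rule finite_subset[of _ "pos_divisors v \<times> pos_divisors v"]) (use assms in auto)
  have cardP: "card ?P \<le> card (pos_divisors v) * card (pos_divisors v)"
    unfolding card_cartesian_product[symmetric]
    by (rule card_mono) (use assms in auto)
  have inj: "inj_on ?f (pair_coincidences v)"
  proof (rule inj_onI, clarsimp)
    fix a b c d d' assume "((a, b), c, d) \<in> pair_coincidences v" "((a, b), c, d') \<in> pair_coincidences v"
    then have "[c + d = c + d'] (mod v)" "d \<in> {0..<v}" "d' \<in> {0..<v}"
      by (auto simp: pair_coincidences_def units_mod_def intro: cong_trans cong_sym)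
    then have "v dvd d - d'" by (simp add: cong_iff_dvd_diff)
    then have "d mod v = d' mod v" by (simp add: mod_eq_dvd_iff)
    then show "d = d'" using \<open>d \<in> _\<close> \<open>d' \<in> _\<close> by simp
  qed
  have sub: "?f ` pair_coincidences v \<subseteq> (\<Union>p\<in>?P. ?T p)"
  proof safe
    fix a b c d assume H: "((a, b), (c, d)) \<in> pair_coincidences v"
    then obtain D e f where *: "D \<in> pos_divisors v" "e \<in> pos_divisors v" "f > 0" "v = D * e * f"
        "(b, c) \<in> coincidence_class D e f a" using pair_coincidence_factors[OF assms] by blast
    have "D * e \<noteq> 0" using * by (auto simp: pos_divisors_def)
    then have "v div (D * e) = f" using *(4) by simp
    moreover have "a \<in> units_mod v" using H by (auto simp: pair_coincidences_def)
    moreover have "D * e dvd v" using * by simp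
    ultimately show "(a, (b, c)) \<in> (\<Union>p\<in>?P. ?T p)" using *(1,2,5) by (intro UN_I[of "(D, e)"]) auto
  qed
  have cT: "int (card (?T p)) \<le> 2 * v\<^sup>2" if "p \<in> ?P" for p
  proof -
    obtain D e where p: "p = (D, e)" by (cases p)
    then have De: "D > 0" "e > 0" "D * e dvd v" using that by (auto simp: pos_divisors_def)
    then obtain f where f: "v = D * e * f" by blast
    have "f > 0" using f De assms by (metis mult_pos_pos zero_less_mult_pos)
    have vf: "v div (D * e) = f" using f De by simp
    have "int (card (?T p)) = (\<Sum>a\<in>units_mod v. int (card (coincidence_class D e f a)))"
      unfolding p vf by (simp add: card_SigmaI vf)
    also have "\<dots> \<le> (\<Sum>a\<in>units_mod v. 2 * v)"
      by (rule sum_mono) (use card_coincidence_class De \<open>f > 0\<close> f in \<open>auto simp: units_mod_def\<close>)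
    also have "\<dots> = int (card (units_mod v)) * (2 * v)" by simp
    also have "\<dots> \<le> v * (2 * v)"
    proof (rule mult_right_mono)
      have "card (units_mod v) \<le> card {0..<v}" by (rule card_mono) (auto simp: units_mod_def)
      then show "int (card (units_mod v)) \<le> v" using assms by simp
    qed (use assms in auto)
    finally show ?thesis by (simp add: power2_eq_square)
  qed
  have finT: "finite (?T p)" for p by (cases p) auto
  have "card (pair_coincidences v) = card (?f ` pair_coincidences v)" by (simp add: card_image[OF inj])
  also have "\<dots> \<le> card (\<Union>p\<in>?P. ?T p)" by (rule card_mono[OF _ sub]) (use finP finT in auto)
  also have "\<dots> \<le> (\<Sum>p\<in>?P. card (?T p))" by (rule card_UN_le[OF finP])
  finally have "int (card (pair_coincidences v)) \<le> int (\<Sum>p\<in>?P. card (?T p))" by (rule of_nat_mono)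
  also have "\<dots> = (\<Sum>p\<in>?P. int (card (?T p)))" by (rule of_nat_sum)
  finally have "int (card (pair_coincidences v)) \<le> (\<Sum>p\<in>?P. int (card (?T p)))" .
  also have "\<dots> \<le> (\<Sum>p\<in>?P. 2 * v\<^sup>2)" by (rule sum_mono) (rule cT)
  also have "\<dots> = int (card ?P) * (2 * v\<^sup>2)" by simp
  also have "\<dots> \<le> int (card (pos_divisors v) * card (pos_divisors v)) * (2 * v\<^sup>2)"
    using cardP by (intro mult_right_mono) (auto simp del: of_nat_mult)
  finally show ?thesis by (simp add: power2_eq_square mult_ac)
qed

section \<open>A bound for the individual Kloosterman sum\<close>

lemma card_units_mod:
  assumes "v > 1"
  shows "card (units_mod v) = totient (nat v)"
proof -
  have "bij_betw nat (units_mod v) (totatives (nat v))"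
  proof (rule bij_betw_byWitness[where f' = int])
    have "nat a \<in> totatives (nat v)" if "a \<in> units_mod v" for a
    proof -
      have "a \<noteq> 0" using that assms by (auto simp: units_mod_def)
      then show ?thesis using that assms
        by (auto simp: units_mod_def totatives_def coprime_nat_abs_left_iff coprime_int_iff[symmetric] simp del: coprime_int_iff)
    qed
    then show "nat ` units_mod v \<subseteq> totatives (nat v)" by blast
    have "int a \<in> units_mod v" if "a \<in> totatives (nat v)" for a
    proof -
      have "a \<noteq> nat v" using that assms by (auto simp: totatives_def)
      moreover have "coprime (int a) (int (nat v))"
        using that by (simp only: coprime_int_iff totatives_def mem_Collect_eq)
      then have "coprime (int a) v" using assms by simp
      ultimately show ?thesis using that assms by (auto simp: units_mod_def totatives_def)
    qed
    then show "int ` totatives (nat v) \<subseteq> units_mod v" by blast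
  qed (use assms in \<open>auto simp: units_mod_def\<close>)
  then show ?thesis by (simp add: totient_def bij_betw_same_card)
qed

lemma card_pos_divisors:
  assumes "v > 0"
  shows "card (pos_divisors v) = card {d. d dvd nat v}"
proof -
  have "bij_betw nat (pos_divisors v) {d. d dvd nat v}"
  proof (rule bij_betw_byWitness[where f' = int])
    show "nat ` pos_divisors v \<subseteq> {d. d dvd nat v}"
      using assms by (auto simp: pos_divisors_def nat_dvd_iff)
    show "int ` {d. d dvd nat v} \<subseteq> pos_divisors v"
    proof safe
      fix d assume d: "d dvd nat v"
      then have "int d dvd int (nat v)" by (simp only: int_dvd_int_iff)
      moreover have "d > 0" using d assms dvd_pos_nat[of "nat v" d] by simp
      ultimately show "int d \<in> pos_divisors v" using assms by (simp add: pos_divisors_def)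
    qed
  qed (auto simp: pos_divisors_def)
  then show ?thesis by (rule bij_betw_same_card)
qed

text \<open>In the formula for n as the sum of the totients of its divisors every summand is at most
  the totient of n. This serves as a lower bound for the number of units, at the price of a divisor
  function.\<close>

lemma le_totient_times_divisors: "n \<le> totient n * card {d. d dvd n}"
proof (cases "n = 0")
  case False
  have "n = (\<Sum>d | d dvd n. totient d)" by (simp add: totient_divisor_sum)
  also have "\<dots> \<le> (\<Sum>d | d dvd n. totient n)"
  proof (rule sum_mono)
    fix d assume "d \<in> {d. d dvd n}"
    then show "totient d \<le> totient n" using False by (auto intro!: totient_dvd_mono dvd_imp_le simp: totient_dvd)
  qed
  finally show ?thesis by (simp add: mult.commute)
qed simp

text \<open>The residue of k w modulo \<open>v\<close> fixes w modulo v / gcd(k, v), which leaves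
  gcd(k, v) classes, and inversion is injective on the units.\<close>

lemma card_dilation_fibre:
  assumes "v > 0"
  shows "card {t \<in> units_mod v. k * modular_inverse v t mod v = c} \<le> nat (gcd k v)"
proof -
  let ?A = "{w \<in> {0..<v}. k * w mod v = c}"
  obtain n where n: "v = gcd k v * n" by (meson dvdE gcd_dvd2)
  have g: "gcd k v > 0" using assms by (simp add: gcd_pos_int)
  have n0: "n > 0" using n g assms by (metis zero_less_mult_pos)
  have "v div n = gcd k v" using n n0 by (metis less_numeral_extra(3) nonzero_mult_div_cancel_right)
  have "card {t \<in> units_mod v. k * modular_inverse v t mod v = c} \<le> card ?A"
  proof (rule card_inj_on_le[where f = "modular_inverse v"])
    show "inj_on (modular_inverse v) {t \<in> units_mod v. k * modular_inverse v t mod v = c}"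
      using bij_betw_modular_inverse[OF assms] by (auto simp: bij_betw_def intro: inj_on_subset)
    show "finite ?A" by (rule finite_subset[of _ "{0..<v}"]) auto
  qed (use assms in \<open>auto simp: modular_inverse_int_nonneg modular_inverse_int_less\<close>)
  moreover have "int (card ?A) \<le> v div n"
  proof (rule card_cong_class_dvd)
    show "n dvd v" using n by (metis dvd_triv_right)
    fix x y assume "x \<in> ?A" "y \<in> ?A"
    then have "v dvd k * (x - y)" by (simp add: right_diff_distrib mod_eq_dvd_iff[symmetric])
    obtain l where l: "k = gcd k v * l" by (meson dvdE gcd_dvd1)
    have "gcd k v * gcd l n = gcd (gcd k v * l) (gcd k v * n)" 
      using gcd_mult_distrib_int[of "gcd k v" l n] g by simp
    also have "\<dots> = gcd k v" using l n by simp
    finally have "gcd k v * gcd l n = gcd k v * 1" by simp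
    then have "gcd l n = 1" using g mult_left_cancel[of "gcd k v"] by (metis less_irrefl)
    then have "coprime l n" by (simp add: coprime_iff_gcd_eq_1)
    have "gcd k v * n dvd gcd k v * (l * (x - y))"
      using \<open>v dvd k * (x - y)\<close> l n by (metis mult.assoc)
    then have "n dvd l * (x - y)" using g dvd_mult_cancel_left[of "gcd k v" n "l * (x - y)"] by linarith
    then have "n dvd x - y" using \<open>coprime l n\<close> by (simp add: coprime_commute coprime_dvd_mult_right_iff)
    then show "[x = y] (mod n)" by (simp add: cong_iff_dvd_diff)
  qed (use assms n0 in auto)
  ultimately show ?thesis using \<open>v div n = gcd k v\<close> by linarith
qed

text \<open>
  The sum \<open>S(h, k)\<close> equals \<open>S(h t, k t\<^sup>-\<^sup>1)\<close> for every unit \<open>t\<close>, so a single large value forces many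
  large values in the fourth moment.
\<close>
lemma kloosterman_fourth_power_le:
  assumes "v > 0"
  shows "real (card (units_mod v)) * norm (kloosterman v h k) ^ 4
    \<le> real_of_int (gcd k v) * (\<Sum>h\<in>{0..<v}. \<Sum>k\<in>{0..<v}. norm (kloosterman v h k) ^ 4)"
proof -
  define F where "F = (\<lambda>(h, k). norm (kloosterman v h k) ^ 4)"
  define \<phi> where "\<phi> t = (h * t mod v, k * modular_inverse v t mod v)" for t
  let ?Y = "{0..<v} \<times> {0..<v}"
  have F: "F (\<phi> t) = norm (kloosterman v h k) ^ 4" if "t \<in> units_mod v" for t
  proof -
    have "kloosterman v (h * t mod v) (k * modular_inverse v t mod v) =
          kloosterman v (h * t) (k * modular_inverse v t)"
      by (rule kloosterman_cong) (use assms in \<open>auto simp: Cong.cong_def\<close>)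
    then show ?thesis using kloosterman_dilate[OF assms that] by (simp add: F_def \<phi>_def)
  qed
  have "real (card (units_mod v)) * norm (kloosterman v h k) ^ 4 = (\<Sum>t\<in>units_mod v. F (\<phi> t))"
    by (simp add: F)
  \<comment> \<open>The dilations are sorted by the frequency pair that they reach. A pair is
    reached at most gcd(k, v) times, as already its second entry shows.\<close>
  also have "\<dots> = (\<Sum>y\<in>?Y. \<Sum>t | t \<in> units_mod v \<and> \<phi> t = y. F (\<phi> t))"
    by (rule sum.group[symmetric]) (use assms in \<open>auto simp: \<phi>_def\<close>)
  also have "\<dots> = (\<Sum>y\<in>?Y. real (card {t \<in> units_mod v. \<phi> t = y}) * F y)"
    by (intro sum.cong refl) simp
  also have "\<dots> \<le> (\<Sum>y\<in>?Y. real_of_int (gcd k v) * F y)"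
  proof (intro sum_mono mult_right_mono)
    fix y :: "int \<times> int"
    have "card {t \<in> units_mod v. \<phi> t = y} \<le> card {t \<in> units_mod v. k * modular_inverse v t mod v = snd y}"
      by (rule card_mono) (auto simp: \<phi>_def)
    also have "\<dots> \<le> nat (gcd k v)" by (rule card_dilation_fibre[OF assms])
    finally have "int (card {t \<in> units_mod v. \<phi> t = y}) \<le> gcd k v" by (simp add: le_nat_iff)
    then show "real (card {t \<in> units_mod v. \<phi> t = y}) \<le> real_of_int (gcd k v)"
      by (metis of_int_le_iff of_int_of_nat_eq)
    show "0 \<le> F y" by (simp add: F_def case_prod_unfold)
  qed
  also have "\<dots> = real_of_int (gcd k v) * (\<Sum>y\<in>?Y. F y)" by (simp add: sum_distrib_left)
  also have "(\<Sum>y\<in>?Y. F y) = (\<Sum>h\<in>{0..<v}. \<Sum>k\<in>{0..<v}. norm (kloosterman v h k) ^ 4)"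
    unfolding F_def by (simp add: sum.cartesian_product)
  finally show ?thesis .
qed

text \<open>With T the number of divisors of \<open>v\<close>, the fourth moment is at most 2 v^4
  T^2, and at least v / T dilations repeat the value, each frequency pair occurring at most g =
  gcd(k, v) times. Hence the fourth power is at most 2 g v^3 T^3.\<close>

lemma kloosterman_bound:
  assumes "v > 1"
  shows "norm (kloosterman v h k) \<le> 2 * real_of_int (gcd k v) * real (card (pos_divisors v)) * real_of_int v powr (3/4)"
proof -
  define N where "N = norm (kloosterman v h k)"
  define g where "g = real_of_int (gcd k v)"
  define T where "T = real (card (pos_divisors v))"
  define V where "V = real_of_int v"
  define P where "P = real (card (units_mod v))"
  have "gcd k v > 0" using assms by (simp add: gcd_pos_int)
  then have g: "g \<ge> 1" unfolding g_def by linarith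
  have "1 \<in> pos_divisors v" by (simp add: pos_divisors_def)
  then have "card (pos_divisors v) > 0" using assms by (auto simp: card_gt_0_iff)
  then have T: "T \<ge> 1" by (simp add: T_def)
  have V: "V > 0" using assms by (simp add: V_def)
  have "nat v \<le> card (units_mod v) * card (pos_divisors v)"
    using le_totient_times_divisors[of "nat v"] assms by (simp add: card_units_mod card_pos_divisors)
  then have "real (nat v) \<le> real (card (units_mod v) * card (pos_divisors v))" by (rule of_nat_mono)
  then have PT: "V \<le> P * T" using assms by (simp add: V_def P_def T_def)
  have "real_of_int (int (card (pair_coincidences v))) \<le> real_of_int (2 * v\<^sup>2 * (int (card (pos_divisors v)))\<^sup>2)"
    using card_pair_coincidences[of v] assms by (simp only: of_int_le_iff)
  then have R: "real (card (pair_coincidences v)) \<le> 2 * V\<^sup>2 * T\<^sup>2" by (simp add: V_def T_def)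
  have "V * N ^ 4 \<le> T * (P * N ^ 4)" using mult_right_mono[OF PT, of "N ^ 4"] by (simp add: mult_ac N_def)
  also have "P * N ^ 4 \<le> g * (V\<^sup>2 * real (card (pair_coincidences v)))"
    using kloosterman_fourth_power_le[of v h k] assms kloosterman_fourth_moment[of v]
    by (simp add: N_def P_def g_def V_def)
  also have "\<dots> \<le> g * (V\<^sup>2 * (2 * V\<^sup>2 * T\<^sup>2))" using R g by (intro mult_left_mono) auto
  finally have "V * N ^ 4 \<le> T * (g * (V\<^sup>2 * (2 * V\<^sup>2 * T\<^sup>2)))" using T by simp
  also have "\<dots> = V * (2 * g * V ^ 3 * T ^ 3)" by (simp add: power2_eq_square power3_eq_cube)
  finally have 1: "N ^ 4 \<le> 2 * g * V ^ 3 * T ^ 3" using V by simp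
  \<comment> \<open>Since g and T are at least 1, all factors except the power of v can be rounded
    up to fourth powers, with 16 = 2^4.\<close>
  also have "\<dots> \<le> 16 * g ^ 4 * V ^ 3 * T ^ 4"
  proof -
    have "g ^ 1 \<le> g ^ 4" using g by (intro power_increasing) auto
    moreover have "T ^ 3 \<le> T ^ 4" using T by (intro power_increasing) auto
    ultimately show ?thesis using g T V by (intro mult_mono) auto
  qed
  also have "\<dots> = (2 * g * T * V powr (3/4)) ^ 4"
  proof -
    have "(V powr (3/4)) ^ 4 = (V powr (3/4)) powr 4" using V by (subst powr_numeral) auto
    also have "\<dots> = V powr 3" by (simp add: powr_powr)
    also have "\<dots> = V ^ 3" using V by (subst powr_numeral) auto
    finally show ?thesis by (simp add: power_mult_distrib)
  qed
  finally have "N \<le> 2 * g * T * V powr (3/4)" using g T by (subst (asm) power_mono_iff) (auto simp: N_def)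
  then show ?thesis by (simp add: N_def g_def T_def V_def)
qed

section \<open>Geometric sums of additive characters\<close>

lemma sin_ge_half:
  assumes "0 \<le> x" "x \<le> pi / 2"
  shows "sin x \<ge> x / 2"
proof -
  have s: "(\<Sum>m<3. sin_coeff m * x ^ m) = x" by (simp add: numeral_3_eq_3 sin_coeff_def)
  have f: "inverse (fact 3 :: real) = 1 / 6" by (simp add: fact_numeral)
  have 1: "\<bar>sin x - x\<bar> \<le> 1 / 6 * \<bar>x\<bar> ^ 3"
    using Maclaurin_sin_bound[of x 3] unfolding s f .
  \<comment> \<open>On x <= 1.6 the Taylor remainder x^3 / 6 is at most x / 2, because 1.6^2 = 2.56
    is below 3.\<close>
  have "pi \<le> 3.2" using pi_approx(2) by simp
  then have "x \<le> 1.6" using assms by simp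
  then have "x * x \<le> 1.6 * 1.6" using assms by (intro mult_mono) auto
  then have "x * (x * x) \<le> x * 3" using assms by (intro mult_left_mono) auto
  moreover have "\<bar>x\<bar> ^ 3 = x * (x * x)" using assms by (simp add: power3_eq_cube)
  ultimately show ?thesis using 1 by linarith
qed

text \<open>The modulus is 2 |sin (pi k / v)|. Replacing k by v - k if necessary brings the angle
  into the range of \<open>sin_ge_half\<close>, whose factor 1/2 is absorbed by pi / 2 >= 1.\<close>

lemma norm_add_char_minus_1:
  assumes "0 < k" "k < v"
  shows "norm (add_char v k - 1) \<ge> 2 * min (real_of_int k) (real_of_int (v - k)) / real_of_int v"
proof -
  have V: "real_of_int v > 0" using assms by simp
  have *: "sin (pi * m / of_int v) \<ge> m / of_int v" if "0 \<le> m" "2 * m \<le> real_of_int v" for m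
  proof -
    have "pi * m / of_int v / 2 \<le> sin (pi * m / of_int v)"
      by (rule sin_ge_half) (use that V in \<open>auto simp: field_simps\<close>)
    moreover have "m / of_int v * 1 \<le> m / of_int v * (pi / 2)"
      using that V pi_ge_two by (intro mult_left_mono) auto
    ultimately show ?thesis by (simp add: field_simps)
  qed
  have "sin (pi * of_int k / of_int v) = sin (pi - pi * of_int k / of_int v)" by simp
  also have "pi - pi * of_int k / of_int v = pi * of_int (v - k) / of_int v" using V by (simp add: field_simps)
  finally have s: "sin (pi * of_int k / of_int v) = sin (pi * of_int (v - k) / of_int v)" .
  have "min (real_of_int k) (real_of_int (v - k)) / of_int v \<le> sin (pi * of_int k / of_int v)"
  proof (cases "2 * k \<le> v")
    case True
    then have "min (real_of_int k) (real_of_int (v - k)) = of_int k" by simp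
    then show ?thesis using *[of "of_int k"] True assms by simp
  next
    case False
    then have "min (real_of_int k) (real_of_int (v - k)) = of_int (v - k)" by simp
    then show ?thesis unfolding s using *[of "of_int (v - k)"] False assms by simp
  qed
  also have "\<dots> \<le> \<bar>sin (pi * of_int k / of_int v)\<bar>" by simp
  also have "2 * \<dots> = norm (add_char v k - 1)"
    using dist_exp_i_1[of "2 * pi * of_int k / of_int v"] by (simp add: add_char_def cis_conv_exp)
  finally show ?thesis by simp
qed

text \<open>In the closed form of the geometric series the numerator has modulus at most 2 and the
  denominator is bounded by \<open>norm_add_char_minus_1\<close>. The two reciprocals replace the
  reciprocal of the minimum because their sum over \<open>k\<close> can be folded by
  reflection.\<close>

lemma interval_exp_sum_bound:
  assumes "0 < k" "k < v" "m \<le> n"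
  shows "norm (\<Sum>z\<in>{m..<n}. add_char v (k * z)) \<le> real_of_int v * (1 / real_of_int k + 1 / real_of_int (v - k))"
proof -
  have V: "real_of_int v > 0" using assms by simp
  have w1: "add_char v k \<noteq> 1" using assms by (simp add: add_char_eq_1_iff zdvd_not_zless)
  have "(\<Sum>z\<in>{m..<n}. add_char v (k * z)) = (\<Sum>j<nat (n - m). add_char v (k * (m + int j)))"
    by (rule sum.reindex_bij_witness[of _ "\<lambda>j. m + int j" "\<lambda>z. nat (z - m)"]) auto
  also have "\<dots> = add_char v (k * m) * (\<Sum>j<nat (n - m). add_char v k ^ j)"
    by (simp add: distrib_left add_char_add sum_distrib_left add_char_power[symmetric] mult.commute)
  also have "norm \<dots> = norm (add_char v k ^ nat (n - m) - 1) / norm (add_char v k - 1)"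
    using w1 by (simp add: norm_mult geometric_sum norm_divide)
  also have "\<dots> \<le> 2 / norm (add_char v k - 1)"
    by (intro divide_right_mono order.trans[OF norm_triangle_ineq4]) (auto simp: norm_power)
  also have "\<dots> \<le> 2 / (2 * min (real_of_int k) (real_of_int (v - k)) / real_of_int v)"
    using assms w1 by (intro divide_left_mono norm_add_char_minus_1 mult_pos_pos divide_pos_pos) auto
  also have "\<dots> = real_of_int v * (1 / min (real_of_int k) (real_of_int (v - k)))" by simp
  also have "\<dots> \<le> real_of_int v * (1 / real_of_int k + 1 / real_of_int (v - k))"
    using V assms by (intro mult_left_mono) (auto simp: min_def)
  finally show ?thesis .
qed

subsection \<open>Equidistribution of modular inverses\<close>

text \<open>The bias of the condition on inverses. The value 0 at the residue 0 and at the midpoint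
  leaves a function that is odd under \<open>w\<close> to \<open>v - w\<close> for 0 < w < v, hence
  has mean zero over a period.\<close>

definition half_sign :: "int \<Rightarrow> int \<Rightarrow> int" where
  "half_sign v w = (if 0 < w \<and> 2 * w < v then 1 else if v < 2 * w then -1 else 0)"

definition dft :: "int \<Rightarrow> (int \<Rightarrow> complex) \<Rightarrow> int \<Rightarrow> complex" where
  "dft v f h = (\<Sum>z\<in>{0..<v}. f z * add_char v (- (h * z)))"

lemma dft_inversion:
  assumes "v > 0" "u \<in> {0..<v}"
  shows "(\<Sum>h\<in>{0..<v}. dft v f h * add_char v (h * u)) = of_int v * f u"
proof -
  have "(\<Sum>h\<in>{0..<v}. dft v f h * add_char v (h * u)) = (\<Sum>h\<in>{0..<v}. \<Sum>z\<in>{0..<v}. f z * add_char v (h * (u - z)))"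
    unfolding dft_def sum_distrib_right
    by (intro sum.cong refl) (simp add: right_diff_distrib add_char_diff add_char_minus mult_ac)
  also have "\<dots> = (\<Sum>z\<in>{0..<v}. f z * (\<Sum>h\<in>{0..<v}. add_char v (h * (u - z))))"
    by (subst sum.swap) (simp add: sum_distrib_left)
  also have "\<dots> = (\<Sum>z\<in>{0..<v}. if z = u then of_int v * f u else 0)"
  proof (intro sum.cong refl)
    fix z assume z: "z \<in> {0..<v}"
    have "v dvd u - z \<longleftrightarrow> z = u" using z assms by (auto simp: mod_eq_dvd_iff[symmetric])
    then show "f z * (\<Sum>h\<in>{0..<v}. add_char v (h * (u - z))) = (if z = u then of_int v * f u else 0)"
      using assms by (simp add: add_char_orthogonality)
  qed
  also have "\<dots> = of_int v * f u" using assms by simp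
  finally show ?thesis .
qed

text \<open>Both f at u and g at the inverse of u are written as Fourier sums; what remains for each
  pair of frequencies is a complete Kloosterman sum. The factor is the square of the one in
  \<open>dft_inversion\<close>.\<close>

lemma completion:
  fixes f g :: "int \<Rightarrow> complex"
  assumes "v > 0"
  shows "(of_int v)\<^sup>2 * (\<Sum>u\<in>units_mod v. f u * g (modular_inverse v u))
       = (\<Sum>h\<in>{0..<v}. \<Sum>k\<in>{0..<v}. dft v f h * dft v g k * kloosterman v h k)"
proof -
  let ?i = "modular_inverse v"
  have "(\<Sum>h\<in>{0..<v}. \<Sum>k\<in>{0..<v}. dft v f h * dft v g k * kloosterman v h k)
     = (\<Sum>h\<in>{0..<v}. \<Sum>k\<in>{0..<v}. \<Sum>u\<in>units_mod v. (dft v f h * add_char v (h * u)) * (dft v g k * add_char v (k * ?i u)))"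
    by (simp add: kloosterman_def sum_distrib_left add_char_add mult_ac)
  also have "\<dots> = (\<Sum>h\<in>{0..<v}. \<Sum>u\<in>units_mod v. \<Sum>k\<in>{0..<v}. (dft v f h * add_char v (h * u)) * (dft v g k * add_char v (k * ?i u)))"
    by (rule sum.cong[OF refl], rule sum.swap)
  also have "\<dots> = (\<Sum>u\<in>units_mod v. \<Sum>h\<in>{0..<v}. \<Sum>k\<in>{0..<v}. (dft v f h * add_char v (h * u)) * (dft v g k * add_char v (k * ?i u)))"
    by (rule sum.swap)
  also have "\<dots> = (\<Sum>u\<in>units_mod v. (\<Sum>h\<in>{0..<v}. dft v f h * add_char v (h * u)) * (\<Sum>k\<in>{0..<v}. dft v g k * add_char v (k * ?i u)))"
    by (simp add: sum_product)
  also have "\<dots> = (\<Sum>u\<in>units_mod v. (of_int v * f u) * (of_int v * g (?i u)))"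
    using assms modular_inverse_in_units[OF assms]
    by (intro sum.cong refl arg_cong2[where f = "(*)"] dft_inversion) (auto simp: units_mod_def)
  also have "\<dots> = (of_int v)\<^sup>2 * (\<Sum>u\<in>units_mod v. f u * g (?i u))"
    by (simp add: sum_distrib_left power2_eq_square mult_ac)
  finally show ?thesis ..
qed

lemma interval_exp_sum_bound_neg:
  assumes "0 < k" "k < v" "m \<le> n"
  shows "norm (\<Sum>z\<in>{m..<n}. add_char v (- (k * z))) \<le> real_of_int v * (1 / real_of_int k + 1 / real_of_int (v - k))"
proof -
  have "(\<Sum>z\<in>{m..<n}. add_char v (- (k * z))) = cnj (\<Sum>z\<in>{m..<n}. add_char v (k * z))"
    by (simp add: add_char_minus)
  then show ?thesis using interval_exp_sum_bound[OF assms] by (simp only: complex_mod_cnj)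
qed

lemma dft_indicator_bound:
  assumes "0 < k" "k < v" "0 \<le> y" "y \<le> v"
  shows "norm (dft v (\<lambda>z. if z < y then 1 else 0) k) \<le> real_of_int v * (1 / real_of_int k + 1 / real_of_int (v - k))"
proof -
  have "dft v (\<lambda>z. if z < y then 1 else 0) k = (\<Sum>z\<in>{0..<y}. add_char v (- (k * z)))"
    unfolding dft_def by (rule sum.mono_neutral_cong_right) (use assms in auto)
  then show ?thesis using interval_exp_sum_bound_neg[OF assms(1-3)] by simp
qed

text \<open>Oddness pairs z with v - z. The vanishing is essential: at k = 0 the factor gcd(k, v) of
  \<open>kloosterman_bound\<close> would be \<open>v\<close> itself.\<close>

lemma dft_half_sign_0:
  assumes "v > 0"
  shows "dft v (\<lambda>z. of_int (half_sign v z)) 0 = 0"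
proof -
  have 1: "(\<Sum>z\<in>{0..<v}. half_sign v z) = (\<Sum>z\<in>{1..<v}. half_sign v z)"
    by (rule sum.mono_neutral_right) (use assms in \<open>auto simp: half_sign_def\<close>)
  have 2: "(\<Sum>z\<in>{1..<v}. half_sign v z) = (\<Sum>z\<in>{1..<v}. half_sign v (v - z))"
    by (rule sum.reindex_bij_witness[of _ "\<lambda>z. v - z" "\<lambda>z. v - z"]) auto
  also have "\<dots> = (\<Sum>z\<in>{1..<v}. - half_sign v z)"
    by (rule sum.cong) (auto simp: half_sign_def)
  also have "\<dots> = - (\<Sum>z\<in>{1..<v}. half_sign v z)" by (rule sum_negf)
  finally have "(\<Sum>z\<in>{0..<v}. half_sign v z) = 0" using 1 by linarith
  then have "complex_of_int (\<Sum>z\<in>{0..<v}. half_sign v z) = 0" by (simp only: of_int_0)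
  then have "(\<Sum>z\<in>{0..<v}. complex_of_int (half_sign v z)) = 0" by (simp only: of_int_sum)
  then show ?thesis by (simp add: dft_def)
qed

lemma dft_half_sign_bound:
  assumes "0 < k" "k < v"
  shows "norm (dft v (\<lambda>z. of_int (half_sign v z)) k) \<le> 2 * (real_of_int v * (1 / real_of_int k + 1 / real_of_int (v - k)))"
proof -
  \<comment> \<open>For either parity of \<open>v\<close>, z < p means 2 z < v and q <= z means 2 z
    > v. So the sign is a difference of two interval indicators, whence the factor 2.\<close>
  define p where "p = (v + 1) div 2"
  define q where "q = v div 2 + 1"
  have pq: "1 \<le> p" "p \<le> q" "q \<le> v" using assms by (auto simp: p_def q_def)
  have hs: "of_int (half_sign v z) = (if z \<in> {1..<p} then 1 else 0) - (if z \<in> {q..<v} then 1 else (0::complex))"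
    if "z \<in> {0..<v}" for z
  proof -
    have "z < p \<longleftrightarrow> 2 * z < v" "q \<le> z \<longleftrightarrow> v < 2 * z" unfolding p_def q_def by linarith+
    then show ?thesis using that by (auto simp: half_sign_def)
  qed
  have "dft v (\<lambda>z. of_int (half_sign v z)) k =
     (\<Sum>z\<in>{0..<v}. if z \<in> {1..<p} then add_char v (- (k * z)) else 0) - (\<Sum>z\<in>{0..<v}. if z \<in> {q..<v} then add_char v (- (k * z)) else 0)"
    unfolding dft_def sum_subtractf[symmetric] by (intro sum.cong refl) (simp only: hs, simp)
  also have "(\<Sum>z\<in>{0..<v}. if z \<in> {1..<p} then add_char v (- (k * z)) else 0) = (\<Sum>z\<in>{1..<p}. add_char v (- (k * z)))"
    by (rule sum.mono_neutral_cong_right) (use pq in auto)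
  also have "(\<Sum>z\<in>{0..<v}. if z \<in> {q..<v} then add_char v (- (k * z)) else 0) = (\<Sum>z\<in>{q..<v}. add_char v (- (k * z)))"
    by (rule sum.mono_neutral_cong_right) (use pq in auto)
  finally show ?thesis
    using norm_triangle_ineq4[of "\<Sum>z\<in>{1..<p}. add_char v (- (k * z))" "\<Sum>z\<in>{q..<v}. add_char v (- (k * z))"]
      interval_exp_sum_bound_neg[OF assms pq(1)] interval_exp_sum_bound_neg[OF assms pq(3)] by simp
qed

lemma sum_inverse_symmetric:
  fixes F :: "int \<Rightarrow> real"
  assumes "\<And>k. 0 < k \<Longrightarrow> k < v \<Longrightarrow> F (v - k) = F k"
  shows "(\<Sum>k\<in>{1..<v}. F k * (1 / real_of_int k + 1 / real_of_int (v - k))) = 2 * (\<Sum>k\<in>{1..<v}. F k / real_of_int k)"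
proof -
  have "(\<Sum>k\<in>{1..<v}. F k / real_of_int (v - k)) = (\<Sum>k\<in>{1..<v}. F (v - k) / real_of_int k)"
    by (rule sum.reindex_bij_witness[of _ "\<lambda>z. v - z" "\<lambda>z. v - z"]) auto
  also have "\<dots> = (\<Sum>k\<in>{1..<v}. F k / real_of_int k)"
    using assms by (intro sum.cong refl) auto
  finally show ?thesis by (simp add: distrib_left sum.distrib)
qed

lemma sum_inverse_int: "(\<Sum>k\<in>{1..<v::int}. 1 / real_of_int k) \<le> harm (nat v)"
proof -
  have "(\<Sum>k\<in>{1..<v::int}. 1 / real_of_int k) = (\<Sum>k\<in>{1..<nat v}. 1 / real k)"
    by (rule sum.reindex_bij_witness[of _ int nat]) auto
  also have "\<dots> \<le> (\<Sum>k\<in>{1..nat v}. 1 / real k)" by (rule sum_mono2) auto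
  finally show ?thesis by (simp add: harm_def inverse_eq_divide)
qed

text \<open>The gcd is one of the common divisors, so it is bounded by the sum of all of them. For a
  divisor g of \<open>v\<close> the multiples k = g j contribute 1 / j each, thus at most one
  harmonic number.\<close>

lemma sum_gcd_inverse:
  assumes "v > 0"
  shows "(\<Sum>k\<in>{1..<v}. real_of_int (gcd k v) / real_of_int k) \<le> real (card (pos_divisors v)) * harm (nat v)"
proof -
  have "(\<Sum>k\<in>{1..<v}. real_of_int (gcd k v) / real_of_int k)
     \<le> (\<Sum>k\<in>{1..<v}. \<Sum>g\<in>pos_divisors v. if g dvd k then real_of_int g / real_of_int k else 0)"
  proof (rule sum_mono)
    fix k assume k: "k \<in> {1..<v}"
    have "gcd k v \<in> pos_divisors v" using assms by (simp add: pos_divisors_def)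
    then show "real_of_int (gcd k v) / real_of_int k \<le> (\<Sum>g\<in>pos_divisors v. if g dvd k then real_of_int g / real_of_int k else 0)"
      using assms k member_le_sum[of "gcd k v" "pos_divisors v" "\<lambda>g. if g dvd k then real_of_int g / real_of_int k else 0"]
      by (auto simp: pos_divisors_def)
  qed
  also have "\<dots> = (\<Sum>g\<in>pos_divisors v. \<Sum>k\<in>{1..<v}. if g dvd k then real_of_int g / real_of_int k else 0)"
    by (rule sum.swap)
  also have "\<dots> \<le> (\<Sum>g\<in>pos_divisors v. harm (nat v))"
  proof (rule sum_mono)
    fix g assume g: "g \<in> pos_divisors v"
    then have g0: "g > 0" by (simp add: pos_divisors_def)
    have "(\<Sum>k\<in>{1..<v}. if g dvd k then real_of_int g / real_of_int k else 0) = (\<Sum>k\<in>{k\<in>{1..<v}. g dvd k}. real_of_int g / real_of_int k)"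
      by (rule sum.mono_neutral_cong_right) auto
    also have "\<dots> = (\<Sum>k\<in>(\<lambda>j. g * j) ` {j\<in>{1..<v}. g * j < v}. real_of_int g / real_of_int k)"
    proof (rule sum.cong)
      show "{k \<in> {1..<v}. g dvd k} = (\<lambda>j. g * j) ` {j \<in> {1..<v}. g * j < v}"
      proof safe
        fix k assume k: "k \<in> {1..<v}" "g dvd k"
        then obtain j where j: "k = g * j" by blast
        have "j > 0" using j k g0 by (metis atLeastLessThan_iff zero_less_mult_pos zero_less_one order_less_le_trans)
        moreover have "j \<le> g * j" using g0 \<open>j > 0\<close> mult_right_mono[of 1 g j] by linarith
        then have "j < v" using j k by (metis atLeastLessThan_iff le_less_trans)
        ultimately show "k \<in> (\<lambda>j. g * j) ` {j \<in> {1..<v}. g * j < v}"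
          using j k by (intro image_eqI[of _ _ j]) auto
      next
        fix j assume "j \<in> {1..<v}" "g * j < v"
        moreover have "1 * 1 \<le> g * j" using g0 \<open>j \<in> _\<close> by (intro mult_mono) auto
        ultimately show "g * j \<in> {1..<v}" by auto
      qed auto
    qed simp
    also have "\<dots> = (\<Sum>j\<in>{j\<in>{1..<v}. g * j < v}. 1 / real_of_int j)"
      using g0 by (subst sum.reindex) (auto simp: inj_on_def)
    also have "\<dots> \<le> (\<Sum>j\<in>{1..<v}. 1 / real_of_int j)"
      by (rule sum_mono2) auto
    also have "\<dots> \<le> harm (nat v)" by (rule sum_inverse_int)
    finally show "(\<Sum>k\<in>{1..<v}. if g dvd k then real_of_int g / real_of_int k else 0) \<le> harm (nat v)" .
  qed
  finally show ?thesis by simp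
qed

lemma sum_int_split_0: "v > 0 \<Longrightarrow> (\<Sum>h\<in>{0..<v::int}. f h) = f 0 + (\<Sum>h\<in>{1..<v}. f h)"
proof -
  assume "v > 0"
  then have "{0..<v} = insert 0 {1..<v}" by auto
  then show ?thesis by simp
qed

text \<open>Completion of the indicator of u < y and of the sign of the inverse. With H the harmonic
  number, the transform of the interval has total mass at most v (1 + 2 H), where 1 is the frequency
  0. The transform of the sign, weighted by the Kloosterman bound, yields H and two divisor
  functions, one from that bound and one from \<open>sum_gcd_inverse\<close>. The 8 collects a 2
  from the Kloosterman bound, a 2 from the two intervals and a 2 from the reflection in
  \<open>k\<close>.\<close>

lemma incomplete_half_sign_bound:
  assumes "v > 1" "0 \<le> y" "y \<le> v"
  shows "\<bar>\<Sum>u\<in>{u \<in> units_mod v. u < y}. real_of_int (half_sign v (modular_inverse v u))\<bar>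
    \<le> 8 * (1 + 2 * harm (nat v)) * harm (nat v) * (real (card (pos_divisors v)))\<^sup>2 * real_of_int v powr (3/4)"
    (is "\<bar>?J\<bar> \<le> _")
proof -
  define f where "f = (\<lambda>z. if z < y then 1 else (0::complex))"
  define g where "g = (\<lambda>z. complex_of_int (half_sign v z))"
  define V where "V = real_of_int v"
  define T where "T = real (card (pos_divisors v))"
  define H where "H = (harm (nat v) :: real)"
  define B where "B k = 2 * real_of_int (gcd k v) * T * V powr (3/4)" for k
  have V: "V > 1" using assms by (simp add: V_def)
  have H0: "H \<ge> 0" by (simp add: H_def harm_nonneg)
  have B: "norm (kloosterman v h k) \<le> B k" for h k
    unfolding B_def T_def V_def by (rule kloosterman_bound) (use assms in simp)
  have "(\<Sum>u\<in>units_mod v. f u * g (modular_inverse v u)) = (\<Sum>u\<in>{u \<in> units_mod v. u < y}. g (modular_inverse v u))"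
    by (rule sum.mono_neutral_cong_right) (auto simp: f_def)
  also have "\<dots> = complex_of_real ?J" by (simp add: g_def)
  finally have "complex_of_real (V\<^sup>2 * ?J) = (\<Sum>h\<in>{0..<v}. \<Sum>k\<in>{0..<v}. dft v f h * dft v g k * kloosterman v h k)"
    using completion[of v f g] assms by (simp add: V_def)
  moreover have "V\<^sup>2 * \<bar>?J\<bar> = norm (complex_of_real (V\<^sup>2 * ?J))"
    by (simp only: norm_of_real abs_mult abs_power2)
  ultimately have "V\<^sup>2 * \<bar>?J\<bar> = norm (\<Sum>h\<in>{0..<v}. \<Sum>k\<in>{0..<v}. dft v f h * dft v g k * kloosterman v h k)"
    by simp
  also have "\<dots> \<le> (\<Sum>h\<in>{0..<v}. \<Sum>k\<in>{0..<v}. norm (dft v f h) * (norm (dft v g k) * B k))"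
    by (intro sum_norm_le) (auto simp: norm_mult mult.assoc intro!: mult_left_mono B)
  also have "\<dots> = (\<Sum>h\<in>{0..<v}. norm (dft v f h)) * (\<Sum>k\<in>{0..<v}. norm (dft v g k) * B k)"
    by (simp add: sum_product)
  also have "\<dots> \<le> (V * (1 + 2 * H)) * (8 * T\<^sup>2 * H * V * V powr (3/4))"
  proof (rule mult_mono)
    have "norm (dft v f 0) \<le> (\<Sum>z\<in>{0..<v}. 1)"
      unfolding dft_def by (intro sum_norm_le) (auto simp: f_def)
    then have f0: "norm (dft v f 0) \<le> V" using assms by (simp add: V_def)
    have "(\<Sum>h\<in>{1..<v}. norm (dft v f h)) \<le> (\<Sum>h\<in>{1..<v}. V * (1 / real_of_int h + 1 / real_of_int (v - h)))"
      unfolding f_def V_def by (intro sum_mono dft_indicator_bound) (use assms in auto)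
    also have "\<dots> = 2 * (\<Sum>h\<in>{1..<v}. V / real_of_int h)"
      by (rule sum_inverse_symmetric) simp
    also have "\<dots> = 2 * V * (\<Sum>h\<in>{1..<v}. 1 / real_of_int h)" by (simp add: sum_distrib_left)
    also have "\<dots> \<le> 2 * V * H" unfolding H_def using V by (intro mult_left_mono sum_inverse_int) auto
    finally show "(\<Sum>h\<in>{0..<v}. norm (dft v f h)) \<le> V * (1 + 2 * H)"
      using f0 assms by (subst sum_int_split_0) (auto simp: algebra_simps)
  next
    have "(\<Sum>k\<in>{0..<v}. norm (dft v g k) * B k) = (\<Sum>k\<in>{1..<v}. norm (dft v g k) * B k)"
      using assms dft_half_sign_0[of v] by (subst sum_int_split_0) (auto simp: g_def)
    also have "\<dots> \<le> (\<Sum>k\<in>{1..<v}. 2 * (V * (1 / real_of_int k + 1 / real_of_int (v - k))) * B k)"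
    proof (intro sum_mono mult_right_mono)
      fix k assume "k \<in> {1..<v}"
      then show "norm (dft v g k) \<le> 2 * (V * (1 / real_of_int k + 1 / real_of_int (v - k)))"
        unfolding g_def V_def by (intro dft_half_sign_bound) auto
    qed (use V in \<open>auto simp: B_def T_def\<close>)
    also have "\<dots> = 2 * V * (\<Sum>k\<in>{1..<v}. B k * (1 / real_of_int k + 1 / real_of_int (v - k)))"
      by (simp add: sum_distrib_left mult_ac)
    also have "\<dots> = 2 * V * (2 * (\<Sum>k\<in>{1..<v}. B k / real_of_int k))"
    proof (subst sum_inverse_symmetric)
      fix k assume "0 < k" "k < v"
      have "gcd (v - k) v = gcd k v"
        using gcd_diff1[of v k] by (metis gcd.commute gcd_diff2 gcd_diff1)
      then show "B (v - k) = B k" by (simp add: B_def)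
    qed simp
    also have "\<dots> = 8 * T * V * V powr (3/4) * (\<Sum>k\<in>{1..<v}. real_of_int (gcd k v) / real_of_int k)"
      by (simp add: B_def sum_distrib_left mult_ac)
    also have "\<dots> \<le> 8 * T * V * V powr (3/4) * (T * H)"
      unfolding H_def T_def using assms V by (intro mult_left_mono sum_gcd_inverse) auto
    finally show "(\<Sum>k\<in>{0..<v}. norm (dft v g k) * B k) \<le> 8 * T\<^sup>2 * H * V * V powr (3/4)"
      by (simp add: power2_eq_square mult_ac)
  qed (use V H0 in \<open>auto intro!: sum_nonneg mult_nonneg_nonneg simp: B_def T_def\<close>)
  also have "\<dots> = V\<^sup>2 * (8 * (1 + 2 * H) * H * T\<^sup>2 * V powr (3/4))"
    by (simp add: power2_eq_square mult_ac)
  finally have "\<bar>?J\<bar> \<le> 8 * (1 + 2 * H) * H * T\<^sup>2 * V powr (3/4)" using V by simp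
  then show ?thesis by (simp add: H_def T_def V_def)
qed

text \<open>Inversion permutes the units, and so does negation, which reverses the sign; the sum is
  its own negative.\<close>

lemma half_sign_units_sum:
  assumes "v > 2"
  shows "(\<Sum>u\<in>units_mod v. half_sign v (modular_inverse v u)) = 0"
proof -
  have U: "v - a \<in> units_mod v" if a: "a \<in> units_mod v" for a
  proof -
    have "a \<noteq> 0" using a assms by (auto simp: units_mod_def)
    moreover have "coprime (v - a) v"
      using a gcd_diff2[of v a] by (simp add: units_mod_def coprime_iff_gcd_eq_1)
    ultimately show ?thesis using a by (auto simp: units_mod_def)
  qed
  have "(\<Sum>u\<in>units_mod v. half_sign v (modular_inverse v u)) = (\<Sum>u\<in>units_mod v. half_sign v u)"
    by (rule sum.reindex_bij_betw[OF bij_betw_modular_inverse]) (use assms in simp)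
  also have "\<dots> = (\<Sum>u\<in>units_mod v. half_sign v (v - u))"
    by (rule sum.reindex_bij_witness[of _ "\<lambda>z. v - z" "\<lambda>z. v - z"]) (use U in auto)
  also have "\<dots> = (\<Sum>u\<in>units_mod v. - half_sign v u)"
  proof (rule sum.cong[OF refl])
    fix u assume "u \<in> units_mod v"
    moreover have "0 \<notin> units_mod v" using assms by (auto simp: units_mod_def)
    ultimately have "0 < u" by (cases "u = 0") (auto simp: units_mod_def)
    then show "half_sign v (v - u) = - half_sign v u"
      using \<open>u \<in> _\<close> by (auto simp: half_sign_def units_mod_def)
  qed
  also have "\<dots> = - (\<Sum>u\<in>units_mod v. half_sign v u)" by (rule sum_negf)
  finally show ?thesis using bij_betw_modular_inverse[of v] assms sum.reindex_bij_betw[of "modular_inverse v" "units_mod v" "units_mod v" "half_sign v"]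
    by simp
qed

lemma sum_periodic_lessThan:
  fixes f :: "nat \<Rightarrow> 'a :: comm_monoid_add"
  assumes "\<And>u. f (u + v) = f u" "(\<Sum>u<v. f u) = 0"
  shows "(\<Sum>u<n. f u) = (\<Sum>u<n mod v. f u)"
proof (induction n rule: less_induct)
  case (less n)
  show ?case
  proof (cases "n < v \<or> v = 0")
    case False
    then have v: "v > 0" and n: "n = (n - v) + v" by auto
    have "(\<Sum>u<n. f u) = (\<Sum>u<v. f u) + (\<Sum>u\<in>{v..<n}. f u)"
      using n by (metis sum.atLeastLessThan_concat atLeast0LessThan le_add2 le0)
    also have "(\<Sum>u\<in>{v..<n}. f u) = (\<Sum>u<n - v. f u)"
    proof (rule sum.reindex_bij_witness[of _ "\<lambda>u. u + v" "\<lambda>u. u - v"])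
      show "f (u - v) = f u" if "u \<in> {v..<n}" for u using assms(1)[of "u - v"] that by simp
    qed (use False in auto)
    finally show ?thesis using less[of "n - v"] v False assms(2) by (simp add: le_mod_geq)
  qed auto
qed

definition kloosterman_error :: "nat \<Rightarrow> real" where
  "kloosterman_error v = 8 * (1 + 2 * harm v) * harm v * (real (card {d. d dvd v}))\<^sup>2 * real v powr (3/4)"

lemma modular_inverse_mod:
  fixes u v :: int
  assumes "v > 0" "coprime u v"
  shows "modular_inverse v (u mod v) = modular_inverse v u"
proof (rule modular_inverse_int_eqI)
  have "[u mod v * modular_inverse v u = u * modular_inverse v u] (mod v)"
    by (intro cong_mult cong_refl) (simp add: Cong.cong_def)
  also have "[u * modular_inverse v u = 1] (mod v)" by (rule cong_modular_inverse1[OF assms(2)])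
  finally show "[u mod v * modular_inverse v u = 1] (mod v)" .
qed (use assms in \<open>auto simp: modular_inverse_int_nonneg modular_inverse_int_less\<close>)

abbreviation inverse_sign :: "nat \<Rightarrow> nat \<Rightarrow> real" where
  "inverse_sign u v \<equiv> real_of_int (half_sign (int v) (modular_inverse (int v) (int u)))"

text \<open>The summand depends on \<open>u\<close> modulo \<open>v\<close> and sums to zero over a
  period, so only an incomplete period remains, whatever the size of \<open>n\<close>.\<close>

lemma half_sign_sum_bound:
  fixes v n :: nat
  assumes "v > 2"
  shows "\<bar>\<Sum>u | u \<in> {1..n} \<and> coprime u v. inverse_sign u v\<bar>
           \<le> kloosterman_error v"
proof -
  define f where "f u = (if coprime u v then inverse_sign u v else 0)"
    for u :: nat
  have f_int: "(\<Sum>u<r. f u) = (\<Sum>u\<in>{u \<in> units_mod (int v). u < int r}. real_of_int (half_sign (int v) (modular_inverse (int v) u)))"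
    if "r \<le> v" for r
  proof -
    have "(\<Sum>u<r. f u) = (\<Sum>u\<in>{u. u < r \<and> coprime u v}. f u)"
      by (rule sum.mono_neutral_right) (auto simp: f_def)
    also have "\<dots> = (\<Sum>u\<in>{u \<in> units_mod (int v). u < int r}. real_of_int (half_sign (int v) (modular_inverse (int v) u)))"
    proof (rule sum.reindex_bij_witness[of _ nat int])
      fix b assume b: "b \<in> {u \<in> units_mod (int v). u < int r}"
      then have "coprime (int (nat b)) (int v)" by (simp add: units_mod_def)
      then have "coprime (nat b) v" by (simp only: coprime_int_iff)
      then show "nat b \<in> {u. u < r \<and> coprime u v}" using b by (auto simp: units_mod_def)
    qed (use that in \<open>auto simp: units_mod_def f_def\<close>)
    finally show ?thesis .
  qed
  have per: "f (u + v) = f u" for u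
  proof -
    have cv: "coprime (u + v) v \<longleftrightarrow> coprime u v" by (metis coprime_iff_gcd_eq_1 gcd_add1)
    show ?thesis
    proof (cases "coprime u v")
      case True
      then have c: "coprime (int u) (int v)" by simp
      then have c': "coprime (int (u + v)) (int v)" by (metis coprime_iff_gcd_eq_1 gcd_add1 of_nat_add)
      have "int (u + v) mod int v = int u mod int v" by simp
      then have "modular_inverse (int v) (int (u + v)) = modular_inverse (int v) (int u)"
        using modular_inverse_mod[OF _ c] modular_inverse_mod[OF _ c'] assms by simp
      then show ?thesis using cv by (simp add: f_def)
    qed (use cv in \<open>simp add: f_def\<close>)
  qed
  have "(\<Sum>u<v. f u) = (\<Sum>u\<in>units_mod (int v). real_of_int (half_sign (int v) (modular_inverse (int v) u)))"
    by (subst f_int) (auto intro!: sum.cong simp: units_mod_def)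
  also have "\<dots> = real_of_int (\<Sum>u\<in>units_mod (int v). half_sign (int v) (modular_inverse (int v) u))"
    by simp
  finally have zero: "(\<Sum>u<v. f u) = 0" using half_sign_units_sum[of "int v"] assms by simp
  have "(\<Sum>u | u \<in> {1..n} \<and> coprime u v. inverse_sign u v)
      = (\<Sum>u<Suc n. f u)"
  proof (rule sum.mono_neutral_cong_left)
    show "\<forall>i\<in>{..<Suc n} - {u. u \<in> {1..n} \<and> coprime u v}. f i = 0"
    proof
      fix u assume u: "u \<in> {..<Suc n} - {u. u \<in> {1..n} \<and> coprime u v}"
      \<comment> \<open>The range may start at 0 to fit the period, because the summand there
        vanishes for v > 1.\<close>
      have "\<not> coprime 0 v" using assms by simp
      then show "f u = 0" using u by (cases "u = 0") (auto simp: f_def)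
    qed
  qed (auto simp: f_def)
  also have "\<dots> = (\<Sum>u<Suc n mod v. f u)" by (rule sum_periodic_lessThan[OF per zero])
  also have "\<dots> = (\<Sum>u\<in>{u \<in> units_mod (int v). u < int (Suc n mod v)}. real_of_int (half_sign (int v) (modular_inverse (int v) u)))"
    using assms by (intro f_int less_imp_le) simp
  also have "\<bar>\<dots>\<bar> \<le> kloosterman_error v"
    using incomplete_half_sign_bound[of "int v" "int (Suc n mod v)"] assms less_imp_le[OF mod_less_divisor[of v "Suc n"]]
      card_pos_divisors[of "int v"]
    by (simp add: kloosterman_error_def del: mod_less_divisor)
  finally show ?thesis .
qed

text \<open>The squared divisor count is the number of pairs a, b of divisors of v. With g = gcd(a,
  b), the triple (v, a, b) is recovered from g, a / g, b / g and v / lcm(a, b), whose product is v.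
  So the left side is part of the sum over all quadruples up to N, which is a fourth power. Without
  truncation this is Ramanujan's series zeta(s)^4 / zeta(2 s) bounded by zeta(s)^4.\<close>

lemma sum_divisor_count_squared:
  fixes \<sigma> :: real
  shows "(\<Sum>v=1..N. (real (card {d. d dvd v}))\<^sup>2 * real v powr (-\<sigma>)) \<le> (\<Sum>n=1..N. real n powr (-\<sigma>)) ^ 4"
proof -
  let ?A = "SIGMA v:{1..N}. {d. d dvd v} \<times> {d. d dvd v}"
  let ?Q = "{1..N} \<times> {1..N} \<times> {1..N} \<times> {1..N}"
  define \<phi> where "\<phi> = (\<lambda>(v, a, b). (gcd a b, a div gcd a b, b div gcd a b, v div lcm a b) :: nat \<times> nat \<times> nat \<times> nat)"
  define F where "F = (\<lambda>(g, x, y, m). real g powr (-\<sigma>) * real x powr (-\<sigma>) * real y powr (-\<sigma>) * real m powr (-\<sigma>))"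
  have fact: "v = gcd a b * (a div gcd a b) * (b div gcd a b) * (v div lcm a b) \<and> a = gcd a b * (a div gcd a b) \<and> b = gcd a b * (b div gcd a b)"
    if "a dvd v" "b dvd v" for v a b :: nat
  proof -
    have "gcd a b * (a div gcd a b) * (b div gcd a b) = lcm a b"
    proof (cases "gcd a b = 0")
      case False
      have "gcd a b * lcm a b = (gcd a b * (a div gcd a b)) * (gcd a b * (b div gcd a b))"
        using prod_gcd_lcm_nat[of a b] by simp
      also have "\<dots> = gcd a b * (gcd a b * (a div gcd a b) * (b div gcd a b))" by (simp only: mult_ac)
      finally show ?thesis using False by (metis mult_left_cancel)
    qed simp
    moreover have "lcm a b dvd v" using that by simp
    ultimately show ?thesis by simp
  qed
  have inj: "inj_on \<phi> ?A"
  proof (rule inj_onI)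
    fix p q assume "p \<in> ?A" "q \<in> ?A" and eq: "\<phi> p = \<phi> q"
    obtain v a b where p: "p = (v, a, b)" by (cases p)
    obtain v' a' b' where q: "q = (v', a', b')" by (cases q)
    have "a dvd v" "b dvd v" "a' dvd v'" "b' dvd v'" using \<open>p \<in> ?A\<close> \<open>q \<in> ?A\<close> p q by auto
    note f = fact[OF this(1,2)] and f' = fact[OF this(3,4)]
    have e: "gcd a b = gcd a' b'" "a div gcd a b = a' div gcd a' b'" "b div gcd a b = b' div gcd a' b'"
      "v div lcm a b = v' div lcm a' b'"
      using eq unfolding p q \<phi>_def case_prod_conv prod.inject by blast+
    have "v = v'"
      by (rule trans[OF conjunct1[OF f] trans[OF _ sym[OF conjunct1[OF f']]]]) (intro arg_cong2[where f = "(*)"] e)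
    moreover have "a = a'"
      by (rule trans[OF conjunct1[OF conjunct2[OF f]] trans[OF _ sym[OF conjunct1[OF conjunct2[OF f']]]]])
         (intro arg_cong2[where f = "(*)"] e)
    moreover have "b = b'"
      by (rule trans[OF conjunct2[OF conjunct2[OF f]] trans[OF _ sym[OF conjunct2[OF conjunct2[OF f']]]]])
         (intro arg_cong2[where f = "(*)"] e)
    ultimately show "p = q" unfolding p q by simp
  qed
  have sub: "\<phi> ` ?A \<subseteq> ?Q"
  proof
    fix q assume "q \<in> \<phi> ` ?A"
    then obtain v a b where q: "q = \<phi> (v, a, b)" and v: "v \<in> {1..N}" and ab: "a dvd v" "b dvd v" by auto
    define g x y m where "g = gcd a b" and "x = a div gcd a b" and "y = b div gcd a b" and "m = v div lcm a b"
    have e: "v = g * x * y * m" using fact[OF ab] by (simp add: g_def x_def y_def m_def)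
    have "g dvd v" "x dvd v" "y dvd v" "m dvd v" unfolding e by auto
    then have *: "g \<le> v" "x \<le> v" "y \<le> v" "m \<le> v" using v by (auto intro: dvd_imp_le)
    have "g * x * y * m \<noteq> 0" using e v by auto
    then have "g > 0" "x > 0" "y > 0" "m > 0" by auto
    moreover have "\<phi> (v, a, b) = (g, x, y, m)" by (simp add: \<phi>_def g_def x_def y_def m_def)
    ultimately show "q \<in> ?Q" unfolding q using * v by simp
  qed
  have "(\<Sum>v=1..N. (real (card {d. d dvd v}))\<^sup>2 * real v powr (-\<sigma>)) = (\<Sum>v=1..N. \<Sum>p\<in>{d. d dvd v} \<times> {d. d dvd v}. real v powr (-\<sigma>))"
    by (simp add: power2_eq_square)
  also have "\<dots> = (\<Sum>(v, p)\<in>?A. real v powr (-\<sigma>))"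
    by (rule sum.Sigma) auto
  also have "\<dots> = (\<Sum>q\<in>?A. F (\<phi> q))"
  proof (rule sum.cong[OF refl])
    fix q assume q: "q \<in> ?A"
    obtain v a b where qq: "q = (v, a, b)" by (cases q)
    then have "a dvd v" "b dvd v" using q by auto
    from fact[OF this] have "v = gcd a b * (a div gcd a b) * (b div gcd a b) * (v div lcm a b)" by blast
    then have "real v = real (gcd a b) * real (a div gcd a b) * real (b div gcd a b) * real (v div lcm a b)"
      by (metis of_nat_mult)
    then have "real v powr (-\<sigma>) = real (gcd a b) powr (-\<sigma>) * real (a div gcd a b) powr (-\<sigma>) * real (b div gcd a b) powr (-\<sigma>) * real (v div lcm a b) powr (-\<sigma>)"
      by (simp add: powr_mult)
    then show "(case q of (v, p) \<Rightarrow> real v powr (-\<sigma>)) = F (\<phi> q)" by (simp add: qq F_def \<phi>_def)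
  qed
  also have "\<dots> = (\<Sum>q\<in>\<phi> ` ?A. F q)" by (simp only: sum.reindex[OF inj] o_def)
  also have "\<dots> \<le> (\<Sum>q\<in>?Q. F q)"
    by (rule sum_mono2[OF _ sub]) (auto simp: F_def)
  also have "\<dots> = (\<Sum>n=1..N. real n powr (-\<sigma>)) ^ 4"
    by (simp add: F_def power4_eq_xxxx sum_product sum.cartesian_product[symmetric] sum_distrib_left sum_distrib_right mult_ac)
  finally show ?thesis .
qed

lemma harm_bounds:
  assumes "n > 0"
  shows "harm n \<le> 1 + ln (real n)" "ln (real n) \<le> harm n"
proof -
  show "harm n \<le> 1 + ln (real n)"
    using decseqD[OF decseq_harm_diff_ln, of 0 "n - 1"] assms by (simp add: harm_def)
  have "ln (real n) \<le> ln (real n + 1)" using assms by simp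
  then show "ln (real n) \<le> harm n" using ln_le_harm[of n] by linarith
qed

text \<open>The powers of \<open>v\<close> leave the exponent 3/4 - 2 = -5/4. Each of the two
  harmonic factors costs v^(1/16), and the resulting exponent -9/8 still lies below -1, so
  \<open>sum_divisor_count_squared\<close> gives the fourth power of a convergent series.\<close>

lemma sum_kloosterman_error_bounded:
  "\<exists>K\<ge>0. \<forall>N. (\<Sum>v=1..N. kloosterman_error v / (real v)\<^sup>2) \<le> K"
proof -
  define Z where "Z = (\<Sum>n. real n powr (-(9/8)))"
  have summ: "summable (\<lambda>n. real n powr (-(9/8)))" by (simp add: summable_real_powr_iff)
  have Z: "(\<Sum>n=1..N. real n powr (-(9/8))) \<le> Z" for N
    unfolding Z_def by (rule sum_le_suminf[OF summ]) auto
  have E: "kloosterman_error v / (real v)\<^sup>2 \<le> 5000 * ((real (card {d. d dvd v}))\<^sup>2 * real v powr (-(9/8)))" if "v \<ge> 1" for v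
  proof -
    define w where "w = real v powr (1/16)"
    have w: "w \<ge> 1" using that by (simp add: w_def ge_one_powr_ge_zero)
    have "ln (real v) = 16 * ln w" using that by (simp add: w_def ln_powr)
    also have "\<dots> \<le> 16 * (w - 1)" using ln_le_minus_one[of w] w by simp
    finally have H: "harm v \<le> 16 * w" using harm_bounds(1)[of v] that by simp
    have H0: "harm v \<ge> (0::real)" by (simp add: harm_nonneg)
    have "(1 + 2 * harm v) * harm v \<le> (33 * w) * (16 * w)" using H H0 w by (intro mult_mono) auto
    \<comment> \<open>The product of constants is 8 times 33 times 16, that is 4224.\<close>
    then have "8 * ((1 + 2 * harm v) * harm v) \<le> 5000 * (w * w)"
      using w mult_nonneg_nonneg[of w w] by linarith
    then have le: "8 * ((1 + 2 * harm v) * harm v) * ((real (card {d. d dvd v}))\<^sup>2 * real v powr (3/4) / (real v)\<^sup>2)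
       \<le> 5000 * (w * w) * ((real (card {d. d dvd v}))\<^sup>2 * real v powr (3/4) / (real v)\<^sup>2)"
      by (rule mult_right_mono) auto
    have eq: "w * w * (real v powr (3/4) / (real v)\<^sup>2) = real v powr (-(9/8))"
    proof -
      have "w * w * (real v powr (3/4) / (real v)\<^sup>2)
          = real v powr (1/16) * real v powr (1/16) * (real v powr (3/4) / real v powr 2)"
        using that by (simp add: w_def)
      also have "\<dots> = real v powr (1/16 + 1/16 + (3/4 - 2))" by (simp only: powr_add powr_diff)
      finally show ?thesis by simp
    qed
    have "5000 * (w * w) * ((real (card {d. d dvd v}))\<^sup>2 * real v powr (3/4) / (real v)\<^sup>2)
        = 5000 * ((real (card {d. d dvd v}))\<^sup>2 * (w * w * (real v powr (3/4) / (real v)\<^sup>2)))"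
      by simp
    also have "\<dots> = 5000 * ((real (card {d. d dvd v}))\<^sup>2 * real v powr (-(9/8)))"
      unfolding eq ..
    finally show ?thesis using le by (simp add: kloosterman_error_def mult_ac)
  qed
  have "(\<Sum>v=1..N. kloosterman_error v / (real v)\<^sup>2) \<le> 5000 * Z ^ 4" for N
  proof -
    have "(\<Sum>v=1..N. kloosterman_error v / (real v)\<^sup>2) \<le> (\<Sum>v=1..N. 5000 * ((real (card {d. d dvd v}))\<^sup>2 * real v powr (-(9/8))))"
      by (intro sum_mono E) auto
    also have "\<dots> = 5000 * (\<Sum>v=1..N. (real (card {d. d dvd v}))\<^sup>2 * real v powr (-(9/8)))"
      by (simp add: sum_distrib_left)
    also have "\<dots> \<le> 5000 * (\<Sum>n=1..N. real n powr (-(9/8))) ^ 4"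
      using sum_divisor_count_squared[where \<sigma> = "9/8"] by (intro mult_left_mono) auto
    also have "\<dots> \<le> 5000 * Z ^ 4" by (intro mult_left_mono power_mono Z sum_nonneg) auto
    finally show ?thesis .
  qed
  moreover have "Z \<ge> 0" unfolding Z_def by (rule suminf_nonneg[OF summ]) simp
  ultimately show ?thesis by (intro exI[of _ "5000 * Z ^ 4"]) auto
qed

subsection \<open>Minus continued fractions and the subtractive Euclidean algorithm\<close>

function low_steps :: "nat \<Rightarrow> nat \<Rightarrow> nat" where
  "low_steps m n =
     (if m = 0 \<or> n = 0 then 0 else if m \<le> n then Suc (low_steps m (n - m)) else low_steps (m - n) n)"
  by auto
termination by (relation "Wellfounded.measure (\<lambda>(m, n). m + n)") auto

declare low_steps.simps [simp del]

text \<open>A step with m < n puts a digit 2 in front, as 2 - (n - m) / n = (m + n) / n. A step with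
  m > n raises the first digit by one and creates none. The algorithm ends at m = n with the single
  digit 2. So digits correspond to the steps counted by \<open>low_steps\<close>.\<close>

lemma mcf_of_pair:
  assumes "m > 0" "n > 0"
  shows "\<exists>bs. bs \<noteq> [] \<and> (\<forall>b\<in>set bs. b \<ge> 2) \<and> mcf bs = of_nat (m + n) / of_nat n \<and>
              length bs = low_steps m n"
  using assms
proof (induction m n rule: low_steps.induct)
  case (1 m n)
  consider "m = n" | "m < n" | "m > n" by linarith
  then show ?case
  proof cases
    case 1
    then have "low_steps m n = 1" using "1.prems" by (simp add: low_steps.simps)
    then show ?thesis using 1 "1.prems" by (intro exI[of _ "[2]"]) simp
  next
    case 2
    then obtain bs where bs: "bs \<noteq> []" "\<forall>b\<in>set bs. b \<ge> 2"
      "mcf bs = of_nat (m + (n - m)) / of_nat (n - m)" "length bs = low_steps m (n - m)"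
      using "1.IH"(1) "1.prems" by auto
    have "mcf (2 # bs) = 2 - 1 / mcf bs" using bs by (cases bs) auto
    also have "\<dots> = of_nat (m + n) / of_nat n"
      unfolding bs(3) using 2 "1.prems" by (simp add: of_nat_diff field_simps)
    finally show ?thesis using bs 2 "1.prems"
      by (intro exI[of _ "2 # bs"]) (simp add: low_steps.simps[of m n])
  next
    case 3
    then obtain bs where bs: "bs \<noteq> []" "\<forall>b\<in>set bs. b \<ge> 2"
      "mcf bs = of_nat (m - n + n) / of_nat n" "length bs = low_steps (m - n) n"
      using "1.IH"(2) "1.prems" by auto
    then obtain b cs where cs: "bs = b # cs" by (cases bs) auto
    have "mcf ((b + 1) # cs) = mcf bs + 1" unfolding cs by (cases cs) auto
    also have "\<dots> = of_nat (m + n) / of_nat n"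
      using bs(3) 3 "1.prems" by (simp add: field_simps)
    finally show ?thesis using bs 3 "1.prems" cs
      by (intro exI[of _ "(b + 1) # cs"]) (auto simp: low_steps.simps[of m n])
  qed
qed

lemma mcf_length_pair:
  assumes "m > 0" "n > 0"
  shows "mcf_length (of_nat m / of_nat (m + n)) = low_steps m n"
proof -
  let ?x = "of_nat m / of_nat (m + n) :: rat"
  obtain bs where bs: "bs \<noteq> []" "\<forall>b\<in>set bs. b \<ge> 2" "mcf bs = of_nat (m + n) / of_nat n"
      "length bs = low_steps m n"
    using mcf_of_pair[OF assms] by blast
  have "is_mcf_expansion ?x bs"
    unfolding is_mcf_expansion_def bs(3) using bs(1,2) assms by (simp add: field_simps)
  moreover have "0 < ?x" "?x < 1" using assms by (simp_all add: field_simps)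
  then have "\<exists>!as. is_mcf_expansion ?x as" by (rule mcf_expansion_ex1)
  ultimately have "(THE as. is_mcf_expansion ?x as) = bs" by (rule the1_equality[rotated])
  then show ?thesis using bs(4) by (simp add: mcf_length_def)
qed

definition euclid_states :: "nat \<Rightarrow> nat \<Rightarrow> (nat \<times> nat \<times> nat \<times> nat \<times> nat \<times> nat) set" where
  "euclid_states m n = {(a, b, c, d, r, s). a * d = b * c + 1 \<and> m = a * r + b * s \<and>
     n = c * r + d * s \<and> 1 \<le> r \<and> r \<le> s}"

lemma euclid_states_0: "euclid_states 0 n = {}" "euclid_states m 0 = {}"
  by (auto simp: euclid_states_def)

text \<open>If neither row dominates the other, the rows cross strictly. For c < a and b < d the
  determinant is at least 1 + b + c, which forces the identity matrix; in the opposite crossing it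
  is not positive. This makes the last row operation in a factorisation unique.\<close>

lemma nonneg_sl2_cases:
  fixes a b c d :: nat
  assumes "a * d = b * c + 1"
  shows "(a = 1 \<and> b = 0 \<and> c = 0 \<and> d = 1) \<or> (a \<le> c \<and> b \<le> d) \<or> (c \<le> a \<and> d \<le> b)"
proof (rule ccontr)
  assume H: "\<not> ?thesis"
  then consider "c < a" "b < d" | "a < c" "d < b" by linarith
  then show False
  proof cases
    case 1
    then obtain x y where "a = c + 1 + x" "d = b + 1 + y"
      by (metis Suc_eq_plus1 less_iff_Suc_add add.commute add.left_commute)
    then have "c = 0 \<and> b = 0 \<and> x = 0 \<and> y = 0" using assms by (auto simp: algebra_simps)
    then show False using H \<open>a = _\<close> \<open>d = _\<close> by simp
  next
    case 2
    then have "a * d \<le> c * b" by (intro mult_mono) auto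
    then show False using assms by (simp add: mult.commute)
  qed
qed

text \<open>As m > n the bottom row cannot dominate, and the identity is excluded because it would
  give m = r <= s = n. So the top row dominates, and the bottom row can be subtracted from
  it.\<close>

lemma euclid_states_gt:
  assumes "m > n" "n > 0"
  shows "bij_betw (\<lambda>(a, b, c, d, r, s). (a + c, b + d, c, d, r, s))
           (euclid_states (m - n) n) (euclid_states m n)"
proof (rule bij_betw_byWitness[where f' = "\<lambda>(a, b, c, d, r, s). (a - c, b - d, c, d, r, s)"])
  have *: "c \<le> a \<and> d \<le> b" if "(a, b, c, d, r, s) \<in> euclid_states m n" for a b c d r s
  proof -
    have "a * r + b * s > c * r + d * s" "1 \<le> r" "r \<le> s" "a * d = b * c + 1"
      using that assms by (auto simp: euclid_states_def)
    moreover have "\<not> (a \<le> c \<and> b \<le> d)"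
      using \<open>a * r + b * s > c * r + d * s\<close> add_mono[OF mult_right_mono mult_right_mono, of a c r b d s]
      by linarith
    ultimately show ?thesis using nonneg_sl2_cases[of a d b c] by auto
  qed
  show "\<forall>x\<in>euclid_states m n. (\<lambda>(a, b, c, d, r, s). (a + c, b + d, c, d, r, s))
      ((\<lambda>(a, b, c, d, r, s). (a - c, b - d, c, d, r, s)) x) = x"
    using * by force
  show "(\<lambda>(a, b, c, d, r, s). (a - c, b - d, c, d, r, s)) ` euclid_states m n \<subseteq> euclid_states (m - n) n"
  proof safe
    fix a b c d r s assume H: "(a, b, c, d, r, s) \<in> euclid_states m n"
    obtain x y where "a = c + x" "b = d + y" using *[OF H] by (metis le_iff_add)
    then show "(a - c, b - d, c, d, r, s) \<in> euclid_states (m - n) n"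
      using H by (auto simp: euclid_states_def algebra_simps)
  qed
qed (use assms in \<open>auto simp: euclid_states_def algebra_simps\<close>)

text \<open>The identity matrix supplies the one additional state, with (r, s) = (m, n). For every
  other matrix the bottom row dominates, and removing the top row from it is a step of the
  algorithm.\<close>

lemma euclid_states_le:
  assumes "m \<le> n" "m > 0"
  shows "euclid_states m n = insert (1, 0, 0, 1, m, n)
           ((\<lambda>(a, b, c, d, r, s). (a, b, a + c, b + d, r, s)) ` euclid_states m (n - m))"
proof (intro equalityI subsetI)
  fix x assume x: "x \<in> euclid_states m n"
  obtain a b c d r s where x_eq: "x = (a, b, c, d, r, s)" by (cases x) auto
  have H: "a * r + b * s \<le> c * r + d * s" "1 \<le> r" "r \<le> s" "a * d = b * c + 1"
    "m = a * r + b * s" "n = c * r + d * s"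
    using x assms by (auto simp: euclid_states_def x_eq)
  consider "a = 1 \<and> b = 0 \<and> c = 0 \<and> d = 1" | "a \<le> c \<and> b \<le> d" | "c \<le> a \<and> d \<le> b"
    using nonneg_sl2_cases[OF H(4)] by blast
  then show "x \<in> insert (1, 0, 0, 1, m, n)
           ((\<lambda>(a, b, c, d, r, s). (a, b, a + c, b + d, r, s)) ` euclid_states m (n - m))"
  proof cases
    case 1 then show ?thesis using H x_eq by simp
  next
    case 2
    then obtain y z where yz: "c = a + y" "d = b + z" by (metis le_iff_add)
    then have "(a, b, y, z, r, s) \<in> euclid_states m (n - m)"
      using H by (auto simp: euclid_states_def algebra_simps)
    then show ?thesis unfolding x_eq yz by force
  next
    case 3
    then obtain y z where yz: "a = c + y" "b = d + z" by (metis le_iff_add)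
    have "y * r + z * s = 0" using H(1) unfolding yz by (simp add: algebra_simps)
    then have "y = 0" "z = 0" using H by auto
    then show ?thesis using H(4) yz by (simp add: algebra_simps)
  qed
next
  fix x assume "x \<in> insert (1, 0, 0, 1, m, n)
           ((\<lambda>(a, b, c, d, r, s). (a, b, a + c, b + d, r, s)) ` euclid_states m (n - m))"
  then show "x \<in> euclid_states m n"
    using assms by (auto simp: euclid_states_def algebra_simps)
qed

text \<open>The two preceding lemmas reproduce the recursion of \<open>low_steps\<close>, with the
  additional state of \<open>euclid_states_le\<close> as its successor.\<close>

lemma euclid_states_low_steps:
  "finite (euclid_states m n) \<and> card (euclid_states m n) = low_steps m n"
proof (induction m n rule: low_steps.induct)
  case (1 m n)
  consider "m = 0 \<or> n = 0" | "m > 0" "n > 0" "m \<le> n" | "m > 0" "n > 0" "m > n" by linarith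
  then show ?case
  proof cases
    case 1 then show ?thesis by (auto simp: euclid_states_0 low_steps.simps)
  next
    case 2
    let ?f = "\<lambda>(a::nat, b::nat, c, d, r::nat, s::nat). (a, b, a + c, b + d, r, s)"
    have IH: "finite (euclid_states m (n - m))" "card (euclid_states m (n - m)) = low_steps m (n - m)"
      using "1.IH"(1) 2 by auto
    have "inj ?f" by (auto simp: inj_on_def)
    then have "card (?f ` euclid_states m (n - m)) = low_steps m (n - m)"
      using IH by (subst card_image) (auto intro: inj_on_subset)
    moreover have "(1, 0, 0, 1, m, n) \<notin> ?f ` euclid_states m (n - m)" by auto
    ultimately show ?thesis
      using IH 2 by (simp add: euclid_states_le low_steps.simps[of m n])
  next
    case 3
    then have IH: "finite (euclid_states (m - n) n)"
      "card (euclid_states (m - n) n) = low_steps (m - n) n" using "1.IH"(2) by auto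
    have "low_steps m n = low_steps (m - n) n" using 3 by (subst low_steps.simps) simp
    then show ?thesis using IH 3 bij_betw_same_card[OF euclid_states_gt, of n m]
        bij_betw_finite[OF euclid_states_gt, of n m] by simp
  qed
qed

subsection \<open>Moebius inversion\<close>

definition moebius_mu :: "nat \<Rightarrow> real" where
  "moebius_mu n = (if squarefree n then (-1) ^ card (prime_factors n) else 0)"

lemma moebius_0 [simp]: "moebius_mu 0 = 0" and moebius_1 [simp]: "moebius_mu (Suc 0) = 1"
  by (simp_all add: moebius_mu_def)

lemma abs_moebius_le: "\<bar>moebius_mu n\<bar> \<le> 1"
  by (simp add: moebius_mu_def power_abs)

lemma moebius_prime_mult:
  assumes "prime p"
  shows "moebius_mu (p * e) = (if p dvd e then 0 else - moebius_mu e)"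
proof (cases "p dvd e")
  case True
  then have "p ^ 2 dvd p * e" by (simp add: power2_eq_square)
  then have "\<not> squarefree (p * e)" using assms by (intro not_squarefreeI) auto
  then show ?thesis using True by (simp add: moebius_mu_def)
next
  case False
  then have e: "e \<noteq> 0" by (metis dvd_0_right)
  have "coprime p e" using assms False by (simp add: prime_imp_coprime)
  then have sf: "squarefree (p * e) \<longleftrightarrow> squarefree e"
    using assms squarefree_mult_coprime squarefree_multD(2) squarefree_prime by blast
  have "prime_factors (p * e) = insert p (prime_factors e)"
    using assms e by (simp add: prime_factors_product prime_factorization_prime)
  moreover have "p \<notin> prime_factors e" using False by (simp add: in_prime_factors_iff)
  ultimately have "card (prime_factors (p * e)) = Suc (card (prime_factors e))" by simp
  then show ?thesis using sf False by (simp add: moebius_mu_def)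
qed

text \<open>For a prime p dividing n, the divisors p e with e prime to p cancel against the divisors
  e, and those divisible by the square of p contribute nothing.\<close>

lemma sum_moebius_divisors:
  assumes "n > 0"
  shows "(\<Sum>d | d dvd n. moebius_mu d) = (if n = 1 then 1 else 0)"
proof (cases "n = 1")
  case True
  then have "{d. d dvd n} = {1}" by auto
  then show ?thesis using True by simp
next
  case False
  then obtain p where p: "prime p" "p dvd n" using prime_factor_nat by blast
  have fin: "finite {d. d dvd n}" using assms by simp
  have "(\<Sum>d | d dvd n. moebius_mu d) = (\<Sum>d | d dvd n \<and> p dvd d. moebius_mu d) + (\<Sum>d | d dvd n \<and> \<not> p dvd d. moebius_mu d)"
    using fin by (subst sum.union_disjoint[symmetric]) (auto intro!: sum.cong)
  also have "(\<Sum>d | d dvd n \<and> p dvd d. moebius_mu d) = (\<Sum>e | p * e dvd n. moebius_mu (p * e))"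
    by (rule sum.reindex_bij_witness[of _ "\<lambda>e. p * e" "\<lambda>d. d div p"]) (use p in auto)
  also have "\<dots> = (\<Sum>e | e dvd n \<and> \<not> p dvd e. - moebius_mu e)"
  proof (rule sum.mono_neutral_cong_right)
    have "inj (\<lambda>e. p * e)" using p by (auto simp: inj_def)
    then show "finite {e. p * e dvd n}" using finite_vimageI[OF fin] by (simp add: vimage_def)
    show "{e. e dvd n \<and> \<not> p dvd e} \<subseteq> {e. p * e dvd n}"
      using p by (auto intro: divides_mult prime_imp_coprime)
    show "\<forall>e\<in>{e. p * e dvd n} - {e. e dvd n \<and> \<not> p dvd e}. moebius_mu (p * e) = 0"
      using moebius_prime_mult[OF p(1)] by (auto dest: dvd_mult_right)
  qed (use moebius_prime_mult[OF p(1)] in auto)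
  finally show ?thesis using False by (simp add: sum_negf)
qed

text \<open>Pairs with d e <= n are sorted by their product k. This is the form in which all
  truncated Dirichlet convolutions are evaluated.\<close>

lemma sum_divisor_pairs:
  fixes f :: "nat \<Rightarrow> nat \<Rightarrow> 'a :: comm_monoid_add"
  shows "(\<Sum>d=1..n. \<Sum>e=1..n div d. f d (d * e)) = (\<Sum>k=1..n. \<Sum>d | d dvd k. f d k)"
proof -
  have "(\<Sum>d=1..n. \<Sum>e=1..n div d. f d (d * e)) = (\<Sum>(d, e)\<in>(SIGMA d:{1..n}. {1..n div d}). f d (d * e))"
    by (rule sum.Sigma) auto
  also have "\<dots> = (\<Sum>(k, d)\<in>(SIGMA k:{1..n}. {d. d dvd k}). f d k)"
  proof (rule sum.reindex_bij_witness[of _ "\<lambda>(k, d). (d, k div d)" "\<lambda>(d, e). (d * e, d)"])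
    fix a assume "a \<in> (SIGMA d:{1..n}. {1..n div d})"
    then obtain d e where a: "a = (d, e)" "d \<ge> 1" "e \<ge> 1" "e \<le> n div d" by auto
    have "d * e \<le> d * (n div d)" using a by simp
    also have "\<dots> \<le> n" by simp
    finally have "d * e \<le> n" .
    then show "(case a of (d, e) \<Rightarrow> (d * e, d)) \<in> (SIGMA k:{1..n}. {d. d dvd k})" using a by simp
  next
    fix b assume "b \<in> (SIGMA k:{1..n}. {d. d dvd k})"
    then obtain k d where b: "b = (k, d)" "k \<ge> 1" "k \<le> n" "d dvd k" by auto
    then obtain j where j: "k = d * j" by blast
    have "d > 0" "j > 0" using b j by (auto intro: Nat.gr0I)
    moreover have "j \<le> n div d" using b j \<open>d > 0\<close> by (simp add: less_eq_div_iff_mult_less_eq mult.commute)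
    moreover have "d \<le> n" using b dvd_imp_le[of d k] by simp
    ultimately have "d \<le> n" "d > 0" "k div d > 0" "k div d \<le> n div d" using j by auto
    then show "(case b of (k, d) \<Rightarrow> (d, k div d)) \<in> (SIGMA d:{1..n}. {1..n div d})" using b by simp
  qed auto
  also have "\<dots> = (\<Sum>k=1..n. \<Sum>d | d dvd k. f d k)"
    by (rule sum.Sigma[symmetric]) auto
  finally show ?thesis .
qed

text \<open>Nested floors compose, n div d div e = n div (d e), so the double sum depends on d and d
  e only and \<open>sum_moebius_divisors\<close> leaves k = 1.\<close>

lemma moebius_inversion_floor:
  fixes F G :: "nat \<Rightarrow> real"
  assumes "\<And>n. G n = (\<Sum>d=1..n. F (n div d))" "n > 0"
  shows "F n = (\<Sum>d=1..n. moebius_mu d * G (n div d))"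
proof -
  have "(\<Sum>d=1..n. moebius_mu d * G (n div d)) = (\<Sum>d=1..n. \<Sum>e=1..n div d. moebius_mu d * F (n div (d * e)))"
    by (simp add: assms(1) sum_distrib_left div_mult2_eq)
  also have "\<dots> = (\<Sum>k=1..n. \<Sum>d | d dvd k. moebius_mu d * F (n div k))"
    by (rule sum_divisor_pairs[where f = "\<lambda>d k. moebius_mu d * F (n div k)"])
  also have "\<dots> = (\<Sum>k=1..n. if k = 1 then F n else 0)"
    by (intro sum.cong refl) (simp add: sum_distrib_right[symmetric] sum_moebius_divisors)
  also have "\<dots> = F n" using assms(2) by simp
  finally show ?thesis ..
qed

section \<open>Dirichlet series at 2 with powers of logarithms\<close>

definition zeta_log_term :: "nat \<Rightarrow> nat \<Rightarrow> real" where
  "zeta_log_term k n = ln (real n) ^ k / (real n)\<^sup>2"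

lemma summable_zeta_log: 
  assumes "k \<le> 2"
  shows "summable (zeta_log_term k)"
proof -
  consider "k = 0" | "k = 1" | "k = 2" using assms by linarith
  then have *: "(\<lambda>n. ln (real n) ^ k / (real n)\<^sup>2) \<in> O(\<lambda>n. real n powr (-3/2))"
  proof cases
    case 1
    have "(\<lambda>n. 1 / (real n)\<^sup>2) \<in> O(\<lambda>n. real n powr (-3/2))" by real_asymp
    then show ?thesis using 1 by simp
  next
    case 2
    have "(\<lambda>n. ln (real n) / (real n)\<^sup>2) \<in> O(\<lambda>n. real n powr (-3/2))" by real_asymp
    then show ?thesis using 2 by simp
  next
    case 3
    have "(\<lambda>n. ln (real n) ^ 2 / (real n)\<^sup>2) \<in> O(\<lambda>n. real n powr (-3/2))" by real_asymp
    then show ?thesis using 3 by simp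
  qed
  show ?thesis unfolding zeta_log_term_def[abs_def]
    by (rule summable_comparison_test_bigo[OF _ *]) (simp add: summable_real_powr_iff)
qed

lemma zeta_log_term_nonneg: "zeta_log_term k n \<ge> 0"
  by (cases "n = 0") (auto simp: zeta_log_term_def)

text \<open>Division by zero makes the term at index 0 vanish, so the unshifted series has the same
  sum as the shifted one in \<open>zeta\<close>.\<close>

lemma zeta_2: "zeta 2 = (\<Sum>n. zeta_log_term 0 n)"
proof -
  have "(\<Sum>n. zeta_log_term 0 n) = (\<Sum>n. zeta_log_term 0 (Suc n))"
    by (subst suminf_split_head[OF summable_zeta_log]) (auto simp: zeta_log_term_def)
  then show ?thesis by (simp add: zeta_def zeta_log_term_def)
qed

lemma zeta_2_ge_1: "zeta 2 \<ge> 1"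
proof -
  have "(\<Sum>n\<in>{1}. zeta_log_term 0 n) \<le> (\<Sum>n. zeta_log_term 0 n)"
    by (rule sum_le_suminf[OF summable_zeta_log]) (auto simp: zeta_log_term_nonneg)
  then show ?thesis by (simp add: zeta_2 zeta_log_term_def)
qed

text \<open>Termwise differentiation on a neighbourhood of 2 that stays to the right of 3/2; the
  differentiated terms have the summable majorant ln n / n^(3/2).\<close>

lemma deriv_zeta_2: "deriv zeta 2 = - (\<Sum>n. zeta_log_term 1 n)"
proof -
  define f where "f n s = 1 / real (Suc n) powr s" for n and s :: real
  define f' where "f' n s = - ln (real (Suc n)) / real (Suc n) powr s" for n and s :: real
  let ?S = "{3/2<..<3} :: real set"
  have "((\<lambda>s. \<Sum>n. f n s) has_field_derivative (\<Sum>n. f' n 2)) (at 2)"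
  proof (rule has_field_derivative_series'(2)[of ?S f f' 2])
    show "(f n has_field_derivative f' n s) (at s within ?S)" for n s
    proof -
      have "f n = (\<lambda>s. exp (- (s * ln (real (Suc n)))))"
        by (simp add: fun_eq_iff f_def powr_def exp_minus field_simps)
      moreover have "((\<lambda>s. exp (- (s * ln (real (Suc n))))) has_field_derivative f' n s) (at s within ?S)"
        by (auto intro!: derivative_eq_intros simp: f'_def powr_def exp_minus field_simps)
      ultimately show ?thesis by simp
    qed
    show "uniformly_convergent_on ?S (\<lambda>n s. \<Sum>i<n. f' i s)"
    proof (rule Weierstrass_m_test')
      fix n and s :: real assume s: "s \<in> ?S"
      have "real (Suc n) powr (3/2) \<le> real (Suc n) powr s" using s by (intro powr_mono) auto
      then show "norm (f' n s) \<le> ln (real (Suc n)) / real (Suc n) powr (3/2)"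
        unfolding f'_def by (simp add: divide_left_mono)
    next
      have "(\<lambda>n. ln (real (Suc n)) / real (Suc n) powr (3/2)) \<in> O(\<lambda>n. real n powr (-5/4))"
        by real_asymp
      then show "summable (\<lambda>n. ln (real (Suc n)) / real (Suc n) powr (3/2))"
        by (rule summable_comparison_test_bigo[rotated]) (simp add: summable_real_powr_iff)
    qed
    have "summable (\<lambda>n. zeta_log_term 0 (Suc n))"
      using summable_zeta_log[of 0] by (subst summable_Suc_iff) auto
    then show "summable (\<lambda>n. f n 2)" by (simp add: f_def zeta_log_term_def)
    have "interior ?S = ?S" by (rule interior_open) auto
    then show "2 \<in> interior ?S" by simp
  qed auto
  then have "deriv zeta 2 = (\<Sum>n. f' n 2)"
    unfolding f_def zeta_def[abs_def, symmetric] by (rule DERIV_imp_deriv)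
  also have "f' n 2 = - zeta_log_term 1 (Suc n)" for n
    by (simp add: f'_def zeta_log_term_def)
  then have "(\<Sum>n. f' n 2) = (\<Sum>n. - zeta_log_term 1 (Suc n))" by simp
  also have "\<dots> = - (\<Sum>n. zeta_log_term 1 (Suc n))"
    using summable_zeta_log[of 1] by (intro suminf_minus) (subst summable_Suc_iff, simp)
  also have "(\<Sum>n. zeta_log_term 1 (Suc n)) = (\<Sum>n. zeta_log_term 1 n)"
  proof -
    have "zeta_log_term 1 0 = 0" by (simp add: zeta_log_term_def)
    then show ?thesis using suminf_split_head[OF summable_zeta_log[of 1]] by simp
  qed
  finally show ?thesis .
qed

text \<open>For fixed d the inner sum tends to the sum of g, and |f d| times that sum is a summable
  majorant, so Tannery's theorem applies. The truncation d e <= N is the one on which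
  \<open>sum_divisor_pairs\<close> works.\<close>

lemma dirichlet_convolution_limit:
  fixes f g :: "nat \<Rightarrow> real"
  assumes "summable (\<lambda>d. \<bar>f d\<bar>)" "summable g" "\<And>e. g e \<ge> 0" "f 0 = 0" "g 0 = 0"
  shows "(\<lambda>N. \<Sum>d=1..N. f d * (\<Sum>e=1..N div d. g e)) \<longlonglongrightarrow> suminf f * suminf g"
proof -
  define S where "S N = (\<Sum>e=1..N. g e)" for N
  define a where "a d N = (if d \<in> {1..N} then f d * S (N div d) else 0)" for d N
  have S_eq: "S N = (\<Sum>e<Suc N. g e)" for N
    unfolding S_def by (rule sum.mono_neutral_left) (use assms(5) in \<open>auto simp: not_less_eq_eq\<close>)
  have S_lim: "S \<longlonglongrightarrow> suminf g"
    unfolding S_eq[abs_def] by (rule LIMSEQ_Suc, rule summable_LIMSEQ) (use assms in simp)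
  have S_nonneg: "S N \<ge> 0" for N unfolding S_def by (rule sum_nonneg) (use assms in auto)
  have S_le: "S N \<le> suminf g" for N
    unfolding S_eq by (rule sum_le_suminf) (use assms in auto)
  have lim: "(\<lambda>N. a d N) \<longlonglongrightarrow> f d * suminf g" for d
  proof (cases "d = 0")
    case False
    have "filterlim (\<lambda>N. N div d) at_top at_top"
      unfolding filterlim_at_top
    proof
      fix Z
      show "\<forall>\<^sub>F N in sequentially. Z \<le> N div d"
        using eventually_ge_at_top[of "Z * d"] by eventually_elim (use False in \<open>simp add: less_eq_div_iff_mult_less_eq\<close>)
    qed
    then have "(\<lambda>N. f d * S (N div d)) \<longlonglongrightarrow> f d * suminf g"
      by (intro tendsto_mult_left filterlim_compose[OF S_lim])
    moreover have "\<forall>\<^sub>F N in sequentially. f d * S (N div d) = a d N"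
      using eventually_ge_at_top[of d] by eventually_elim (use False in \<open>simp add: a_def\<close>)
    ultimately show ?thesis by (rule Lim_transform_eventually)
  qed (use assms in \<open>simp add: a_def\<close>)
  have "((\<lambda>N. suminf (\<lambda>d. a d N)) \<longlonglongrightarrow> suminf (\<lambda>d. f d * suminf g))"
  proof (rule conjunct2[OF conjunct2[OF tannerys_theorem]])
    show "summable (\<lambda>d. \<bar>f d\<bar> * suminf g)" by (rule summable_mult2) (use assms in simp)
    show "\<forall>\<^sub>F (d, N) in sequentially \<times>\<^sub>F sequentially. norm (a d N) \<le> \<bar>f d\<bar> * suminf g"
      using S_le S_nonneg by (intro always_eventually)
        (auto simp: a_def abs_mult intro!: mult_left_mono mult_nonneg_nonneg order.trans[OF S_nonneg S_le])
  qed (use lim in auto)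
  also have "(\<lambda>N. suminf (\<lambda>d. a d N)) = (\<lambda>N. \<Sum>d=1..N. f d * S (N div d))"
  proof
    fix N
    have "suminf (\<lambda>d. a d N) = (\<Sum>d=1..N. a d N)" by (rule suminf_finite) (auto simp: a_def)
    then show "suminf (\<lambda>d. a d N) = (\<Sum>d=1..N. f d * S (N div d))" by (simp add: a_def)
  qed
  also have "suminf (\<lambda>d. f d * suminf g) = suminf f * suminf g"
    by (rule suminf_mult2[symmetric], rule summable_rabs_cancel) (use assms in simp)
  finally show ?thesis by (simp add: S_def)
qed

definition moebius_log_term :: "nat \<Rightarrow> nat \<Rightarrow> real" where
  "moebius_log_term k n = moebius_mu n * zeta_log_term k n"

lemma zeta_log_term_at_0 [simp]: "zeta_log_term k 0 = 0"
  by (simp add: zeta_log_term_def)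

lemma moebius_log_term_0 [simp]: "moebius_log_term k 0 = 0"
  by (simp add: moebius_log_term_def)

lemma abs_moebius_log_term_le: "\<bar>moebius_log_term k n\<bar> \<le> zeta_log_term k n"
  unfolding moebius_log_term_def abs_mult
  using mult_right_mono[OF abs_moebius_le, of "\<bar>zeta_log_term k n\<bar>" n] by (simp add: zeta_log_term_nonneg)

lemma summable_moebius_log: 
  assumes "k \<le> 2"
  shows "summable (\<lambda>n. \<bar>moebius_log_term k n\<bar>)" "summable (moebius_log_term k)"
proof -
  show "summable (\<lambda>n. \<bar>moebius_log_term k n\<bar>)"
    by (rule summable_comparison_test'[OF summable_zeta_log[OF assms], of 0]) (simp add: abs_moebius_log_term_le)
  then show "summable (moebius_log_term k)" by (rule summable_rabs_cancel)
qed

lemma zeta_log_term_mult_0: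
  "zeta_log_term 0 d * zeta_log_term k e = ln (real e) ^ k / (real (d * e))\<^sup>2"
  by (simp add: zeta_log_term_def power_mult_distrib)

text \<open>The truncated convolutions with the series of zeta(2) are all equal to 1, so their
  limit, the product of the two series, is 1.\<close>

lemma suminf_moebius_0: "suminf (moebius_log_term 0) = 1 / zeta 2"
proof -
  have "(\<Sum>d=1..N. moebius_log_term 0 d * (\<Sum>e=1..N div d. zeta_log_term 0 e)) = 1" if "N \<ge> 1" for N
  proof -
    have "(\<Sum>d=1..N. moebius_log_term 0 d * (\<Sum>e=1..N div d. zeta_log_term 0 e)) = (\<Sum>d=1..N. \<Sum>e=1..N div d. moebius_mu d / (real (d * e))\<^sup>2)"
      by (simp add: sum_distrib_left moebius_log_term_def mult.assoc zeta_log_term_mult_0)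
    also have "\<dots> = (\<Sum>k=1..N. \<Sum>d | d dvd k. moebius_mu d / (real k)\<^sup>2)"
      by (rule sum_divisor_pairs[where f = "\<lambda>d k. moebius_mu d / (real k)\<^sup>2"])
    also have "\<dots> = (\<Sum>k=1..N. if k = 1 then 1 else 0)"
      by (intro sum.cong refl) (simp add: sum_divide_distrib[symmetric] sum_moebius_divisors)
    also have "\<dots> = 1" using that by simp
    finally show ?thesis .
  qed
  then have "\<forall>\<^sub>F N in sequentially. (\<Sum>d=1..N. moebius_log_term 0 d * (\<Sum>e=1..N div d. zeta_log_term 0 e)) = 1"
    by (rule eventually_sequentiallyI)
  then have "(\<lambda>N. \<Sum>d=1..N. moebius_log_term 0 d * (\<Sum>e=1..N div d. zeta_log_term 0 e)) \<longlonglongrightarrow> 1"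
    by (rule tendsto_eventually)
  moreover have "(\<lambda>N. \<Sum>d=1..N. moebius_log_term 0 d * (\<Sum>e=1..N div d. zeta_log_term 0 e)) \<longlonglongrightarrow> suminf (moebius_log_term 0) * zeta 2"
    unfolding zeta_2 by (rule dirichlet_convolution_limit)
      (simp_all add: summable_moebius_log summable_zeta_log zeta_log_term_nonneg)
  ultimately have "suminf (moebius_log_term 0) * zeta 2 = 1" by (rule LIMSEQ_unique[symmetric])
  then show ?thesis using zeta_2_ge_1 by (simp add: field_simps)
qed

text \<open>The derivative of the product of zeta and its reciprocal at 2. Since ln d + ln e = ln (d
  e), the two truncated convolutions merge into one; in it k > 1 is killed by the Moebius sum and k
  = 1 by ln 1 = 0.\<close>

lemma suminf_moebius_1: "suminf (moebius_log_term 1) = deriv zeta 2 / (zeta 2)\<^sup>2"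
proof -
  let ?L = "\<lambda>N. (\<Sum>d=1..N. moebius_log_term 1 d * (\<Sum>e=1..N div d. zeta_log_term 0 e)) + (\<Sum>d=1..N. moebius_log_term 0 d * (\<Sum>e=1..N div d. zeta_log_term 1 e))"
  have "?L N = 0" for N
  proof -
    have "moebius_log_term 1 d * zeta_log_term 0 e + moebius_log_term 0 d * zeta_log_term 1 e = moebius_mu d * ln (real (d * e)) / (real (d * e))\<^sup>2"
      if "d \<ge> 1" "e \<ge> 1" for d e
      using that by (simp add: moebius_log_term_def zeta_log_term_def ln_mult power_mult_distrib add_divide_distrib distrib_left)
    then have "?L N = (\<Sum>d=1..N. \<Sum>e=1..N div d. moebius_mu d * ln (real (d * e)) / (real (d * e))\<^sup>2)"
      by (simp add: sum_distrib_left sum.distrib[symmetric])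
    also have "\<dots> = (\<Sum>k=1..N. \<Sum>d | d dvd k. moebius_mu d * ln (real k) / (real k)\<^sup>2)"
      by (rule sum_divisor_pairs[where f = "\<lambda>d k. moebius_mu d * ln (real k) / (real k)\<^sup>2"])
    also have "\<dots> = (\<Sum>k=1..N. 0)"
      by (intro sum.cong refl) (simp add: sum_divide_distrib[symmetric] sum_distrib_right[symmetric] sum_moebius_divisors)
    finally show ?thesis by simp
  qed
  then have "?L \<longlonglongrightarrow> 0" by simp
  moreover have "?L \<longlonglongrightarrow> suminf (moebius_log_term 1) * suminf (zeta_log_term 0) + suminf (moebius_log_term 0) * suminf (zeta_log_term 1)"
    by (intro tendsto_add dirichlet_convolution_limit)
      (simp_all add: summable_moebius_log[where k = 1, simplified] summable_moebius_log summable_zeta_log[where k = 1, simplified] summable_zeta_log zeta_log_term_nonneg)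
  ultimately have "0 = suminf (moebius_log_term 1) * suminf (zeta_log_term 0) + suminf (moebius_log_term 0) * suminf (zeta_log_term 1)"
    by (rule LIMSEQ_unique)
  moreover have "suminf (zeta_log_term 0) = zeta 2" "suminf (zeta_log_term 1) = - deriv zeta 2"
    by (simp_all only: zeta_2 deriv_zeta_2 minus_minus)
  ultimately have "suminf (moebius_log_term 1) * zeta 2 + 1 / zeta 2 * (- deriv zeta 2) = 0"
    by (simp only: suminf_moebius_0)
  then show ?thesis using zeta_2_ge_1 by (simp add: field_simps power2_eq_square)
qed

text \<open>In the tail d > n, so the factor ln n may be pulled inside as ln d. Mere convergence of
  the series with i + j logarithms then makes the tail O((ln n)^(-j)).\<close>

lemma moebius_log_partial_sum:
  assumes "i + j \<le> 2" "n \<ge> 1"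
  shows "ln (real n) ^ j * \<bar>suminf (moebius_log_term i) - (\<Sum>d=1..n. moebius_log_term i d)\<bar> \<le> suminf (zeta_log_term (i + j))"
proof -
  let ?S = "(\<Sum>d=1..n. moebius_log_term i d)"
  have i: "i \<le> 2" using assms by simp
  have s: "summable (\<lambda>d. \<bar>moebius_log_term i (d + Suc n)\<bar>)"
    by (subst summable_iff_shift) (rule summable_moebius_log[OF i])
  have z: "summable (\<lambda>d. zeta_log_term (i + j) (d + Suc n))"
    by (subst summable_iff_shift) (rule summable_zeta_log[OF assms(1)])
  have "?S = (\<Sum>d<Suc n. moebius_log_term i d)"
    by (rule sum.mono_neutral_left) (auto simp: not_less_eq_eq)
  then have "suminf (moebius_log_term i) - ?S = (\<Sum>d. moebius_log_term i (d + Suc n))"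
    using suminf_minus_initial_segment[OF summable_moebius_log(2)[OF i], of "Suc n"] by simp
  then have "\<bar>suminf (moebius_log_term i) - ?S\<bar> \<le> (\<Sum>d. \<bar>moebius_log_term i (d + Suc n)\<bar>)"
    using summable_rabs[OF s] by simp
  then have "ln (real n) ^ j * \<bar>suminf (moebius_log_term i) - ?S\<bar>
      \<le> ln (real n) ^ j * (\<Sum>d. \<bar>moebius_log_term i (d + Suc n)\<bar>)"
    using assms by (intro mult_left_mono) auto
  also have "\<dots> = (\<Sum>d. ln (real n) ^ j * \<bar>moebius_log_term i (d + Suc n)\<bar>)"
    by (rule suminf_mult[OF s, symmetric])
  also have "\<dots> \<le> (\<Sum>d. zeta_log_term (i + j) (d + Suc n))"
  proof (rule suminf_le)
    fix d
    have "ln (real n) ^ j * \<bar>moebius_log_term i (d + Suc n)\<bar> \<le> ln (real (d + Suc n)) ^ j * zeta_log_term i (d + Suc n)"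
      using assms by (intro mult_mono power_mono abs_moebius_log_term_le) auto
    also have "\<dots> = zeta_log_term (i + j) (d + Suc n)" by (simp add: zeta_log_term_def power_add)
    finally show "ln (real n) ^ j * \<bar>moebius_log_term i (d + Suc n)\<bar> \<le> zeta_log_term (i + j) (d + Suc n)" .
  qed (use s z in \<open>auto intro: summable_mult\<close>)
  also have "\<dots> \<le> suminf (zeta_log_term (i + j))"
    using suminf_minus_initial_segment[OF summable_zeta_log[OF assms(1)], of "Suc n"]
      sum_nonneg[of "{..<Suc n}" "zeta_log_term (i + j)"] zeta_log_term_nonneg by simp
  finally show ?thesis .
qed

section \<open>Expansions with a quadratic polynomial in the logarithm and error O(n^2)\<close>

definition quad_log :: "real \<Rightarrow> real \<Rightarrow> real \<Rightarrow> real" where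
  "quad_log A B x = x\<^sup>2 * (A * (ln x)\<^sup>2 + B * ln x)"

text \<open>The bound is required from n = 1 on and not just eventually, since Moebius inversion
  evaluates the function at \<open>n div d\<close> for all d up to n.\<close>

definition has_quad_log :: "(nat \<Rightarrow> real) \<Rightarrow> real \<Rightarrow> real \<Rightarrow> bool" where
  "has_quad_log f A B \<longleftrightarrow> (\<exists>K. \<forall>n\<ge>1. \<bar>f n - quad_log A B (real n)\<bar> \<le> K * (real n)\<^sup>2)"

lemma has_quad_logI:
  "(\<And>n. n \<ge> 1 \<Longrightarrow> \<bar>f n - quad_log A B (real n)\<bar> \<le> K * (real n)\<^sup>2) \<Longrightarrow> has_quad_log f A B"
  unfolding has_quad_log_def by blast

lemma has_quad_logE:
  assumes "has_quad_log f A B"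
  obtains K where "\<And>n. n \<ge> 1 \<Longrightarrow> \<bar>f n - quad_log A B (real n)\<bar> \<le> K * (real n)\<^sup>2"
  using assms unfolding has_quad_log_def by blast

lemma ln_le_two_sqrt:
  fixes x :: real
  assumes "x \<ge> 1"
  shows "ln x \<le> 2 * sqrt x"
proof -
  have "ln x = 2 * ln (sqrt x)" using assms by (simp add: ln_sqrt)
  also have "\<dots> \<le> 2 * sqrt x" using ln_le_minus_one[of "sqrt x"] assms by simp
  finally show ?thesis .
qed

lemma ln_squared_le:
  fixes x :: real
  assumes "x \<ge> 1"
  shows "(ln x)\<^sup>2 \<le> 4 * x"
proof -
  have "(ln x)\<^sup>2 \<le> (2 * sqrt x)\<^sup>2"
    using assms ln_le_two_sqrt[OF assms] by (intro power_mono) auto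
  then show ?thesis using assms by (simp add: power_mult_distrib)
qed

text \<open>The derivative of \<open>quad_log\<close> is O(x (ln x)^2), and (ln x)^2 <= 4 x, so a
  shift of the argument by at most 1 costs O(x^2). This permits replacing \<open>n div d\<close> by
  n / d.\<close>

lemma quad_log_near:
  fixes x y :: real
  assumes "1 \<le> y" "y \<le> x" "x \<le> y + 1"
  shows "\<bar>quad_log A B x - quad_log A B y\<bar> \<le> (10 * \<bar>A\<bar> + 3 * \<bar>B\<bar>) * x\<^sup>2"
proof -
  have x: "x \<ge> 1" using assms by simp
  have lx: "0 \<le> ln x" "0 \<le> ln y" "ln y \<le> ln x" "ln x \<le> x" using assms ln_le_minus_one[of x] by auto
  have "ln x - ln y = ln (x / y)" using assms by (simp add: ln_div)
  also have "\<dots> \<le> x / y - 1" using assms ln_le_minus_one[of "x / y"] by simp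
  also have "\<dots> = (x - y) / y" using assms by (simp add: diff_divide_distrib)
  also have "\<dots> \<le> 1 / y" using assms by (intro divide_right_mono) auto
  finally have d: "ln x - ln y \<le> 1 / y" .
  have sq: "0 \<le> x\<^sup>2 - y\<^sup>2" "x\<^sup>2 - y\<^sup>2 \<le> 2 * x"
  proof -
    have "x\<^sup>2 - y\<^sup>2 = (x - y) * (x + y)" by (simp add: power2_eq_square algebra_simps)
    moreover have "(x - y) * (x + y) \<le> 1 * (2 * x)" using assms by (intro mult_mono) auto
    moreover have "0 \<le> (x - y) * (x + y)" using assms by simp
    ultimately show "0 \<le> x\<^sup>2 - y\<^sup>2" "x\<^sup>2 - y\<^sup>2 \<le> 2 * x" by auto
  qed
  have yd: "y\<^sup>2 * (ln x - ln y) \<le> x"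
  proof -
    have "y\<^sup>2 * (ln x - ln y) \<le> y\<^sup>2 * (1 / y)" using d by (intro mult_left_mono) auto
    also have "\<dots> = y" using assms by (simp add: power2_eq_square)
    finally show ?thesis using assms by simp
  qed
  have yd0: "0 \<le> y\<^sup>2 * (ln x - ln y)" using lx by simp
  have xx: "x \<le> x\<^sup>2" using x by (simp add: power2_eq_square)
  define p where "p = x\<^sup>2 * (ln x)\<^sup>2 - y\<^sup>2 * (ln y)\<^sup>2"
  define q where "q = x\<^sup>2 * ln x - y\<^sup>2 * ln y"
  have "p = (x\<^sup>2 - y\<^sup>2) * (ln x)\<^sup>2 + y\<^sup>2 * (ln x - ln y) * (ln x + ln y)"
    by (simp add: p_def algebra_simps power2_eq_square)
  moreover have "(x\<^sup>2 - y\<^sup>2) * (ln x)\<^sup>2 \<le> (2 * x) * (4 * x)"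
    using sq ln_squared_le[OF x] x by (intro mult_mono) auto
  moreover have "y\<^sup>2 * (ln x - ln y) * (ln x + ln y) \<le> x * (2 * x)"
    using yd yd0 lx x by (intro mult_mono) auto
  moreover have "0 \<le> (x\<^sup>2 - y\<^sup>2) * (ln x)\<^sup>2" using sq by simp
  moreover have "0 \<le> y\<^sup>2 * (ln x - ln y) * (ln x + ln y)" using yd0 lx by (intro mult_nonneg_nonneg) auto
  ultimately have p: "\<bar>p\<bar> \<le> 10 * x\<^sup>2" by (simp add: power2_eq_square)
  have "q = (x\<^sup>2 - y\<^sup>2) * ln x + y\<^sup>2 * (ln x - ln y)"
    by (simp add: q_def algebra_simps)
  moreover have "(x\<^sup>2 - y\<^sup>2) * ln x \<le> (2 * x) * x" using sq lx x by (intro mult_mono) auto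
  moreover have "0 \<le> (x\<^sup>2 - y\<^sup>2) * ln x" using sq lx by simp
  ultimately have q: "\<bar>q\<bar> \<le> 3 * x\<^sup>2" using yd yd0 xx by (simp add: power2_eq_square)
  have "quad_log A B x - quad_log A B y = A * p + B * q"
    by (simp add: quad_log_def p_def q_def algebra_simps)
  then have "\<bar>quad_log A B x - quad_log A B y\<bar> \<le> \<bar>A\<bar> * \<bar>p\<bar> + \<bar>B\<bar> * \<bar>q\<bar>"
    using abs_triangle_ineq[of "A * p" "B * q"] by (simp add: abs_mult)
  also have "\<dots> \<le> \<bar>A\<bar> * (10 * x\<^sup>2) + \<bar>B\<bar> * (3 * x\<^sup>2)"
    using p q by (intro add_mono mult_left_mono) auto
  finally show ?thesis by (simp add: algebra_simps)
qed

lemma floor_div_bounds: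
  fixes n d :: nat
  assumes "1 \<le> d" "d \<le> n"
  shows "1 \<le> real (n div d)" "real (n div d) \<le> real n / real d" "real n / real d \<le> real (n div d) + 1"
proof -
  have "n div d \<ge> 1" using assms by (simp add: Suc_le_eq div_greater_zero_iff)
  then show "1 \<le> real (n div d)" by simp
  have "d * (n div d) \<le> n" by simp
  then have "real (d * (n div d)) \<le> real n" by (rule of_nat_mono)
  then show "real (n div d) \<le> real n / real d" using assms by (simp add: field_simps)
  have "n \<le> d * (n div d) + d" using assms mod_less_divisor[of d n] mult_div_mod_eq[of d n] by linarith
  then have "real n \<le> real (d * (n div d) + d)" by (rule of_nat_mono)
  then show "real n / real d \<le> real (n div d) + 1" using assms by (simp add: field_simps)
qed

lemma abs_triangle_two: "\<bar>x - z\<bar> \<le> \<bar>x - y\<bar> + \<bar>y - (z::real)\<bar>"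
  using abs_triangle_ineq[of "x - y" "y - z"] by simp

lemma abs_sum7_le:
  fixes x1 :: real
  assumes "\<bar>x1\<bar> \<le> b1" "\<bar>x2\<bar> \<le> b2" "\<bar>x3\<bar> \<le> b3" "\<bar>x4\<bar> \<le> b4" "\<bar>x5\<bar> \<le> b5" "\<bar>x6\<bar> \<le> b6" "\<bar>x7\<bar> \<le> b7"
  shows "\<bar>x1 + x2 - x3 - x4 + x5 + x6 - x7\<bar> \<le> b1 + b2 + b3 + b4 + b5 + b6 + b7"
  by (intro order.trans[OF abs_triangle_ineq] order.trans[OF abs_triangle_ineq4] add_mono assms)

text \<open>Errors of size (n / d)^2 sum to O(n^2), so only the main terms at n / d matter. With ln
  (n / d) = ln n - ln d they lead to partial sums of mu(d) (ln d)^i / d^2. The limits 1 / zeta(2)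
  for i = 0 and zeta'(2) / zeta(2)^2 for i = 1 enter the new coefficients; i = 2 only affects the
  error.\<close>

lemma moebius_transfer:
  fixes F G :: "nat \<Rightarrow> real"
  assumes G: "\<And>n. G n = (\<Sum>d=1..n. F (n div d))"
    and G_log: "has_quad_log G A B"
  shows "has_quad_log F (A / zeta 2) (B / zeta 2 - 2 * A * deriv zeta 2 / (zeta 2)\<^sup>2)"
proof -
  let ?P = "\<lambda>n. quad_log (A / zeta 2) (B / zeta 2 - 2 * A * deriv zeta 2 / (zeta 2)\<^sup>2) (real n)"
  let ?S = "\<lambda>n. \<Sum>d=1..n. moebius_mu d * quad_log A B (real n / real d)"
  obtain K where K: "\<And>n. n \<ge> 1 \<Longrightarrow> \<bar>G n - quad_log A B (real n)\<bar> \<le> K * (real n)\<^sup>2"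
    using has_quad_logE[OF G_log] by blast
  define Q where "Q i = suminf (zeta_log_term i)" for i
  define M where "M i = suminf (moebius_log_term i)" for i
  define K1 where "K1 = K + (10 * \<bar>A\<bar> + 3 * \<bar>B\<bar>)"
  define K2 where "K2 = \<bar>A\<bar> * Q 2 + \<bar>B\<bar> * Q 1 + 2 * \<bar>A\<bar> * Q 2 + \<bar>B\<bar> * Q 1 + \<bar>A\<bar> * Q 2 + \<bar>A\<bar> * \<bar>M 2\<bar> + \<bar>B\<bar> * \<bar>M 1\<bar>"
  define K' where "K' = K1 * Q 0 + K2"
  have "\<bar>F n - ?P n\<bar> \<le> K' * (real n)\<^sup>2"
    if n: "n \<ge> 1" for n
  proof -
    define L where "L = ln (real n)"
    define S where "S i = (\<Sum>d=1..n. moebius_log_term i d)" for i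
    have L: "L \<ge> 0" using n by (simp add: L_def)
    have K0: "K \<ge> 0" using K[of 1] by (simp add: order.trans[OF abs_ge_zero])
    have near: "\<bar>G (n div d) - quad_log A B (real n / real d)\<bar> \<le> K1 * (real n / real d)\<^sup>2" if d: "d \<in> {1..n}" for d
    proof -
      note b = floor_div_bounds[of d n]
      have "\<bar>G (n div d) - quad_log A B (real (n div d))\<bar> \<le> K * (real (n div d))\<^sup>2"
        using b d by (intro K) auto
      also have "\<dots> \<le> K * (real n / real d)\<^sup>2"
        using b d K0 by (intro mult_left_mono power_mono) auto
      finally have "\<bar>G (n div d) - quad_log A B (real (n div d))\<bar> \<le> K * (real n / real d)\<^sup>2" .
      moreover have "\<bar>quad_log A B (real n / real d) - quad_log A B (real (n div d))\<bar> \<le> (10 * \<bar>A\<bar> + 3 * \<bar>B\<bar>) * (real n / real d)\<^sup>2"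
        using b d by (intro quad_log_near) auto
      ultimately show ?thesis unfolding K1_def distrib_right by linarith
    qed
    have FG: "F n = (\<Sum>d=1..n. moebius_mu d * G (n div d))"
      by (rule moebius_inversion_floor[OF G]) (use n in simp)
    have "\<bar>F n - ?S n\<bar>
        = \<bar>\<Sum>d=1..n. moebius_mu d * (G (n div d) - quad_log A B (real n / real d))\<bar>"
      by (simp add: FG sum_subtractf right_diff_distrib)
    also have "\<dots> \<le> (\<Sum>d=1..n. 1 * (K1 * (real n / real d)\<^sup>2))"
    proof (intro order.trans[OF sum_abs] sum_mono)
      fix d assume "d \<in> {1..n}"
      then show "\<bar>moebius_mu d * (G (n div d) - quad_log A B (real n / real d))\<bar> \<le> 1 * (K1 * (real n / real d)\<^sup>2)"
        unfolding abs_mult by (intro mult_mono abs_moebius_le near) auto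
    qed
    also have "\<dots> = K1 * (real n)\<^sup>2 * (\<Sum>d=1..n. zeta_log_term 0 d)"
      by (simp add: zeta_log_term_def sum_distrib_left power_divide)
    also have "\<dots> \<le> K1 * (real n)\<^sup>2 * Q 0"
      unfolding Q_def using K0 by (intro mult_left_mono sum_le_suminf summable_zeta_log) (auto simp: zeta_log_term_nonneg K1_def)
    finally have 1: "\<bar>F n - ?S n\<bar> \<le> K1 * Q 0 * (real n)\<^sup>2"
      by (simp add: mult_ac)
    have "?S n
        = (\<Sum>d=1..n. (real n)\<^sup>2 * ((A * L\<^sup>2 + B * L) * moebius_log_term 0 d - (2 * A * L + B) * moebius_log_term 1 d + A * moebius_log_term 2 d))"
    proof (intro sum.cong refl)
      fix d assume d: "d \<in> {1..n}"
      have eq: "ln (real n / real d) = L - ln (real d)" using d n by (simp add: L_def ln_div)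
      show "moebius_mu d * quad_log A B (real n / real d) = (real n)\<^sup>2 * ((A * L\<^sup>2 + B * L) * moebius_log_term 0 d - (2 * A * L + B) * moebius_log_term 1 d + A * moebius_log_term 2 d)"
        unfolding quad_log_def moebius_log_term_def zeta_log_term_def eq
        by (simp add: power_divide add_divide_distrib diff_divide_distrib algebra_simps power2_eq_square)
    qed
    also have "\<dots> = (real n)\<^sup>2 * ((A * L\<^sup>2 + B * L) * S 0 - (2 * A * L + B) * S 1 + A * S 2)"
      by (simp only: S_def sum_distrib_left[symmetric] sum.distrib sum_subtractf)
    finally have 2: "?S n = (real n)\<^sup>2 * ((A * L\<^sup>2 + B * L) * S 0 - (2 * A * L + B) * S 1 + A * S 2)" .
    have r: "L ^ j * \<bar>S i - M i\<bar> \<le> Q (i + j)" if "i + j \<le> 2" for i j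
      using moebius_log_partial_sum[OF that n] unfolding L_def S_def M_def Q_def by (simp only: abs_minus_commute)
    have r': "\<bar>a * (L ^ j * (S i - M i))\<bar> \<le> \<bar>a\<bar> * Q k" if "i + j = k" "k \<le> 2" for a i j k
      using mult_left_mono[OF r[of i j], of "\<bar>a\<bar>"] L that by (simp add: abs_mult)
    \<comment> \<open>A partial sum with i logarithms is multiplied by at most (ln n)^(2 - i),
      exactly what \<open>moebius_log_partial_sum\<close> absorbs. The limits \<open>M 2\<close> and
      \<open>M 1\<close> in the last two terms of \<open>E_eq\<close> carry no power of ln n and
      belong to the error.\<close>
    define E where "E = ((A * L\<^sup>2 + B * L) * S 0 - (2 * A * L + B) * S 1 + A * S 2) - (A * M 0 * L\<^sup>2 + (B * M 0 - 2 * A * M 1) * L)"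
    have E_eq: "E = A * (L ^ 2 * (S 0 - M 0)) + B * (L ^ 1 * (S 0 - M 0)) - (2 * A) * (L ^ 1 * (S 1 - M 1))
        - B * (L ^ 0 * (S 1 - M 1)) + A * (L ^ 0 * (S 2 - M 2)) + A * M 2 - B * M 1"
      by (simp add: E_def algebra_simps)
    have e1: "\<bar>A * (L ^ 2 * (S 0 - M 0))\<bar> \<le> \<bar>A\<bar> * Q 2" by (rule r') auto
    have e2: "\<bar>B * (L ^ 1 * (S 0 - M 0))\<bar> \<le> \<bar>B\<bar> * Q 1" by (rule r') auto
    have "\<bar>(2 * A) * (L ^ 1 * (S 1 - M 1))\<bar> \<le> \<bar>2 * A\<bar> * Q 2" by (rule r') auto
    then have e3: "\<bar>(2 * A) * (L ^ 1 * (S 1 - M 1))\<bar> \<le> 2 * \<bar>A\<bar> * Q 2"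
      by (simp only: abs_mult[of 2 A] abs_numeral)
    have e4: "\<bar>B * (L ^ 0 * (S 1 - M 1))\<bar> \<le> \<bar>B\<bar> * Q 1" by (rule r') auto
    have e5: "\<bar>A * (L ^ 0 * (S 2 - M 2))\<bar> \<le> \<bar>A\<bar> * Q 2" by (rule r') auto
    have e6: "\<bar>A * M 2\<bar> \<le> \<bar>A\<bar> * \<bar>M 2\<bar>" and e7: "\<bar>B * M 1\<bar> \<le> \<bar>B\<bar> * \<bar>M 1\<bar>"
      by (simp_all add: abs_mult)
    have "\<bar>E\<bar> \<le> K2"
      unfolding E_eq K2_def by (rule abs_sum7_le[OF e1 e2 e3 e4 e5 e6 e7])
    then have *: "(real n)\<^sup>2 * \<bar>E\<bar> \<le> (real n)\<^sup>2 * K2"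
      by (rule mult_left_mono) simp
    have 3: "?P n
        = (real n)\<^sup>2 * (A * M 0 * L\<^sup>2 + (B * M 0 - 2 * A * M 1) * L)"
      unfolding quad_log_def M_def suminf_moebius_0 suminf_moebius_1 L_def by (simp add: algebra_simps)
    have "?S n - ?P n
        = (real n)\<^sup>2 * E"
      unfolding 2 3 E_def by (simp only: right_diff_distrib)
    then have "\<bar>?S n - ?P n\<bar>
        = (real n)\<^sup>2 * \<bar>E\<bar>" by (simp only: abs_mult abs_power2)
    also note *
    also have "(real n)\<^sup>2 * K2 = K2 * (real n)\<^sup>2"
      by (rule mult.commute)
    finally have "\<bar>?S n - ?P n\<bar>
       \<le> K2 * (real n)\<^sup>2" .
    from add_mono[OF 1 this] show ?thesis unfolding K'_def
      by (intro order.trans[OF abs_triangle_two]) (simp only: distrib_right)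
  qed
  then show ?thesis by (rule has_quad_logI)
qed

subsection \<open>The additive divisor problem\<close>

lemma ln_Suc_diff:
  assumes "n > 0"
  shows "1 / (real n + 1) \<le> ln (real n + 1) - ln (real n)" "ln (real n + 1) - ln (real n) \<le> 1 / real n"
proof -
  have "ln (real n) - ln (real n + 1) = ln (real n / (real n + 1))" using assms by (simp add: ln_div)
  also have "\<dots> \<le> real n / (real n + 1) - 1" using assms by (intro ln_le_minus_one) simp
  also have "\<dots> = - (1 / (real n + 1))" by (simp add: field_simps)
  finally show "1 / (real n + 1) \<le> ln (real n + 1) - ln (real n)" by simp
  have "ln (real n + 1) - ln (real n) = ln ((real n + 1) / real n)" using assms by (simp add: ln_div)
  also have "\<dots> \<le> (real n + 1) / real n - 1" using assms by (intro ln_le_minus_one) simp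
  also have "\<dots> = 1 / real n" using assms by (simp add: field_simps)
  finally show "ln (real n + 1) - ln (real n) \<le> 1 / real n" .
qed

text \<open>An elementary Stirling estimate; the induction step uses n d <= 1 <= (n + 1) d for d =
  ln (n + 1) - ln n.\<close>

lemma sum_ln_bounds:
  assumes "n > 0"
  shows "real n * ln (real n) - real n + 1 \<le> (\<Sum>j=1..n. ln (real j))"
    "(\<Sum>j=1..n. ln (real j)) \<le> real n * ln (real n) - real n + 1 + ln (real n)"
proof -
  have "real n * ln (real n) - real n + 1 \<le> (\<Sum>j=1..n. ln (real j)) \<and>
        (\<Sum>j=1..n. ln (real j)) \<le> real n * ln (real n) - real n + 1 + ln (real n)"
    using assms
  proof (induction n rule: nat_induct_non_zero)
    case (Suc n)
    let ?d = "ln (real n + 1) - ln (real n)"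
    have "real n * ?d \<le> real n * (1 / real n)" using ln_Suc_diff[OF Suc(1)] by (intro mult_left_mono) auto
    then have 1: "real n * ?d \<le> 1" using Suc(1) by simp
    have "(real n + 1) * (1 / (real n + 1)) \<le> (real n + 1) * ?d" using ln_Suc_diff[OF Suc(1)] by (intro mult_left_mono) auto
    then have 2: "1 \<le> (real n + 1) * ?d" by simp
    show ?case using Suc(2) 1 2 by (simp add: algebra_simps)
  qed simp
  then show "real n * ln (real n) - real n + 1 \<le> (\<Sum>j=1..n. ln (real j))"
    "(\<Sum>j=1..n. ln (real j)) \<le> real n * ln (real n) - real n + 1 + ln (real n)" by auto
qed

text \<open>After division by n these are Riemann sums of the logarithm on (0, 1), whose integral is
  -1.\<close>

lemma sum_ln_quotient:
  assumes "n > 0"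
  shows "(\<Sum>j=1..n. \<bar>ln (real j) - ln (real n)\<bar>) \<le> real n"
    "\<bar>(\<Sum>j=1..n. ln (real j) - ln (real n)) + real n\<bar> \<le> 1 + ln (real n)"
proof -
  have "(\<Sum>j=1..n. \<bar>ln (real j) - ln (real n)\<bar>) = (\<Sum>j=1..n. ln (real n) - ln (real j))"
    by (intro sum.cong refl) auto
  also have "\<dots> = real n * ln (real n) - (\<Sum>j=1..n. ln (real j))" by (simp add: sum_subtractf)
  also have "\<dots> \<le> real n" using sum_ln_bounds(1)[OF assms] by linarith
  finally show "(\<Sum>j=1..n. \<bar>ln (real j) - ln (real n)\<bar>) \<le> real n" .
  have "(\<Sum>j=1..n. ln (real j) - ln (real n)) = (\<Sum>j=1..n. ln (real j)) - real n * ln (real n)"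
    by (simp add: sum_subtractf)
  moreover have "0 \<le> ln (real n)" using assms by simp
  ultimately show "\<bar>(\<Sum>j=1..n. ln (real j) - ln (real n)) + real n\<bar> \<le> 1 + ln (real n)"
    using sum_ln_bounds[OF assms] by linarith
qed

lemma harm_euler_mascheroni:
  assumes "n > 0"
  shows "\<bar>harm n - ln (real n) - euler_mascheroni\<bar> \<le> 1 / real n"
proof -
  have "euler_mascheroni \<ge> harm n - ln (real n + 1) + inverse (2 * (real n + 1))"
    "euler_mascheroni \<le> harm n - ln (real n + 1) + inverse (2 * real n)"
    using euler_mascheroni_bounds[of n] assms by (auto simp: algebra_simps)
  moreover have "inverse (2 * real n) \<le> 1 / real n" "0 \<le> inverse (2 * (real n + 1))" "0 \<le> 1 / (real n + 1)"
    using assms by (auto simp: field_simps)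
  ultimately show ?thesis using ln_Suc_diff[OF assms] by linarith
qed

section \<open>The summatory divisor function\<close>

definition divisor_sum :: "nat \<Rightarrow> real" where
  "divisor_sum n = (\<Sum>k=1..n. real (card {d. d dvd k}))"

lemma divisor_sum_eq: "divisor_sum n = (\<Sum>d=1..n. real (n div d))"
  using sum_divisor_pairs[of "\<lambda>d k. 1 :: real" n] by (simp add: divisor_sum_def)

lemma divisor_sum_0 [simp]: "divisor_sum 0 = 0"
  by (simp add: divisor_sum_def)

lemma div_bounds: "d > 0 \<Longrightarrow> real n / real d - 1 \<le> real (n div d) \<and> real (n div d) \<le> real n / real d"
proof
  assume d: "d > 0"
  have "d * (n div d) \<le> n" "n \<le> d * (n div d) + d" using mult_div_mod_eq[of d n] mod_less_divisor[OF d, of n] by linarith+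
  then have "real (d * (n div d)) \<le> real n" "real n \<le> real (d * (n div d) + d)" by (simp_all only: of_nat_le_iff)
  then show "real n / real d - 1 \<le> real (n div d)" "real (n div d) \<le> real n / real d" using d by (simp_all add: field_simps)
qed

text \<open>A lattice point under the hyperbola has a coordinate at most k, and the points with both
  coordinates at most k form a full square.\<close>

lemma divisor_sum_hyperbola:
  assumes "k * k \<le> n" "n < (k + 1) * (k + 1)"
  shows "divisor_sum n = 2 * (\<Sum>a=1..k. real (n div a)) - (real k)\<^sup>2"
proof -
  let ?S = "{(a, b). 1 \<le> a \<and> 1 \<le> b \<and> a * b \<le> n}"
  let ?A = "{(a, b). 1 \<le> a \<and> a \<le> k \<and> 1 \<le> b \<and> a * b \<le> n}"
  let ?B = "{(a, b). 1 \<le> a \<and> b \<le> k \<and> 1 \<le> b \<and> a * b \<le> n}"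
  have A: "{(a, b). 1 \<le> a \<and> a \<le> l \<and> 1 \<le> b \<and> a * b \<le> n} = (SIGMA a:{1..l}. {1..n div a})" for l
    by (auto simp: less_eq_div_iff_mult_less_eq mult.commute)
  have cA: "card {(a, b). 1 \<le> a \<and> a \<le> l \<and> 1 \<le> b \<and> a * b \<le> n} = (\<Sum>a=1..l. n div a)" for l
    unfolding A by simp
  have fin: "finite {(a, b). 1 \<le> a \<and> a \<le> l \<and> 1 \<le> b \<and> a * b \<le> n}" for l
    unfolding A by simp
  have le: "a \<le> n" if "a * b \<le> n" "1 \<le> b" for a b :: nat
    using that by (metis mult.right_neutral mult_le_mono2 order_trans)
  have "?S = {(a, b). 1 \<le> a \<and> a \<le> n \<and> 1 \<le> b \<and> a * b \<le> n}" using le by auto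
  then have cS: "card ?S = (\<Sum>a=1..n. n div a)" by (simp only: cA)
  have B: "?B = (\<lambda>(a, b). (b, a)) ` ?A" by (auto simp: image_iff mult.commute)
  have "card ?B = card ?A" unfolding B by (rule card_image) (auto simp: inj_on_def)
  have finB: "finite ?B" unfolding B using fin by blast
  have "?S = ?A \<union> ?B"
  proof -
    have "a \<le> k \<or> b \<le> k" if "a * b \<le> n" for a b :: nat
    proof (rule ccontr)
      assume "\<not> ?thesis"
      then have "(k + 1) * (k + 1) \<le> a * b" by (intro mult_le_mono) auto
      then show False using that assms by linarith
    qed
    then show ?thesis by auto
  qed
  moreover have "?A \<inter> ?B = {1..k} \<times> {1..k}"
  proof -
    have "a * b \<le> n" if "a \<le> k" "b \<le> k" for a b
      using mult_le_mono[OF that] assms by linarith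
    then show ?thesis by auto
  qed
  ultimately have "card ?A + card ?B = card ?S + card ({1..k} \<times> {1..k})"
    using card_Un_Int[OF fin finB] by simp
  then have "2 * (\<Sum>a=1..k. n div a) = (\<Sum>a=1..n. n div a) + k * k"
    using cA[of k] cS \<open>card ?B = card ?A\<close> by simp
  then have "real (2 * (\<Sum>a=1..k. n div a)) = real ((\<Sum>a=1..n. n div a) + k * k)" by (simp only:)
  then show ?thesis by (simp add: divisor_sum_eq power2_eq_square)
qed

definition divisor_main :: "nat \<Rightarrow> real" where
  "divisor_main n = real n * ln (real n) + (2 * euler_mascheroni - 1) * real n"

text \<open>Dirichlet's estimate, from the hyperbola method with k the integer part of sqrt n. An
  error of order n would be too large: in the correlation sum it is multiplied by a quantity of
  order n ln n, and the result has to stay O(n^2).\<close>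

lemma divisor_sum_asymptotics: "\<bar>divisor_sum n - divisor_main n\<bar> \<le> 30 * sqrt (real n)"
proof (cases "n = 0")
  case False
  define k where "k = nat \<lfloor>sqrt (real n)\<rfloor>"
  have sq: "sqrt (real n) \<ge> 1" using False by simp
  have k: "k \<ge> 1" "real k \<le> sqrt (real n)" "sqrt (real n) < real k + 1"
    using sq by (auto simp: k_def le_nat_iff le_floor_iff)
  have "(real k)\<^sup>2 \<le> (sqrt (real n))\<^sup>2" using k by (intro power_mono) auto
  then have k1: "(real k)\<^sup>2 \<le> real n" by simp
  have "(sqrt (real n))\<^sup>2 < (real k + 1)\<^sup>2" using k by (intro power_strict_mono) auto
  then have k2: "real n < (real k + 1)\<^sup>2" by simp
  have kn: "k * k \<le> n" "n < (k + 1) * (k + 1)"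
  proof -
    have "real (k * k) \<le> real n" using k1 by (simp add: power2_eq_square)
    then show "k * k \<le> n" by (simp only: of_nat_le_iff)
    have "real n < real ((k + 1) * (k + 1))" using k2 by (simp add: power2_eq_square algebra_simps)
    then show "n < (k + 1) * (k + 1)" by (simp only: of_nat_less_iff)
  qed
  then have "n \<le> k * k + 2 * k" by simp
  then have "real n \<le> real (k * k + 2 * k)" by (simp only: of_nat_le_iff)
  then have k3: "real n \<le> (real k)\<^sup>2 + 2 * real k" by (simp add: power2_eq_square)
  have K: "real k > 0" using k by simp
  have nk: "real n / real k \<le> 3 * real k"
  proof -
    have "real n / real k \<le> ((real k)\<^sup>2 + 2 * real k) / real k" using k3 K by (intro divide_right_mono) auto
    also have "\<dots> = real k + 2" using K by (simp add: power2_eq_square add_divide_distrib)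
    also have "\<dots> \<le> 3 * real k" using k by simp
    finally show ?thesis .
  qed
  have "(\<Sum>a=1..k. real (n div a)) \<le> (\<Sum>a=1..k. real n / real a)" by (intro sum_mono) (use div_bounds in auto)
  moreover have "(\<Sum>a=1..k. real n / real a) = real n * harm k"
    by (simp add: harm_def sum_distrib_left divide_inverse)
  moreover have "(\<Sum>a=1..k. real n / real a - 1) \<le> (\<Sum>a=1..k. real (n div a))"
    by (intro sum_mono) (use div_bounds in auto)
  ultimately have s: "\<bar>(\<Sum>a=1..k. real (n div a)) - real n * harm k\<bar> \<le> real k"
    by (simp add: sum_subtractf abs_le_iff)
  have "real n * harm k - real n * (ln (real k) + euler_mascheroni) = real n * (harm k - ln (real k) - euler_mascheroni)"
    by (simp add: algebra_simps)
  then have "\<bar>real n * harm k - real n * (ln (real k) + euler_mascheroni)\<bar> = real n * \<bar>harm k - ln (real k) - euler_mascheroni\<bar>"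
    by (simp only: abs_mult abs_of_nat)
  also have "\<dots> \<le> real n * (1 / real k)" using harm_euler_mascheroni[of k] k by (intro mult_left_mono) auto
  finally have h: "\<bar>real n * harm k - real n * (ln (real k) + euler_mascheroni)\<bar> \<le> 3 * real k" using nk by simp
  have "ln (real n) - 2 * ln (real k) = ln (real n / (real k)\<^sup>2)"
    using False K by (simp add: ln_div ln_realpow)
  moreover have "ln (real n / (real k)\<^sup>2) \<le> real n / (real k)\<^sup>2 - 1" using False K by (intro ln_le_minus_one) simp
  moreover have "real n / (real k)\<^sup>2 - 1 \<le> 2 / real k"
  proof -
    have "real n / (real k)\<^sup>2 \<le> ((real k)\<^sup>2 + 2 * real k) / (real k)\<^sup>2" using k3 K by (intro divide_right_mono) auto
    also have "\<dots> = 1 + 2 / real k" using K by (simp add: power2_eq_square add_divide_distrib)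
    finally show ?thesis by simp
  qed
  moreover have "0 \<le> ln (real n / (real k)\<^sup>2)" using k1 K by (intro ln_ge_zero) (simp add: field_simps)
  ultimately have "0 \<le> ln (real n) - 2 * ln (real k)" "ln (real n) - 2 * ln (real k) \<le> 2 / real k" by linarith+
  note d = this
  have "0 \<le> real n * (ln (real n) - 2 * ln (real k))" using d by (intro mult_nonneg_nonneg) auto
  moreover have "real n * (ln (real n) - 2 * ln (real k)) \<le> real n * (2 / real k)" using d by (intro mult_left_mono) auto
  moreover have "real n * (2 / real k) = 2 * (real n / real k)" by simp
  ultimately have l: "0 \<le> real n * (ln (real n) - 2 * ln (real k))" "real n * (ln (real n) - 2 * ln (real k)) \<le> 6 * real k"
    using nk by linarith+
  have "\<bar>divisor_sum n - divisor_main n\<bar> \<le> 30 * real k"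
  proof -
    \<comment> \<open>Rounding costs 2 k, the harmonic number 6 k, replacing ln n by 2 ln k another
      6 k, and n - k^2 is at most 2 k.\<close>
    define X Y Z where "X = (\<Sum>a=1..k. real (n div a))" and "Y = real n * harm k" and "Z = real n * (ln (real k) + euler_mascheroni)"
    have D: "divisor_sum n = 2 * X - (real k)\<^sup>2" unfolding X_def by (rule divisor_sum_hyperbola[OF kn])
    have M: "divisor_main n = 2 * Z + real n * (ln (real n) - 2 * ln (real k)) - real n"
      by (simp add: divisor_main_def Z_def algebra_simps)
    show ?thesis using s h l k1 k3 K unfolding X_def[symmetric] Y_def[symmetric] Z_def[symmetric] D M abs_le_iff by linarith
  qed
  also have "\<dots> \<le> 30 * sqrt (real n)" using k by simp
  finally show ?thesis .
qed (simp add: divisor_main_def)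

lemma sum_by_parts:
  fixes D h :: "nat \<Rightarrow> real"
  assumes "D 0 = 0" "h 0 = 0"
  shows "(\<Sum>m=1..n. (D m - D (m - 1)) * h (n - m)) = (\<Sum>m<n. D m * (h (n - m) - h (n - m - 1)))"
proof -
  have "(\<Sum>m=1..n. D m * h (n - m)) = (\<Sum>m\<le>n. D m * h (n - m))"
    by (rule sum.mono_neutral_left) (use assms in \<open>auto simp: not_less_eq_eq\<close>)
  also have "\<dots> = (\<Sum>m<n. D m * h (n - m))"
    by (rule sum.mono_neutral_right) (use assms in auto)
  finally have 1: "(\<Sum>m=1..n. D m * h (n - m)) = (\<Sum>m<n. D m * h (n - m))" .
  have 2: "(\<Sum>m=1..n. D (m - 1) * h (n - m)) = (\<Sum>m<n. D m * h (n - m - 1))"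
    by (rule sum.reindex_bij_witness[of _ Suc "\<lambda>m. m - 1"]) auto
  show ?thesis using 1 2 by (simp add: left_diff_distrib right_diff_distrib sum_subtractf)
qed

definition divisor_correlation :: "nat \<Rightarrow> real" where
  "divisor_correlation n = (\<Sum>m=1..n. real (card {d. d dvd m}) * divisor_sum (n - m))"

lemma divisor_main_diff:
  assumes "j > 0"
  shows "\<bar>divisor_main j - divisor_main (j - 1) - (ln (real j) + 2 * euler_mascheroni)\<bar> \<le> 1 / real j"
proof (cases "j = 1")
  case False
  obtain i where i: "j = Suc i" "i > 0" using assms False by (cases j) auto
  let ?d = "ln (real i + 1) - ln (real i)"
  have "divisor_main j - divisor_main (j - 1) - (ln (real j) + 2 * euler_mascheroni) = real i * ?d - 1"
    by (simp add: divisor_main_def i algebra_simps)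
  moreover have "real i * ?d \<le> real i * (1 / real i)" using ln_Suc_diff[OF i(2)] by (intro mult_left_mono) auto
  moreover have "real i * (1 / (real i + 1)) \<le> real i * ?d" using ln_Suc_diff[OF i(2)] by (intro mult_left_mono) auto
  moreover have "real i * (1 / real i) = 1" using i by simp
  moreover have "real i * (1 / (real i + 1)) = 1 - 1 / real j" using i by (simp add: field_simps)
  moreover have "0 \<le> 1 / real j" by simp
  ultimately show ?thesis unfolding abs_le_iff by linarith
qed (simp add: divisor_main_def)

lemma sqrt_bounds:
  assumes "n \<ge> (1::nat)"
  shows "1 \<le> sqrt (real n)" "sqrt (real n) \<le> real n" "ln (real n) \<le> 2 * sqrt (real n)"
    "sqrt (real n) * sqrt (real n) = real n" "0 \<le> ln (real n)"
proof -
  show 1: "1 \<le> sqrt (real n)" using assms by simp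
  show 2: "sqrt (real n) * sqrt (real n) = real n" by simp
  show "sqrt (real n) \<le> real n" using mult_left_mono[OF 1, of "sqrt (real n)"] 1 2 by simp
qed (use assms ln_le_two_sqrt in auto)

text \<open>
  Writing \<open>a j = ln (j / n)\<close>, the term of order \<open>ln n\<close> is \<open>\<Sum> m (a m + a (n - m))\<close>. The substitution
  \<open>m = n - j\<close> in its second half turns it into \<open>n \<Sum> a j\<close>, so that only \<open>ln (n!)\<close> has to be estimated.
\<close>
lemma correlation_main_sum:
  fixes c :: real
  assumes n: "n \<ge> 1"
  shows "\<bar>(\<Sum>m<n. (real m * ln (real m) + c * real m) * (ln (real (n - m)) + c + 1)) - quad_log (1/2) (c - 1/2) (real n)\<bar>
     \<le> ((1 + \<bar>c\<bar>) * (2 + \<bar>c\<bar>) + 8 + \<bar>2 * c + 1\<bar>) * (real n)\<^sup>2"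
proof -
  let ?D = "(\<Sum>m<n. (real m * ln (real m) + c * real m) * (ln (real (n - m)) + c + 1))"
  define L where "L = ln (real n)"
  define a where "a j = ln (real j) - L" for j
  note sq = sqrt_bounds[OF n]
  have L: "0 \<le> L" "L \<le> 2 * sqrt (real n)" "L \<le> 2 * real n" using sq by (auto simp: L_def)
  have A: "(\<Sum>j=1..n. \<bar>a j\<bar>) \<le> real n" "\<bar>(\<Sum>j=1..n. a j) + real n\<bar> \<le> 1 + L"
    using sum_ln_quotient[of n] n by (simp_all add: a_def L_def)
  define R where "R = (\<Sum>m<n. real m * (a m + c) * (a (n - m) + c + 1))"
  define T where "T = (\<Sum>m<n. real m)"
  have split: "(real m * ln (real m) + c * real m) * (ln (real (n - m)) + c + 1)
      = L\<^sup>2 * real m + L * (2 * c + 1) * real m + L * (real m * a m + real m * a (n - m)) + real m * (a m + c) * (a (n - m) + c + 1)" for m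
    by (simp add: a_def algebra_simps power2_eq_square)
  \<comment> \<open>The ranges may be exchanged because the term at 0 has the factor 0 and
    \<open>a n = 0\<close>.\<close>
  have "(\<Sum>m<n. real m * a m) = (\<Sum>j=1..n. real j * a j)"
  proof -
    have "(\<Sum>m<n. real m * a m) = (\<Sum>m\<le>n. real m * a m)"
      by (rule sum.mono_neutral_left) (auto simp: a_def L_def)
    also have "\<dots> = (\<Sum>j=1..n. real j * a j)"
      by (rule sum.mono_neutral_right) (auto simp: not_less_eq_eq)
    finally show ?thesis .
  qed
  moreover have "(\<Sum>m<n. real m * a (n - m)) = (\<Sum>j=1..n. (real n - real j) * a j)"
    by (rule sum.reindex_bij_witness[of _ "\<lambda>j. n - j" "\<lambda>m. n - m"]) (auto simp: of_nat_diff)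
  ultimately have "(\<Sum>m<n. real m * a m + real m * a (n - m)) = (\<Sum>j=1..n. real j * a j) + (\<Sum>j=1..n. (real n - real j) * a j)"
    by (simp only: sum.distrib)
  also have "\<dots> = (\<Sum>j=1..n. real j * a j + (real n - real j) * a j)" by (rule sum.distrib[symmetric])
  also have "\<dots> = (\<Sum>j=1..n. real n * a j)" by (intro sum.cong refl) (simp add: algebra_simps)
  finally have "(\<Sum>m<n. real m * a m + real m * a (n - m)) = (\<Sum>j=1..n. real n * a j)" .
  then have S: "(\<Sum>m<n. real m * a m + real m * a (n - m)) = real n * (\<Sum>j=1..n. a j)"
    by (simp only: sum_distrib_left)
  have main: "?D
     = L\<^sup>2 * T + L * (2 * c + 1) * T + L * (real n * (\<Sum>j=1..n. a j)) + R"
  proof -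
    have "?D
      = (\<Sum>m<n. L\<^sup>2 * real m) + (\<Sum>m<n. L * (2 * c + 1) * real m) + (\<Sum>m<n. L * (real m * a m + real m * a (n - m))) + R"
      unfolding R_def by (simp only: split sum.distrib)
    also have "(\<Sum>m<n. L * (real m * a m + real m * a (n - m))) = L * (\<Sum>m<n. real m * a m + real m * a (n - m))"
      by (rule sum_distrib_left[symmetric])
    also have "(\<Sum>m<n. L\<^sup>2 * real m) = L\<^sup>2 * T" unfolding T_def by (rule sum_distrib_left[symmetric])
    also have "(\<Sum>m<n. L * (2 * c + 1) * real m) = L * (2 * c + 1) * T" unfolding T_def by (rule sum_distrib_left[symmetric])
    finally show ?thesis unfolding S .
  qed
  have T: "T = (real n)\<^sup>2 / 2 - real n / 2"
  proof -
    have "(\<Sum>m<n. real m) = real n * (real n - 1) / 2" by (induction n) (auto simp: field_simps)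
    then show ?thesis by (simp add: T_def power2_eq_square field_simps)
  qed
  \<comment> \<open>The bound ln x <= x - 1 at x = n / m shows that m |ln (m / n)| is at most n - m,
    so the singularity of the logarithm at 0 is harmless.\<close>
  have ma: "\<bar>real m * (a m + c)\<bar> \<le> real n * (1 + \<bar>c\<bar>)" if "m < n" for m
  proof (cases "m = 0")
    case False
    have "ln (real n / real m) \<le> real n / real m - 1" using False that by (intro ln_le_minus_one) simp
    then have "- a m \<le> real n / real m - 1" using False that by (simp add: a_def L_def ln_div)
    then have "real m * (- a m) \<le> real m * (real n / real m - 1)" by (intro mult_left_mono) auto
    also have "\<dots> \<le> real n" using False by (simp add: right_diff_distrib)
    finally have 1: "real m * (- a m) \<le> real n" .
    have "a m \<le> 0" using False that by (simp add: a_def L_def)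
    then have "\<bar>real m * a m\<bar> \<le> real n" using 1 by (simp add: abs_mult)
    moreover have "\<bar>real m * c\<bar> \<le> real n * \<bar>c\<bar>" using that by (simp add: abs_mult mult_right_mono)
    ultimately show ?thesis using abs_triangle_ineq[of "real m * a m" "real m * c"] by (simp add: distrib_left)
  qed (use n in simp)
  have "\<bar>R\<bar> \<le> (\<Sum>m<n. \<bar>real m * (a m + c) * (a (n - m) + c + 1)\<bar>)" unfolding R_def by (rule sum_abs)
  also have "\<dots> \<le> (\<Sum>m<n. real n * (1 + \<bar>c\<bar>) * (\<bar>a (n - m)\<bar> + (\<bar>c\<bar> + 1)))"
    unfolding abs_mult[of "_ * _"] by (intro sum_mono mult_mono ma) auto
  also have "\<dots> = real n * (1 + \<bar>c\<bar>) * ((\<Sum>m<n. \<bar>a (n - m)\<bar>) + real n * (\<bar>c\<bar> + 1))"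
    by (simp add: sum_distrib_left[symmetric] sum.distrib)
  also have "(\<Sum>m<n. \<bar>a (n - m)\<bar>) = (\<Sum>j=1..n. \<bar>a j\<bar>)"
    by (rule sum.reindex_bij_witness[of _ "\<lambda>j. n - j" "\<lambda>m. n - m"]) auto
  also have "real n * (1 + \<bar>c\<bar>) * ((\<Sum>j=1..n. \<bar>a j\<bar>) + real n * (\<bar>c\<bar> + 1)) \<le> real n * (1 + \<bar>c\<bar>) * (real n + real n * (\<bar>c\<bar> + 1))"
    using A by (intro mult_left_mono add_mono) auto
  also have "\<dots> = (1 + \<bar>c\<bar>) * (2 + \<bar>c\<bar>) * (real n)\<^sup>2" by (simp add: power2_eq_square algebra_simps)
  finally have R: "\<bar>R\<bar> \<le> (1 + \<bar>c\<bar>) * (2 + \<bar>c\<bar>) * (real n)\<^sup>2" .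
  \<comment> \<open>The sum of the \<open>a j\<close> is -n up to O(1 + L). Its main part
    contributes -n^2 L, which turns the coefficient (2 c + 1) / 2 coming from \<open>T\<close> into
    c - 1/2.\<close>
  define U where "U = (\<Sum>j=1..n. a j) + real n"
  have diff: "L\<^sup>2 * T + L * (2 * c + 1) * T + L * (real n * (\<Sum>j=1..n. a j)) + R - quad_log (1/2) (c - 1/2) (real n)
     = R - L\<^sup>2 * real n / 2 - (2 * c + 1) * (L * real n) / 2 + real n * (L * U)"
    by (simp add: T quad_log_def U_def L_def[symmetric] field_simps power2_eq_square)
  have "L * L \<le> (2 * sqrt (real n)) * (2 * sqrt (real n))" using L by (intro mult_mono) auto
  then have L2: "L\<^sup>2 \<le> 4 * real n" using sq by (simp add: power2_eq_square)
  then have "L\<^sup>2 * real n \<le> 4 * real n * real n" by (intro mult_right_mono) auto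
  then have e1: "\<bar>L\<^sup>2 * real n / 2\<bar> \<le> 2 * (real n)\<^sup>2" by (simp add: power2_eq_square)
  have "L * real n \<le> (2 * real n) * real n" using L by (intro mult_right_mono) auto
  then have "\<bar>L * real n\<bar> \<le> 2 * (real n)\<^sup>2" using L by (simp add: power2_eq_square)
  then have "\<bar>2 * c + 1\<bar> * \<bar>L * real n\<bar> \<le> \<bar>2 * c + 1\<bar> * (2 * (real n)\<^sup>2)" by (intro mult_left_mono) auto
  then have e2: "\<bar>(2 * c + 1) * (L * real n) / 2\<bar> \<le> \<bar>2 * c + 1\<bar> * (real n)\<^sup>2" by (simp add: abs_mult)
  have "\<bar>L * U\<bar> \<le> L * (1 + L)" using A(2) L unfolding U_def by (simp add: abs_mult mult_left_mono)
  also have "\<dots> \<le> 6 * real n" using L2 L by (simp add: power2_eq_square distrib_left)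
  finally have "real n * \<bar>L * U\<bar> \<le> real n * (6 * real n)" by (intro mult_left_mono) auto
  then have e3: "\<bar>real n * (L * U)\<bar> \<le> 6 * (real n)\<^sup>2" by (simp add: abs_mult power2_eq_square)
  have "\<bar>R - L\<^sup>2 * real n / 2 - (2 * c + 1) * (L * real n) / 2 + real n * (L * U)\<bar>
     \<le> (1 + \<bar>c\<bar>) * (2 + \<bar>c\<bar>) * (real n)\<^sup>2 + 2 * (real n)\<^sup>2 + \<bar>2 * c + 1\<bar> * (real n)\<^sup>2 + 6 * (real n)\<^sup>2"
    by (intro order.trans[OF abs_triangle_ineq] order.trans[OF abs_triangle_ineq4] add_mono R e1 e2 e3)
  also have "\<dots> = ((1 + \<bar>c\<bar>) * (2 + \<bar>c\<bar>) + 8 + \<bar>2 * c + 1\<bar>) * (real n)\<^sup>2" by (simp only: distrib_right)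
  finally show ?thesis unfolding main diff .
qed

text \<open>In \<open>X1\<close> the divisor sum at n - m is replaced by its main term. Summation by
  parts then moves the difference from the divisor sum to the main term, so that the remaining
  divisor sum can be replaced too (\<open>X2\<close>), and finally the differences become ln (n - m)
  + 2 gamma (\<open>X3\<close>).\<close>

lemma divisor_correlation_asymptotics:
  "has_quad_log divisor_correlation (1/2) (2 * euler_mascheroni - 3/2)"
proof -
  define c :: real where "c = 2 * euler_mascheroni - 1"
  define K where "K = 90 + 30 * (4 + \<bar>c\<bar>) + 3 * (2 + \<bar>c\<bar>) + ((1 + \<bar>c\<bar>) * (2 + \<bar>c\<bar>) + 8 + \<bar>2 * c + 1\<bar>)"
  have "\<bar>divisor_correlation n - quad_log (1/2) (2 * euler_mascheroni - 3/2) (real n)\<bar> \<le> K * (real n)\<^sup>2" if n: "n \<ge> 1" for n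
  proof -
    note sq = sqrt_bounds[OF n]
    define L where "L = ln (real n)"
    \<comment> \<open>All logarithms and harmonic numbers are majorised by multiples of q. Each
      replacement then costs O(n q^2), which is O(n^2).\<close>
    define q where "q = sqrt (real n)"
    have q: "q \<ge> 1" "L \<le> 2 * q" "q * q = real n" "L \<ge> 0" "q \<ge> 0" using sq by (auto simp: L_def q_def)
    have H: "harm n \<le> 3 * q" using harm_bounds(1)[of n] n q by (simp add: L_def)
    have lnm: "ln (real m) \<le> L" if "m \<le> n" "m > 0" for m using that by (simp add: L_def)
    have sqm: "sqrt (real m) \<le> q" if "m \<le> n" for m using that by (simp add: q_def)
    define \<Delta> where "\<Delta> j = divisor_main j - divisor_main (j - 1)" for j
    have "divisor_sum n \<le> (\<Sum>d=1..n. real n / real d)"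
      unfolding divisor_sum_eq by (intro sum_mono) (use div_bounds in auto)
    also have "\<dots> = real n * harm n" by (simp add: harm_def sum_distrib_left divide_inverse)
    also have "\<dots> \<le> real n * (3 * q)" using H by (intro mult_left_mono) auto
    finally have Dn: "divisor_sum n \<le> 3 * real n * q" by simp
    define X1 where "X1 = (\<Sum>m=1..n. real (card {d. d dvd m}) * divisor_main (n - m))"
    define X2 where "X2 = (\<Sum>m<n. divisor_main m * \<Delta> (n - m))"
    define X3 where "X3 = (\<Sum>m<n. divisor_main m * (ln (real (n - m)) + c + 1))"
    have "\<bar>divisor_correlation n - X1\<bar> = \<bar>\<Sum>m=1..n. real (card {d. d dvd m}) * (divisor_sum (n - m) - divisor_main (n - m))\<bar>"
      by (simp add: divisor_correlation_def X1_def sum_subtractf right_diff_distrib)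
    also have "\<dots> \<le> (\<Sum>m=1..n. real (card {d. d dvd m}) * (30 * q))"
    proof (intro order.trans[OF sum_abs] sum_mono)
      fix m
      have "\<bar>divisor_sum (n - m) - divisor_main (n - m)\<bar> \<le> 30 * q"
        using divisor_sum_asymptotics[of "n - m"] sqm[of "n - m"] by simp
      then show "\<bar>real (card {d. d dvd m}) * (divisor_sum (n - m) - divisor_main (n - m))\<bar> \<le> real (card {d. d dvd m}) * (30 * q)"
        unfolding abs_mult by (intro mult_mono) auto
    qed
    also have "\<dots> = divisor_sum n * (30 * q)" by (simp add: divisor_sum_def sum_distrib_right)
    also have "\<dots> \<le> (3 * real n * q) * (30 * q)" using Dn q by (intro mult_right_mono) auto
    also have "\<dots> = 90 * real n * (q * q)" by simp
    also have "\<dots> = 90 * (real n)\<^sup>2" using q by (simp add: power2_eq_square)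
    finally have e1: "\<bar>divisor_correlation n - X1\<bar> \<le> 90 * (real n)\<^sup>2" .
    have "X1 = (\<Sum>m=1..n. (divisor_sum m - divisor_sum (m - 1)) * divisor_main (n - m))"
      unfolding X1_def
    proof (intro sum.cong refl)
      fix m assume "m \<in> {1..n}"
      then obtain l where "m = Suc l" by (cases m) auto
      then show "real (card {d. d dvd m}) * divisor_main (n - m) = (divisor_sum m - divisor_sum (m - 1)) * divisor_main (n - m)"
        by (simp add: divisor_sum_def)
    qed
    also have "\<dots> = (\<Sum>m<n. divisor_sum m * \<Delta> (n - m))"
      unfolding \<Delta>_def by (rule sum_by_parts) (simp_all add: divisor_main_def)
    finally have X1: "X1 = (\<Sum>m<n. divisor_sum m * \<Delta> (n - m))" .
    have \<Delta>1: "\<bar>\<Delta> j - (ln (real j) + c + 1)\<bar> \<le> 1 / real j" if "j > 0" for j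
      using divisor_main_diff[OF that] by (simp add: \<Delta>_def c_def)
    have \<Delta>2: "\<bar>\<Delta> j\<bar> \<le> (4 + \<bar>c\<bar>) * q" if "j > 0" "j \<le> n" for j
    proof -
      have "1 / real j \<le> 1" "0 \<le> ln (real j)" using that by auto
      then have "\<bar>\<Delta> j\<bar> \<le> 2 * q + \<bar>c\<bar> + 2" using \<Delta>1[OF that(1)] lnm[OF that(2,1)] q by linarith
      also have "\<dots> \<le> 2 * q + \<bar>c\<bar> * q + 2 * q" using q mult_left_mono[OF q(1), of "\<bar>c\<bar>"] by simp
      finally show ?thesis by (simp add: algebra_simps)
    qed
    have "\<bar>X1 - X2\<bar> = \<bar>\<Sum>m<n. (divisor_sum m - divisor_main m) * \<Delta> (n - m)\<bar>"
      by (simp add: X1 X2_def sum_subtractf left_diff_distrib)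
    also have "\<dots> \<le> (\<Sum>m<n. (30 * q) * ((4 + \<bar>c\<bar>) * q))"
    proof (intro order.trans[OF sum_abs] sum_mono)
      fix m assume m: "m \<in> {..<n}"
      have "\<bar>divisor_sum m - divisor_main m\<bar> \<le> 30 * q"
        using divisor_sum_asymptotics[of m] sqm[of m] m by simp
      then show "\<bar>(divisor_sum m - divisor_main m) * \<Delta> (n - m)\<bar> \<le> (30 * q) * ((4 + \<bar>c\<bar>) * q)"
        unfolding abs_mult using m q by (intro mult_mono \<Delta>2) auto
    qed
    also have "\<dots> = 30 * (4 + \<bar>c\<bar>) * real n * (q * q)" by simp
    also have "\<dots> = 30 * (4 + \<bar>c\<bar>) * (real n)\<^sup>2" using q by (simp add: power2_eq_square)
    finally have e2: "\<bar>X1 - X2\<bar> \<le> 30 * (4 + \<bar>c\<bar>) * (real n)\<^sup>2" .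
    have fm: "\<bar>divisor_main m\<bar> \<le> real n * ((2 + \<bar>c\<bar>) * q)" if "m < n" for m
    proof (cases "m = 0")
      case False
      have "0 \<le> ln (real m)" "ln (real m) \<le> L" using lnm[of m] that False by auto
      then have "\<bar>ln (real m) + c\<bar> \<le> 2 * q + \<bar>c\<bar>" using q(2) by linarith
      also have "\<dots> \<le> (2 + \<bar>c\<bar>) * q" using q mult_left_mono[OF q(1), of "\<bar>c\<bar>"] by (simp add: distrib_right)
      finally have "real m * \<bar>ln (real m) + c\<bar> \<le> real n * ((2 + \<bar>c\<bar>) * q)" using that by (intro mult_mono) auto
      moreover have "divisor_main m = real m * (ln (real m) + c)" by (simp add: divisor_main_def c_def algebra_simps)
      ultimately show ?thesis by (simp add: abs_mult)
    qed (use q in \<open>simp add: divisor_main_def\<close>)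
    have "\<bar>X2 - X3\<bar> = \<bar>\<Sum>m<n. divisor_main m * (\<Delta> (n - m) - (ln (real (n - m)) + c + 1))\<bar>"
      by (simp add: X2_def X3_def sum_subtractf right_diff_distrib)
    also have "\<dots> \<le> (\<Sum>m<n. (real n * ((2 + \<bar>c\<bar>) * q)) * (1 / real (n - m)))"
      by (intro order.trans[OF sum_abs] sum_mono) (auto simp only: abs_mult lessThan_iff zero_less_diff intro!: mult_mono fm \<Delta>1 abs_ge_zero mult_nonneg_nonneg q of_nat_0_le_iff add_nonneg_nonneg zero_le_numeral)
    also have "\<dots> = real n * ((2 + \<bar>c\<bar>) * q) * (\<Sum>m<n. 1 / real (n - m))" by (simp add: sum_distrib_left)
    also have "(\<Sum>m<n. 1 / real (n - m)) = (\<Sum>j=1..n. 1 / real j)"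
      by (rule sum.reindex_bij_witness[of _ "\<lambda>j. n - j" "\<lambda>m. n - m"]) auto
    also have "\<dots> = harm n" by (simp add: harm_def divide_inverse)
    also have "real n * ((2 + \<bar>c\<bar>) * q) * harm n \<le> real n * ((2 + \<bar>c\<bar>) * q) * (3 * q)" using H q by (intro mult_left_mono) auto
    also have "\<dots> = 3 * (2 + \<bar>c\<bar>) * real n * (q * q)" by simp
    also have "\<dots> = 3 * (2 + \<bar>c\<bar>) * (real n)\<^sup>2" using q by (simp add: power2_eq_square)
    finally have e3: "\<bar>X2 - X3\<bar> \<le> 3 * (2 + \<bar>c\<bar>) * (real n)\<^sup>2" .
    have "X3 = (\<Sum>m<n. (real m * ln (real m) + c * real m) * (ln (real (n - m)) + c + 1))"
      by (simp add: X3_def divisor_main_def c_def)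
    moreover have "2 * euler_mascheroni - 3/2 = c - 1/2" by (simp add: c_def)
    ultimately have e4: "\<bar>X3 - quad_log (1/2) (2 * euler_mascheroni - 3/2) (real n)\<bar> \<le> ((1 + \<bar>c\<bar>) * (2 + \<bar>c\<bar>) + 8 + \<bar>2 * c + 1\<bar>) * (real n)\<^sup>2"
      using correlation_main_sum[OF n, of c] by (simp only:)
    have "\<bar>divisor_correlation n - quad_log (1/2) (2 * euler_mascheroni - 3/2) (real n)\<bar> \<le> 90 * (real n)\<^sup>2 + (30 * (4 + \<bar>c\<bar>) * (real n)\<^sup>2 + (3 * (2 + \<bar>c\<bar>) * (real n)\<^sup>2 + ((1 + \<bar>c\<bar>) * (2 + \<bar>c\<bar>) + 8 + \<bar>2 * c + 1\<bar>) * (real n)\<^sup>2))"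
      by (intro order.trans[OF abs_triangle_two[of _ _ X1]] order.trans[OF abs_triangle_two[of X1 _ X2]] order.trans[OF abs_triangle_two[of X2 _ X3]] add_mono e1 e2 e3 e4)
    also have "\<dots> = K * (real n)\<^sup>2" by (simp only: K_def distrib_right add.assoc)
    finally show ?thesis .
  qed
  then show ?thesis by (rule has_quad_logI)
qed

text \<open>Replacing the harmonic number of s by ln s costs at most 1 per term, and replacing ln s
  by ln m costs at most m in total by \<open>sum_ln_quotient\<close>. Both are weighted by at most
  m, and the weights sum to about m^2 / 2.\<close>

lemma weighted_harm_sum:
  assumes m: "m \<ge> 1"
  shows "\<bar>(\<Sum>s=1..m. (real m - real s) * harm s) - quad_log 0 (1/2) (real m)\<bar> \<le> 3 * (real m)\<^sup>2"
proof -
  define L where "L = ln (real m)"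
  note sq = sqrt_bounds[OF m]
  have L: "0 \<le> L" "L \<le> 2 * real m" using sq by (auto simp: L_def)
  define R where "R = (\<Sum>s=1..m. (real m - real s) * (harm s - ln (real s)))"
  define P where "P = (\<Sum>s=1..m. (real m - real s) * (ln (real s) - L))"
  have T: "(\<Sum>s=1..m. real m - real s) = (real m)\<^sup>2 / 2 - real m / 2"
  proof -
    have "(\<Sum>s=1..m. real s) = real m * (real m + 1) / 2" by (induction m) (auto simp: field_simps)
    then show ?thesis by (simp add: sum_subtractf power2_eq_square field_simps)
  qed
  have "(\<Sum>s=1..m. (real m - real s) * harm s) = R + P + (\<Sum>s=1..m. real m - real s) * L"
    unfolding R_def P_def sum_distrib_right sum.distrib[symmetric] by (intro sum.cong refl) (simp add: algebra_simps)
  then have eq: "(\<Sum>s=1..m. (real m - real s) * harm s) - quad_log 0 (1/2) (real m) = R + P - real m * L / 2"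
    unfolding T by (simp add: quad_log_def L_def[symmetric] field_simps)
  have "\<bar>R\<bar> \<le> (\<Sum>s=1..m. real m * 1)"
    unfolding R_def
  proof (intro order.trans[OF sum_abs] sum_mono)
    fix s assume s: "s \<in> {1..m}"
    then have "\<bar>harm s - ln (real s)\<bar> \<le> 1" using harm_bounds[of s] by auto
    then show "\<bar>(real m - real s) * (harm s - ln (real s))\<bar> \<le> real m * 1"
      unfolding abs_mult using s by (intro mult_mono) auto
  qed
  then have R: "\<bar>R\<bar> \<le> (real m)\<^sup>2" by (simp add: power2_eq_square)
  have "\<bar>P\<bar> \<le> (\<Sum>s=1..m. real m * \<bar>ln (real s) - L\<bar>)"
    unfolding P_def by (intro order.trans[OF sum_abs] sum_mono) (auto simp: abs_mult intro!: mult_right_mono)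
  also have "\<dots> = real m * (\<Sum>s=1..m. \<bar>ln (real s) - L\<bar>)" by (simp add: sum_distrib_left)
  also have "\<dots> \<le> real m * real m" using sum_ln_quotient(1)[of m] m by (intro mult_left_mono) (auto simp: L_def)
  finally have P: "\<bar>P\<bar> \<le> (real m)\<^sup>2" by (simp add: power2_eq_square)
  have "real m * L \<le> real m * (2 * real m)" using L by (intro mult_left_mono) auto
  then have "\<bar>real m * L / 2\<bar> \<le> (real m)\<^sup>2" using L by (simp add: power2_eq_square)
  then show ?thesis unfolding eq using R P by linarith
qed

subsection \<open>Counting solutions of a bilinear inequality\<close>

text \<open>The conditions on (u, v) and on (r, s) are separate parameters, so that coprimality can
  be introduced for one pair at a time.\<close>

definition quads :: "(nat \<Rightarrow> nat \<Rightarrow> bool) \<Rightarrow> (nat \<Rightarrow> nat \<Rightarrow> bool) \<Rightarrow> nat \<Rightarrow> (nat \<times> nat \<times> nat \<times> nat) set" where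
  "quads Q R n = {(u, v, r, s). 1 \<le> u \<and> 1 \<le> v \<and> 1 \<le> r \<and> 1 \<le> s \<and> Q u v \<and> R r s \<and> u * r + v * s \<le> n}"

abbreviation quad_count :: "(nat \<Rightarrow> nat \<Rightarrow> bool) \<Rightarrow> (nat \<Rightarrow> nat \<Rightarrow> bool) \<Rightarrow> nat \<Rightarrow> real" where
  "quad_count Q R \<equiv> \<lambda>n. real (card (quads Q R n))"

abbreviation coprime_le :: "nat \<Rightarrow> nat \<Rightarrow> bool" where
  "coprime_le \<equiv> \<lambda>r s. r \<le> s \<and> coprime r s"

abbreviation any_pair :: "nat \<Rightarrow> nat \<Rightarrow> bool" where
  "any_pair \<equiv> \<lambda>u v. True"

abbreviation odd_and_two :: "nat \<Rightarrow> nat \<Rightarrow> bool" where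
  "odd_and_two \<equiv> \<lambda>u v. v = 2 \<and> odd u"

lemma quads_bounds:
  assumes "(u, v, r, s) \<in> quads Q R n"
  shows "u \<le> n" "v \<le> n" "r \<le> n" "s \<le> n"
proof -
  have *: "1 \<le> u" "1 \<le> v" "1 \<le> r" "1 \<le> s" "u * r + v * s \<le> n" using assms by (auto simp: quads_def)
  have "u * 1 \<le> u * r" "1 * r \<le> u * r" "v * 1 \<le> v * s" "1 * s \<le> v * s"
    using * by (auto intro: mult_le_mono)
  then show "u \<le> n" "v \<le> n" "r \<le> n" "s \<le> n" using *(5) by linarith+
qed

lemma finite_quads [simp]: "finite (quads Q R n)"
  by (rule finite_subset[of _ "{..n} \<times> {..n} \<times> {..n} \<times> {..n}"]) (auto dest: quads_bounds)

lemma card_quads_swap: "card (quads Q R n) = card (quads R Q n)"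
  by (rule bij_betw_same_card[of "\<lambda>(u, v, r, s). (r, s, u, v)"],
      rule bij_betw_byWitness[of _ "\<lambda>(u, v, r, s). (r, s, u, v)"]) (auto simp: quads_def mult.commute)

text \<open>Solutions are sorted by d = gcd(r, s). Dividing it out turns the bound n into
  \<open>n div d\<close>, and the hypothesis says that \<open>R\<close> is insensitive to this
  scaling.\<close>

lemma card_quads_coprime:
  assumes "\<And>d r s. d \<ge> 1 \<Longrightarrow> R (d * r) (d * s) = R r s"
  shows "card (quads Q R n) = (\<Sum>d=1..n. card (quads Q (\<lambda>r s. R r s \<and> coprime r s) (n div d)))"
proof -
  let ?T = "SIGMA d:{1..n}. quads Q (\<lambda>r s. R r s \<and> coprime r s) (n div d)"
  let ?f = "\<lambda>(d, u, v, r, s). (u, v, d * r, d * s)"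
  let ?g = "\<lambda>(u, v, r, s). (gcd r s, u, v, r div gcd r s, s div gcd r s)"
  have "bij_betw ?f ?T (quads Q R n)"
  proof (rule bij_betw_byWitness[where f' = ?g])
    show "\<forall>a\<in>?T. ?g (?f a) = a"
    proof
      fix a assume a: "a \<in> ?T"
      obtain d u v r s where x: "a = (d, u, v, r, s)" by (cases a)
      have "d > 0" "coprime r s" using a by (auto simp: x quads_def)
      then have "gcd (d * r) (d * s) = d" using gcd_mult_distrib_nat[of d r s] by (simp add: coprime_imp_gcd_eq_1)
      then show "?g (?f a) = a" using \<open>d > 0\<close> by (simp add: x)
    qed
    show "\<forall>a\<in>quads Q R n. ?f (?g a) = a" by auto
    show "?f ` ?T \<subseteq> quads Q R n"
    proof
      fix x assume "x \<in> ?f ` ?T"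
      then obtain d u v r s where x: "x = (u, v, d * r, d * s)" and d: "d \<in> {1..n}"
        and *: "(u, v, r, s) \<in> quads Q (\<lambda>r s. R r s \<and> coprime r s) (n div d)" by auto
      then have "(u * r + v * s) * d \<le> n" using d by (auto simp: quads_def less_eq_div_iff_mult_less_eq)
      then show "x \<in> quads Q R n"
        unfolding x using d * assms[of d r s] by (auto simp: quads_def algebra_simps)
    qed
    show "?g ` quads Q R n \<subseteq> ?T"
    proof
      fix z assume "z \<in> ?g ` quads Q R n"
      then obtain u v r s where z: "z = (gcd r s, u, v, r div gcd r s, s div gcd r s)"
        and *: "(u, v, r, s) \<in> quads Q R n" by auto
      define g x y where "g = gcd r s" and "x = r div g" and "y = s div g"
      have "r \<noteq> 0" using * by (auto simp: quads_def)
      then have g: "g > 0" by (simp add: g_def)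
      have rs: "r = g * x" "s = g * y" by (simp_all add: x_def y_def g_def)
      have c: "coprime x y" using \<open>r \<noteq> 0\<close> unfolding x_def y_def g_def by (intro div_gcd_coprime) auto
      have xy: "x \<ge> 1" "y \<ge> 1" using * rs by (auto simp: quads_def Suc_le_eq intro: Nat.gr0I)
      have "(u * x + v * y) * g \<le> n" using * by (auto simp: quads_def rs algebra_simps)
      then have le: "u * x + v * y \<le> n div g" using g by (simp add: less_eq_div_iff_mult_less_eq)
      have "g \<le> r" using rs xy by simp
      then have "g \<le> n" using quads_bounds[OF *] by simp
      moreover have "R x y" using * assms[of g x y] g by (auto simp: quads_def rs)
      ultimately have "(g, u, v, x, y) \<in> ?T" using g c xy le * by (auto simp: quads_def)
      then show "z \<in> ?T" by (simp only: z g_def x_def y_def)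
    qed
  qed
  then show ?thesis using bij_betw_same_card by fastforce
qed

text \<open>For fixed m = u r the choices of (u, r) are the divisors of m, and the inequality v s <=
  n - m is counted by the divisor sum.\<close>

lemma card_quads_all: "quad_count any_pair any_pair n = divisor_correlation n"
proof -
  let ?T = "SIGMA m:{1..n}. {d. d dvd m} \<times> (SIGMA a:{1..n - m}. {1..(n - m) div a})"
  let ?f = "\<lambda>(m, u, v, s). (u, v, m div u, s)"
  let ?g = "\<lambda>(u, v, r, s). (u * r, u, v, s)"
  have "bij_betw ?f ?T (quads any_pair any_pair n)"
  proof (rule bij_betw_byWitness[where f' = ?g])
    show "?f ` ?T \<subseteq> quads any_pair any_pair n"
    proof
      fix x assume "x \<in> ?f ` ?T"
      then obtain m u v s where x: "x = (u, v, m div u, s)" and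
        m: "m \<in> {1..n}" "u dvd m" "v \<in> {1..n - m}" "s \<in> {1..(n - m) div v}" by auto
      then obtain r where r: "m = u * r" by blast
      have "u \<ge> 1" "r \<ge> 1" using m r by (auto simp: Suc_le_eq intro: Nat.gr0I)
      moreover have "v * s \<le> n - m" using m by (simp add: less_eq_div_iff_mult_less_eq mult.commute)
      ultimately show "x \<in> quads any_pair any_pair n"
        unfolding x using m r by (auto simp: quads_def)
    qed
    show "?g ` quads any_pair any_pair n \<subseteq> ?T"
    proof
      fix x assume "x \<in> ?g ` quads any_pair any_pair n"
      then obtain u v r s where x: "x = (u * r, u, v, s)"
        and *: "(u, v, r, s) \<in> quads any_pair any_pair n" by auto
      then have a: "1 \<le> u * r" "v * s \<le> n - u * r" "v \<le> v * s" "1 \<le> v" "1 \<le> s" "u * r \<le> n"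
        by (auto simp: quads_def)
      then have "v \<le> n - u * r" by linarith
      with a show "x \<in> ?T" unfolding x by (auto simp: less_eq_div_iff_mult_less_eq mult.commute)
    qed
  qed (auto simp: quads_def)
  then have "card (quads any_pair any_pair n) = card ?T" by (simp add: bij_betw_same_card)
  also have "\<dots> = (\<Sum>m=1..n. card {d. d dvd m} * (\<Sum>a=1..n - m. (n - m) div a))"
  proof -
    have fin: "finite (SIGMA a:{1..n - m}. {1..(n - m) div a})" for m by simp
    show ?thesis
      by (subst card_SigmaI) (auto simp: card_cartesian_product intro!: finite_cartesian_product fin)
  qed
  finally show ?thesis by (simp add: divisor_correlation_def divisor_sum_eq)
qed

lemma quads_moebius:
  assumes "\<And>d r s. d \<ge> 1 \<Longrightarrow> R (d * r) (d * s) = R r s"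
    and "has_quad_log (quad_count Q R) A B"
  shows "has_quad_log (quad_count Q (\<lambda>r s. R r s \<and> coprime r s)) (A / zeta 2) (B / zeta 2 - 2 * A * deriv zeta 2 / (zeta 2)\<^sup>2)"
  by (rule moebius_transfer[OF _ assms(2)]) (simp_all only: card_quads_coprime[of R, OF assms(1)] of_nat_sum)

definition coprime_const :: real where
  "coprime_const = (2 * euler_mascheroni - 3/2) / (zeta 2)\<^sup>2 - 2 * deriv zeta 2 / zeta 2 ^ 3"

text \<open>One Moebius inversion makes r, s coprime; after exchanging the two pairs a second one
  treats u, v. Each inversion contributes one copy of -zeta'(2) / zeta(2)^3 to the linear
  coefficient.\<close>

lemma coprime_quads_asymptotics:
  "has_quad_log (quad_count coprime coprime) (1 / (2 * (zeta 2)\<^sup>2)) coprime_const"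
proof -
  have z: "zeta 2 \<noteq> 0" using zeta_2_ge_1 by simp
  have "has_quad_log (quad_count any_pair any_pair) (1/2) (2 * euler_mascheroni - 3/2)"
    unfolding card_quads_all by (rule divisor_correlation_asymptotics)
  from quads_moebius[OF refl this]
  have "has_quad_log (quad_count any_pair coprime) (1 / 2 / zeta 2)
     ((2 * euler_mascheroni - 3/2) / zeta 2 - 2 * (1/2) * deriv zeta 2 / (zeta 2)\<^sup>2)"
    by simp
  then have "has_quad_log (quad_count coprime any_pair) (1 / 2 / zeta 2)
     ((2 * euler_mascheroni - 3/2) / zeta 2 - 2 * (1/2) * deriv zeta 2 / (zeta 2)\<^sup>2)"
    by (simp only: card_quads_swap[of coprime])
  from quads_moebius[OF refl this]
  have "has_quad_log (quad_count coprime coprime) (1 / 2 / zeta 2 / zeta 2)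
     (((2 * euler_mascheroni - 3/2) / zeta 2 - 2 * (1/2) * deriv zeta 2 / (zeta 2)\<^sup>2) / zeta 2
        - 2 * (1 / 2 / zeta 2) * deriv zeta 2 / (zeta 2)\<^sup>2)"
    by simp
  note * = this
  have e1: "1 / 2 / zeta 2 / zeta 2 = 1 / (2 * (zeta 2)\<^sup>2)" by (simp add: power2_eq_square)
  have e2: "((2 * euler_mascheroni - 3/2) / zeta 2 - 2 * (1/2) * deriv zeta 2 / (zeta 2)\<^sup>2) / zeta 2
        - 2 * (1 / 2 / zeta 2) * deriv zeta 2 / (zeta 2)\<^sup>2 = coprime_const"
    using z by (simp add: coprime_const_def field_simps power2_eq_square power3_eq_cube)
  show ?thesis using * unfolding e1 e2 .
qed

section \<open>The biased cases v = 1 and v = 2\<close>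

lemma card_quads_v1:
  "card (quads (\<lambda>u v. v = 1) (\<le>) n) = (\<Sum>s=1..n. \<Sum>r=1..s. (n - s) div r)"
proof -
  let ?T = "SIGMA s:{1..n}. SIGMA r:{1..s}. {1..(n - s) div r}"
  have "bij_betw (\<lambda>(s, r, u). (u, 1, r, s)) ?T (quads (\<lambda>u v. v = 1) (\<le>) n)"
    by (rule bij_betw_byWitness[of _ "\<lambda>(u, v, r, s). (s, r, u)"])
       (auto simp: quads_def less_eq_div_iff_mult_less_eq dest: quads_bounds)
  then have "card (quads (\<lambda>u v. v = 1) (\<le>) n) = card ?T" by (simp add: bij_betw_same_card)
  then show ?thesis by (simp add: card_SigmaI)
qed

lemma card_odd_upto: "card {u \<in> {1..q}. odd u} = (q + 1) div 2"
proof (induction q)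
  case (Suc q)
  have "{u \<in> {1..Suc q}. odd u} = (if odd (Suc q) then insert (Suc q) {u \<in> {1..q}. odd u} else {u \<in> {1..q}. odd u})"
    by (auto simp: le_Suc_eq)
  then show ?case using Suc by auto
qed simp

lemma card_quads_v2:
  "card (quads odd_and_two (\<le>) n) = (\<Sum>s=1..n div 2. \<Sum>r=1..s. ((n - 2 * s) div r + 1) div 2)"
proof -
  let ?T = "SIGMA s:{1..n div 2}. SIGMA r:{1..s}. {u \<in> {1..(n - 2 * s) div r}. odd u}"
  have "bij_betw (\<lambda>(s, r, u). (u, 2, r, s)) ?T (quads odd_and_two (\<le>) n)"
  proof (rule bij_betw_byWitness[of _ "\<lambda>(u, v, r, s). (s, r, u)"])
    show "(\<lambda>(u, v, r, s). (s, r, u)) ` quads odd_and_two (\<le>) n \<subseteq> ?T"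
    proof
      fix x assume "x \<in> (\<lambda>(u, v, r, s). (s, r, u)) ` quads odd_and_two (\<le>) n"
      then obtain u v r s where x: "x = (s, r, u)" and "(u, v, r, s) \<in> quads odd_and_two (\<le>) n" by auto
      then have "1 \<le> u" "1 \<le> r" "1 \<le> s" "r \<le> s" "odd u" "u * r + 2 * s \<le> n" by (auto simp: quads_def)
      moreover from this have "s \<le> n div 2" by linarith
      ultimately show "x \<in> ?T" unfolding x by (auto simp: less_eq_div_iff_mult_less_eq)
    qed
  qed (auto simp: quads_def less_eq_div_iff_mult_less_eq)
  then have "card (quads odd_and_two (\<le>) n) = card ?T" by (simp add: bij_betw_same_card)
  also have "\<dots> = (\<Sum>s=1..n div 2. \<Sum>r=1..s. card {u \<in> {1..(n - 2 * s) div r}. odd u})"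
    by (simp add: card_SigmaI)
  finally show ?thesis by (simp only: card_odd_upto)
qed

lemma sum_real_le_square:
  assumes "\<And>s r. s \<in> {1..m} \<Longrightarrow> r \<in> {1..s} \<Longrightarrow> \<bar>f s r - g s r\<bar> \<le> (1::real)"
  shows "\<bar>(\<Sum>s=1..m. \<Sum>r=1..s. f s r) - (\<Sum>s=1..m. \<Sum>r=1..s. g s r)\<bar> \<le> (real m)\<^sup>2"
proof -
  have "\<bar>(\<Sum>s=1..m. \<Sum>r=1..s. f s r) - (\<Sum>s=1..m. \<Sum>r=1..s. g s r)\<bar> = \<bar>\<Sum>s=1..m. \<Sum>r=1..s. f s r - g s r\<bar>"
    by (simp only: sum_subtractf)
  also have "\<dots> \<le> (\<Sum>s=1..m. \<Sum>r=1..s. 1)"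
    by (intro order.trans[OF sum_abs] sum_mono assms)
  also have "\<dots> \<le> (\<Sum>s=1..m. real m)" by (intro sum_mono) auto
  finally show ?thesis by (simp add: power2_eq_square)
qed

lemma sum_weighted_harm: "(\<Sum>s=1..m. \<Sum>r=1..s. (y - real s) / real r) = (\<Sum>s=1..m. (y - real s) * harm s)"
  by (simp add: harm_def sum_distrib_left divide_inverse)

text \<open>For given r <= s there are (n - s) / r values of u up to rounding. Summation over r
  produces (n - s) times the harmonic number of s, and the rounding affects at most n^2
  pairs.\<close>

lemma quads_v1_asymptotics:
  "has_quad_log (quad_count (\<lambda>u v. v = 1) (\<le>)) 0 (1/2)"
proof -
  have "\<bar>quad_count (\<lambda>u v. v = 1) (\<le>) n - quad_log 0 (1/2) (real n)\<bar> \<le> 4 * (real n)\<^sup>2" if n: "n \<ge> 1" for n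
  proof -
    have "\<bar>(\<Sum>s=1..n. \<Sum>r=1..s. real ((n - s) div r)) - (\<Sum>s=1..n. \<Sum>r=1..s. (real n - real s) / real r)\<bar> \<le> (real n)\<^sup>2"
    proof (rule sum_real_le_square)
      fix s r assume "s \<in> {1..n}" "r \<in> {1..s}"
      then show "\<bar>real ((n - s) div r) - (real n - real s) / real r\<bar> \<le> 1"
        using div_bounds[of r "n - s"] by (simp add: of_nat_diff abs_le_iff)
    qed
    then show ?thesis using weighted_harm_sum[OF n] unfolding card_quads_v1 sum_weighted_harm of_nat_sum abs_le_iff by linarith
  qed
  then show ?thesis by (rule has_quad_logI)
qed

lemma harm_le_self: "harm n \<le> real n"
proof -
  have "(\<Sum>k=1..n. inverse (real k)) \<le> (\<Sum>k=1..n. 1)" by (intro sum_mono) (auto simp: field_simps)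
  then show ?thesis by (simp add: harm_def)
qed

lemma close_to_half:
  fixes x :: real
  assumes "x - 1 \<le> q" "q \<le> x" "q / 2 \<le> p" "p \<le> q / 2 + 1/2" "t = x / 2"
  shows "\<bar>p - t\<bar> \<le> 1"
  using assms by linarith

text \<open>Half of the u up to (n - 2 s) / r are odd, so the count is the sum of (n/2 - s) times
  the harmonic number of s over s <= n/2. This is the case v = 1 at n/2, whose main term (1/2)
  (n/2)^2 ln (n/2) gives the coefficient 1/8.\<close>

lemma quads_v2_asymptotics:
  "has_quad_log (quad_count odd_and_two (\<le>)) 0 (1/8)"
proof -
  have "\<bar>quad_count odd_and_two (\<le>) n - quad_log 0 (1/8) (real n)\<bar> \<le> 20 * (real n)\<^sup>2" if n: "n \<ge> 1" for n
  proof (cases "n = 1")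
    case True
    then show ?thesis by (simp add: card_quads_v2 quad_log_def)
  next
    case False
    define m where "m = n div 2"
    have m: "m \<ge> 1" using n False by (simp add: m_def)
    have mn: "real m \<le> real n / 2" "real n / 2 \<le> real m + 1/2" unfolding m_def by linarith+
    have m2: "(real m)\<^sup>2 \<le> (real n)\<^sup>2" using mn by (intro power_mono) auto
    have 1: "\<bar>(\<Sum>s=1..m. \<Sum>r=1..s. real (((n - 2 * s) div r + 1) div 2)) - (\<Sum>s=1..m. \<Sum>r=1..s. (real n / 2 - real s) / real r)\<bar> \<le> (real m)\<^sup>2"
    proof (rule sum_real_le_square)
      fix s r assume sr: "s \<in> {1..m}" "r \<in> {1..s}"
      define q where "q = (n - 2 * s) div r"
      have "2 * s \<le> n" using sr by (auto simp: m_def)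
      then have "real n / real r - 2 * real s / real r - 1 \<le> real q" "real q \<le> real n / real r - 2 * real s / real r"
        using div_bounds[of r "n - 2 * s"] sr by (auto simp: q_def of_nat_diff diff_divide_distrib)
      moreover have "real q / 2 \<le> real ((q + 1) div 2)" "real ((q + 1) div 2) \<le> real q / 2 + 1/2" by linarith+
      moreover have "(real n / 2 - real s) / real r = (real n / real r - 2 * real s / real r) / 2"
        by (simp add: diff_divide_distrib)
      ultimately show "\<bar>real (((n - 2 * s) div r + 1) div 2) - (real n / 2 - real s) / real r\<bar> \<le> 1"
        unfolding q_def[symmetric] by (rule close_to_half)
    qed
    have "(\<Sum>s=1..m. (real n / 2 - real s) * harm s) - (\<Sum>s=1..m. (real m - real s) * harm s) = (real n / 2 - real m) * (\<Sum>s=1..m. harm s)"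
    proof -
      have "(\<Sum>s=1..m. (real n / 2 - real s) * harm s) - (\<Sum>s=1..m. (real m - real s) * harm s)
          = (\<Sum>s=1..m. (real n / 2 - real s) * harm s - (real m - real s) * harm s)"
        by (rule sum_subtractf[symmetric])
      also have "\<dots> = (\<Sum>s=1..m. (real n / 2 - real m) * harm s)"
        by (intro sum.cong refl) (simp add: algebra_simps)
      finally show ?thesis by (simp only: sum_distrib_left)
    qed
    moreover have "0 \<le> (real n / 2 - real m) * (\<Sum>s=1..m. harm s)"
      using mn by (intro mult_nonneg_nonneg sum_nonneg) (auto simp: harm_nonneg)
    moreover have "(real n / 2 - real m) * (\<Sum>s=1..m. harm s) \<le> 1 * (\<Sum>s=1..m. real m)"
    proof (intro mult_mono sum_mono)
      fix s assume "s \<in> {1..m}"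
      then show "harm s \<le> real m" using harm_le_self[of s] by auto
    qed (use mn in \<open>auto intro: sum_nonneg simp: harm_nonneg\<close>)
    ultimately have 2: "\<bar>(\<Sum>s=1..m. (real n / 2 - real s) * harm s) - (\<Sum>s=1..m. (real m - real s) * harm s)\<bar> \<le> (real m)\<^sup>2"
      by (simp add: power2_eq_square)
    note 3 = weighted_harm_sum[OF m]
    have "\<bar>quad_log 0 (1/2) (real n / 2) - quad_log 0 (1/2) (real m)\<bar> \<le> (10 * \<bar>0\<bar> + 3 * \<bar>1/2\<bar>) * (real n / 2)\<^sup>2"
      by (rule quad_log_near) (use m mn in auto)
    also have "\<dots> \<le> (real n)\<^sup>2" by (simp add: power_divide)
    finally have 4: "\<bar>quad_log 0 (1/2) (real n / 2) - quad_log 0 (1/2) (real m)\<bar> \<le> (real n)\<^sup>2" .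
    have "quad_log 0 (1/8) (real n) - quad_log 0 (1/2) (real n / 2) = (real n)\<^sup>2 / 8 * ln 2"
      using n by (simp add: quad_log_def ln_div power_divide algebra_simps)
    moreover have "(real n)\<^sup>2 / 8 * ln 2 \<le> (real n)\<^sup>2 / 8 * 1" using ln_2_less_1 by (intro mult_left_mono) auto
    moreover have "0 \<le> (real n)\<^sup>2 / 8 * ln 2" "0 \<le> (real n)\<^sup>2" by simp_all
    ultimately have 5: "\<bar>quad_log 0 (1/8) (real n) - quad_log 0 (1/2) (real n / 2)\<bar> \<le> (real n)\<^sup>2"
      by linarith
    show ?thesis using 1 2 3 4 5 m2
      unfolding card_quads_v2 m_def[symmetric] sum_weighted_harm of_nat_sum abs_le_iff by linarith
  qed
  then show ?thesis by (rule has_quad_logI)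
qed

lemma quads_v1_coprime:
  "has_quad_log (quad_count (\<lambda>u v. v = 1) coprime_le) 0 (1 / (2 * zeta 2))"
  using quads_moebius[OF _ quads_v1_asymptotics] by simp

lemma quads_v2_coprime:
  "has_quad_log (quad_count odd_and_two coprime_le) 0 (1 / (8 * zeta 2))"
  using quads_moebius[OF _ quads_v2_asymptotics] by simp

text \<open>Exchanging (u, r) with (v, s) maps r <= s to s <= r. The overlap has r = s, hence r = s
  = 1 by coprimality, and then at most n^2 choices of u, v.\<close>

lemma coprime_quads_le:
  "\<bar>2 * quad_count coprime coprime_le n - quad_count coprime coprime n\<bar> \<le> (real n)\<^sup>2"
proof -
  let ?A = "quads coprime coprime_le n"
  let ?B = "quads coprime (\<lambda>r s. s \<le> r \<and> coprime r s) n"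
  have "bij_betw (\<lambda>(u, v, r, s). (v, u, s, r)) ?A ?B"
    by (rule bij_betw_byWitness[of _ "\<lambda>(u, v, r, s). (v, u, s, r)"]) (auto simp: quads_def coprime_commute add.commute)
  then have AB: "card ?A = card ?B" by (rule bij_betw_same_card)
  have "card ?A + card ?B = card (?A \<union> ?B) + card (?A \<inter> ?B)" by (rule card_Un_Int) auto
  moreover have "?A \<union> ?B = quads coprime coprime n" by (auto simp: quads_def)
  moreover have "card (?A \<inter> ?B) \<le> card ((\<lambda>(u, v). (u, v, 1::nat, 1::nat)) ` ({1..n} \<times> {1..n}))"
  proof (rule card_mono)
    show "?A \<inter> ?B \<subseteq> (\<lambda>(u, v). (u, v, 1::nat, 1::nat)) ` ({1..n} \<times> {1..n})"
    proof
      fix x assume x: "x \<in> ?A \<inter> ?B"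
      obtain u v r s where x': "x = (u, v, r, s)" by (cases x)
      then have "r = s" "coprime r s" "u \<ge> 1" "v \<ge> 1" using x by (auto simp: quads_def)
      then have "r = 1" "s = 1" by auto
      moreover have "u \<le> n" "v \<le> n" using x quads_bounds[of u v r s] unfolding x' by auto
      ultimately show "x \<in> (\<lambda>(u, v). (u, v, 1::nat, 1::nat)) ` ({1..n} \<times> {1..n})"
        using \<open>u \<ge> 1\<close> \<open>v \<ge> 1\<close> by (force simp: x')
    qed
  qed auto
  moreover have "card ((\<lambda>(u, v). (u, v, 1::nat, 1::nat)) ` ({1..n} \<times> {1..n})) \<le> n * n"
    using card_image_le[of "{1..n} \<times> {1..n}" "\<lambda>(u, v). (u, v, 1::nat, 1::nat)"] by (simp add: card_cartesian_product)
  ultimately have "card (quads coprime coprime n) \<le> 2 * card ?A \<and> 2 * card ?A \<le> card (quads coprime coprime n) + n * n"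
    using AB by simp
  then have "quad_count coprime coprime n \<le> real (2 * card ?A)" "real (2 * card ?A) \<le> real (card (quads coprime coprime n) + n * n)"
    by (simp_all only: of_nat_le_iff simp_thms)
  then show ?thesis by (simp add: power2_eq_square)
qed

subsection \<open>Column sums of the matrices\<close>

definition small_pairs :: "nat \<Rightarrow> (nat \<times> nat) set" where
  "small_pairs n = {(m, k). 1 \<le> m \<and> m < k \<and> coprime m k \<and> m + k \<le> n}"

lemma finite_small_pairs [simp]: "finite (small_pairs n)"
  by (rule finite_subset[of _ "{..n} \<times> {..n}"]) (auto simp: small_pairs_def)

text \<open>In terms of the top row (a, b) with a v = b u + 1 and b < v the condition for v > 2
  reads 2 b < v. For v = 1 the row is (1, 0), whereas for v = 2 the entry b = 1 is exactly half of v
  and the pair is rejected.\<close>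

definition left_half :: "nat \<Rightarrow> nat \<Rightarrow> bool" where
  "left_half u v \<longleftrightarrow> v = 1 \<or> (v > 2 \<and> 2 * modular_inverse (int v) (int u) > int v)"

lemma sl2_first_row_exists:
  fixes u v :: nat
  assumes "coprime u v" "u \<ge> 1" "v \<ge> 1"
  shows "\<exists>a b. a * v = b * u + 1 \<and> b < v \<and> a \<le> u"
proof (cases "v = 1")
  case False
  then have v: "v > 1" using assms by simp
  define i where "i = modular_inverse (int v) (int u)"
  have c: "coprime (int u) (int v)" using assms(1) by simp
  have i: "0 < i" "i < int v"
    using mult_modular_inverse_int_pos[OF _ c] modular_inverse_int_less[of "int v" "int u"] v by (auto simp: i_def)
  have "[i * int u = 1] (mod int v)" unfolding i_def by (rule cong_modular_inverse2[OF c])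
  then obtain k where k: "i * int u - 1 = int v * k" by (auto simp: cong_iff_dvd_diff)
  \<comment> \<open>The equation i u = 1 + v k is equivalent to (u - k) v = (v - i) u + 1, which
    dictates both entries.\<close>
  define b where "b = nat (int v - i)"
  define a where "a = nat (int u - k)"
  have b: "int b = int v - i" using i by (simp add: b_def)
  have "(int u - k) * int v = int b * int u + 1" using k by (simp add: b algebra_simps)
  moreover from this have "(int u - k) * int v > 0" by (simp add: add_nonneg_pos)
  then have "int u - k > 0" using v by (simp add: zero_less_mult_iff)
  then have "int a = int u - k" by (simp add: a_def)
  ultimately have "int (a * v) = int (b * u + 1)" by simp
  then have ab: "a * v = b * u + 1" by (simp only: of_nat_eq_iff)
  have bv: "b < v" using b i by simp
  have "b * u + 1 \<le> (v - 1) * u + u" using bv assms by (intro add_mono mult_right_mono) auto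
  also have "\<dots> = u * v" using v by (simp add: algebra_simps)
  finally have "a * v \<le> u * v" using ab by simp
  then have "a \<le> u" using v by simp
  then show ?thesis using ab bv by blast
qed (use assms in auto)

text \<open>Subtracting the equations shows that \<open>v\<close> divides (b - b') u, where
  \<open>u\<close> and \<open>v\<close> are coprime by the first equation; both b and b' lie below
  \<open>v\<close>.\<close>

lemma sl2_first_row_unique:
  fixes u v :: nat
  assumes "a * v = b * u + 1" "b < v" "a' * v = b' * u + 1" "b' < v"
  shows "a = a' \<and> b = b'"
proof -
  have c: "coprime (int u) (int v)"
  proof (rule coprimeI)
    fix d assume "d dvd int u" "d dvd int v"
    then have "d dvd int a * int v - int b * int u" by simp
    also have "int a * int v - int b * int u = 1" using arg_cong[OF assms(1), of int] by simp
    finally show "is_unit d" .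
  qed
  have "(int a - int a') * int v = (int b - int b') * int u"
    using arg_cong[OF assms(1), of int] arg_cong[OF assms(3), of int] by (simp add: algebra_simps)
  then have "int v dvd (int b - int b') * int u" by (metis dvd_triv_right)
  then have "int v dvd int b - int b'" using c by (simp add: coprime_commute coprime_dvd_mult_left_iff)
  then have "int b mod int v = int b' mod int v" by (simp add: mod_eq_dvd_iff)
  then have b: "b = b'" using assms by simp
  then have "a * v = a' * v" using assms(1,3) by simp
  then show ?thesis using b assms(2) by simp
qed

text \<open>
  With \<open>a v = b u + 1\<close>, the residue \<open>v - b\<close> is the inverse of \<open>u\<close> modulo \<open>v\<close>. The inequality says that
  the first entry of the column is less than half of the sum of both entries.
\<close>
lemma left_half_iff:
  fixes u v :: nat
  assumes ab: "a * v = b * u + 1" "b < v" and u: "u \<ge> 1" and rs: "1 \<le> r" "r \<le> s" "coprime r s"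
  shows "2 * (a * r + b * s) < u * r + v * s \<longleftrightarrow> left_half u v \<and> (u, v, r, s) \<noteq> (1, 1, 1, 1)"
proof -
  consider "v = 1" | "v = 2" | "v > 2" using ab by linarith
  then show ?thesis
  proof cases
    case 1
    then have "b = 0" "a = 1" using ab by auto
    \<comment> \<open>The inequality fails only for u = 1 and r = s, and coprimality then gives r =
      s = 1: the fraction is 1/2 itself.\<close>
    moreover have "2 * r < u * r + s \<longleftrightarrow> (u, r, s) \<noteq> (1, 1, 1)"
    proof (cases "u = 1")
      case True
      have "r = s \<longrightarrow> r = 1" using rs(3) by auto
      then show ?thesis using rs True by (auto simp: le_less)
    next
      case False
      then have "2 * r \<le> u * r" using u by (intro mult_right_mono) auto
      then have "2 * r < u * r + s" using rs by linarith
      then show ?thesis using False by simp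
    qed
    ultimately show ?thesis using 1 by (auto simp: left_half_def)
  next
    case 2
    have "b \<noteq> 0"
    proof
      assume "b = 0"
      then have "a * 2 = 1" using ab 2 by simp
      then show False by simp
    qed
    then have b: "b = 1" using ab 2 by simp
    then have "2 * a = u + 1" using ab 2 by simp
    then have "(2 * a) * r = (u + 1) * r" by simp
    \<comment> \<open>The right side exceeds u r + 2 s, so the fraction lies above 1/2 for every odd
      \<open>u\<close>.\<close>
    then have "2 * (a * r + b * s) = (u + 1) * r + 2 * s" using b by (simp add: algebra_simps)
    then show ?thesis using 2 by (simp add: left_half_def)
  next
    case 3
    have iab: "int a * int v = int b * int u + 1" using arg_cong[OF ab(1), of int] by simp
    have b0: "b \<noteq> 0"
    proof
      assume "b = 0"
      then have "a * v = 1" using ab by simp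
      then show False using 3 by simp
    qed
    have inv: "modular_inverse (int v) (int u) = int v - int b"
    proof (rule modular_inverse_int_eqI)
      have "int u * (int v - int b) - 1 = int v * (int u - int a)" using iab by (simp add: algebra_simps)
      then show "[int u * (int v - int b) = 1] (mod int v)" by (simp add: cong_iff_dvd_diff)
    qed (use ab b0 in auto)
    have chi: "left_half u v \<longleftrightarrow> 2 * b < v" using 3 by (auto simp: left_half_def inv)
    show ?thesis
    proof (cases "2 * b < v")
      case True
      \<comment> \<open>For u = 1 the relation a v = b + 1 < v with a > 0 is impossible. The bound
        absorbs the summand 2 that appears when 2 b <= v - 1 is inserted into 2 a v = 2 b u +
        2.\<close>
      have "int u \<ge> 2"
      proof (rule ccontr)
        assume "\<not> int u \<ge> 2"
        then have "u = 1" using u by simp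
        then have "a * v = b + 1" using ab by simp
        then have "a * v < v" using True b0 3 by linarith
        moreover have "a \<noteq> 0" using \<open>a * v = b + 1\<close> by (cases a) auto
        ultimately show False by simp
      qed
      have "2 * (int a * int v) = 2 * int b * int u + 2" using iab by simp
      also have "\<dots> \<le> (int v - 1) * int u + 2" using True by (intro add_mono mult_right_mono) auto
      also have "\<dots> = int u * int v - int u + 2" by (simp add: algebra_simps)
      also have "\<dots> \<le> int u * int v" using \<open>int u \<ge> 2\<close> by simp
      finally have "(2 * int a) * int v \<le> int u * int v" by (simp add: mult.assoc)
      then have "2 * a \<le> u" using 3 by simp
      then have "2 * a * r + 2 * b * s < u * r + v * s" using True rs by (intro add_le_less_mono mult_le_mono1 mult_strict_right_mono) auto
      then show ?thesis using chi True 3 by (simp add: add_mult_distrib2 mult.assoc)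
    next
      case False
      have "int u * int v + 1 \<le> int v * int u + 2" by simp
      have "2 * int b * int u \<ge> int v * int u" using False by (intro mult_right_mono) auto
      then have "int v * int u < (2 * int a) * int v" using iab by simp
      then have "int u * int v < (2 * int a) * int v" by (simp add: mult.commute)
      then have "int u < 2 * int a" using 3 by simp
      then have "u \<le> 2 * a" by simp
      then have "u * r + v * s \<le> 2 * a * r + 2 * b * s" using False by (intro add_mono mult_right_mono) auto
      then show ?thesis using chi False by (simp add: add_mult_distrib2 mult.assoc)
    qed
  qed
qed

text \<open>The integral inverse of the matrix expresses r and s through the two entries, so both
  pairs have the same common divisors.\<close>

lemma sl2_coprime_iff:
  fixes a b c d r s :: nat
  assumes "a * d = b * c + 1"
  shows "coprime (a * r + b * s) (c * r + d * s) \<longleftrightarrow> coprime r s"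
proof -
  have iad: "int a * int d - int b * int c = 1" using arg_cong[OF assms, of int] by simp
  define m where "m = int a * int r + int b * int s"
  define k where "k = int c * int r + int d * int s"
  have "int d * m - int b * k = (int a * int d - int b * int c) * int r"
    "int a * k - int c * m = (int a * int d - int b * int c) * int s"
    by (simp_all add: m_def k_def algebra_simps)
  then have r: "int d * m - int b * k = int r" and s: "int a * k - int c * m = int s" using iad by simp_all
  have "coprime m k \<longleftrightarrow> coprime (int r) (int s)"
  proof
    assume c: "coprime (int r) (int s)"
    show "coprime m k"
    proof (rule coprimeI)
      fix x assume "x dvd m" "x dvd k"
      then have "x dvd int r" "x dvd int s" unfolding r[symmetric] s[symmetric] by auto
      then show "is_unit x" using c coprime_common_divisor by blast
    qed
  next
    assume c: "coprime m k"
    show "coprime (int r) (int s)"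
    proof (rule coprimeI)
      fix x assume "x dvd int r" "x dvd int s"
      then have "x dvd m" "x dvd k" unfolding m_def k_def by auto
      then show "is_unit x" using c coprime_common_divisor by blast
    qed
  qed
  moreover have "m = int (a * r + b * s)" "k = int (c * r + d * s)" by (simp_all add: m_def k_def)
  ultimately show ?thesis by (simp only: coprime_int_iff)
qed

text \<open>A state is encoded by the column sums of its matrix together with (r, s). The top row
  can be recovered from the column sums, and then everything else; the condition m < k becomes
  \<open>left_half_iff\<close>. The deleted quadruple belongs to m = k = 1.\<close>

lemma sum_low_steps:
  "(\<Sum>(m, k)\<in>small_pairs n. low_steps m k) =
   card (quads (\<lambda>u v. coprime u v \<and> left_half u v) coprime_le n - {(1, 1, 1, 1)})"
proof -
  let ?T = "SIGMA p:small_pairs n. euclid_states (fst p) (snd p)"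
  let ?Q = "quads (\<lambda>u v. coprime u v \<and> left_half u v) coprime_le n - {(1, 1, 1, 1)}"
  let ?f = "\<lambda>(p, a, b, c, d, r, s). (a + c, b + d, r, s) :: nat \<times> nat \<times> nat \<times> nat"
  have T: "a * (b + d) = b * (a + c) + 1" "b < b + d" "a + c \<ge> 1" "1 \<le> r" "r \<le> s" "coprime r s"
      "m = a * r + b * s" "k = c * r + d * s" "m < k" "m + k \<le> n" "coprime (a + c) (b + d)"
    if "((m, k), (a, b, c, d, r, s)) \<in> ?T" for m k a b c d r s
  proof -
    have H: "a * d = b * c + 1" "m = a * r + b * s" "k = c * r + d * s" "1 \<le> r" "r \<le> s" "m < k" "m + k \<le> n" "coprime m k"
      using that by (auto simp: euclid_states_def small_pairs_def)
    have "d \<noteq> 0" "a \<noteq> 0" using H(1) by (metis add_is_0 mult_is_0 one_neq_zero)+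
    show "a * (b + d) = b * (a + c) + 1" using H(1) by (simp add: algebra_simps)
    show "b < b + d" "a + c \<ge> 1" using \<open>d \<noteq> 0\<close> \<open>a \<noteq> 0\<close> by auto
    show "coprime r s" using H sl2_coprime_iff[OF H(1), of r s] by simp
    have "a * (b + d) = b * (a + c) + 1" using H(1) by (simp add: algebra_simps)
    then show "coprime (a + c) (b + d)"
      by (metis coprimeI dvd_add_right_iff dvd_mult)
  qed (use that in \<open>auto simp: euclid_states_def small_pairs_def\<close>)
  have "bij_betw ?f ?T ?Q"
    unfolding bij_betw_def
  proof
    show "inj_on ?f ?T"
    proof (rule inj_onI)
      fix x y assume x: "x \<in> ?T" and y: "y \<in> ?T" and eq: "?f x = ?f y"
      obtain m k a b c d r s where xx: "x = ((m, k), (a, b, c, d, r, s))" by (metis prod.collapse)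
      obtain m' k' a' b' c' d' r' s' where yy: "y = ((m', k'), (a', b', c', d', r', s'))" by (metis prod.collapse)
      note Tx = T[OF x[unfolded xx]] and Ty = T[OF y[unfolded yy]]
      have e: "a + c = a' + c'" "b + d = b' + d'" "r = r'" "s = s'" using eq by (auto simp: xx yy)
      have "a = a' \<and> b = b'" by (rule sl2_first_row_unique[OF Tx(1,2)]) (use Ty e in auto)
      then show "x = y" using e Tx(7,8) Ty(7,8) by (auto simp: xx yy)
    qed
    show "?f ` ?T = ?Q"
    proof (intro equalityI subsetI)
      fix z assume "z \<in> ?f ` ?T"
      then obtain m k a b c d r s where z: "z = (a + c, b + d, r, s)" and in_T: "((m, k), (a, b, c, d, r, s)) \<in> ?T" by auto
      note t = T[OF in_T]
      have "2 * (a * r + b * s) < (a + c) * r + (b + d) * s" using t(7,8,9) by (simp add: algebra_simps)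
      then have "left_half (a + c) (b + d) \<and> (a + c, b + d, r, s) \<noteq> (1, 1, 1, 1)"
        using left_half_iff[OF t(1,2,3,4,5,6)] by blast
      moreover have "(a + c) * r + (b + d) * s \<le> n" using t(7,8,10) by (simp add: algebra_simps)
      ultimately show "z \<in> ?Q" using t by (auto simp: z quads_def)
    next
      fix z assume z: "z \<in> ?Q"
      obtain u v r s where zz: "z = (u, v, r, s)" by (cases z)
      have H: "1 \<le> u" "1 \<le> v" "1 \<le> r" "1 \<le> s" "coprime u v" "left_half u v" "r \<le> s" "coprime r s" "u * r + v * s \<le> n" "(u, v, r, s) \<noteq> (1, 1, 1, 1)"
        using z by (auto simp: zz quads_def)
      obtain a b where ab: "a * v = b * u + 1" "b < v" "a \<le> u" using sl2_first_row_exists H by blast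
      define c d where "c = u - a" and "d = v - b"
      have uv: "u = a + c" "v = b + d" using ab by (auto simp: c_def d_def)
      have det: "a * d = b * c + 1" using ab(1) unfolding uv by (simp add: algebra_simps)
      have "2 * (a * r + b * s) < u * r + v * s"
        using left_half_iff[OF ab(1,2) H(1,3,7,8)] H by blast
      then have lt: "a * r + b * s < c * r + d * s" unfolding uv by (simp add: algebra_simps)
      have "a \<noteq> 0" using det by (metis add_is_0 mult_is_0 one_neq_zero)
      then have "a * r + b * s \<ge> 1" using H by (auto simp: Suc_le_eq)
      then have "(a * r + b * s, c * r + d * s) \<in> small_pairs n"
        using lt H(8,9) sl2_coprime_iff[OF det, of r s] by (auto simp: small_pairs_def uv algebra_simps)
      then have "((a * r + b * s, c * r + d * s), (a, b, c, d, r, s)) \<in> ?T"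
        using det H by (auto simp: euclid_states_def)
      then show "z \<in> ?f ` ?T" by (rule rev_image_eqI) (simp add: zz uv)
    qed
  qed
  then have "card ?Q = card ?T" by (rule bij_betw_same_card[symmetric])
  also have "\<dots> = (\<Sum>p\<in>small_pairs n. card (euclid_states (fst p) (snd p)))"
    by (rule card_SigmaI) (use euclid_states_low_steps in auto)
  also have "\<dots> = (\<Sum>(m, k)\<in>small_pairs n. low_steps m k)"
    using euclid_states_low_steps by (simp add: case_prod_unfold)
  finally show ?thesis ..
qed

subsection \<open>The sum of the lengths\<close>

text \<open>The value 0 of the sign does not occur: an inverse equal to v / 2 would divide
  \<open>v\<close> while being coprime to it, hence be 1, against v > 2.\<close>

lemma left_half_half_sign:
  assumes "v > 2" "coprime u v"
  shows "2 * (if left_half u v then 1 else 0) = 1 - inverse_sign u v"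
proof -
  define i where "i = modular_inverse (int v) (int u)"
  have c: "coprime (int u) (int v)" using assms(2) by simp
  have i: "0 < i" using mult_modular_inverse_int_pos[OF _ c] assms by (simp add: i_def)
  have "2 * i \<noteq> int v"
  proof
    assume e: "2 * i = int v"
    have "coprime i (int v)" unfolding i_def using c by (rule coprime_modular_inverse)
    then have "coprime i (2 * i)" by (simp only: e)
    then have "i = 1" using i by simp
    then show False using e assms by simp
  qed
  then show ?thesis using i assms unfolding left_half_def i_def[symmetric] half_sign_def by auto
qed

lemma kloosterman_error_nonneg: "kloosterman_error v \<ge> 0"
  by (simp add: kloosterman_error_def harm_nonneg)

text \<open>For fixed v, s, r the variable u runs over an initial segment, so its sum is at most
  \<open>kloosterman_error v\<close>. There are at most (n / v)^2 pairs r <= s <= n / v, and the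
  remaining series over v converges.\<close>

lemma half_sign_quads_bound:
  "\<exists>K. \<forall>n. \<bar>\<Sum>(u, v, r, s)\<in>{(u, v, r, s). (u, v, r, s) \<in> quads coprime coprime_le n \<and> v > 2}.
      inverse_sign u v\<bar> \<le> K * (real n)\<^sup>2"
proof -
  obtain K where K: "\<And>N. (\<Sum>v=1..N. kloosterman_error v / (real v)\<^sup>2) \<le> K"
    using sum_kloosterman_error_bounded by blast
  have "\<bar>\<Sum>(u, v, r, s)\<in>{(u, v, r, s). (u, v, r, s) \<in> quads coprime coprime_le n \<and> v > 2}. inverse_sign u v\<bar> \<le> K * (real n)\<^sup>2" for n
  proof -
    let ?V = "{(u, v, r, s). (u, v, r, s) \<in> quads coprime coprime_le n \<and> v > 2}"
    define R where "R s = {r. r \<in> {1..s} \<and> coprime r s}" for s :: nat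
    define U where "U v s r = {u. u \<in> {1..(n - v * s) div r} \<and> coprime u v}" for v s r
    define W where "W v s r = (\<Sum>u\<in>U v s r. inverse_sign u v)" for v s r
    have fin: "finite (R s)" "finite (U v s r)" for v s r by (simp_all add: R_def U_def)
    have "(\<Sum>(u, v, r, s)\<in>?V. inverse_sign u v) = (\<Sum>(v, s, r, u)\<in>(SIGMA v:{3..n}. SIGMA s:{1..n div v}. SIGMA r:R s. U v s r). inverse_sign u v)"
    proof (rule sum.reindex_bij_witness[of _ "\<lambda>(v, s, r, u). (u, v, r, s)" "\<lambda>(u, v, r, s). (v, s, r, u)"])
      fix x assume x: "x \<in> ?V"
      obtain u v r s where xx: "x = (u, v, r, s)" by (cases x)
      have q: "(u, v, r, s) \<in> quads coprime coprime_le n" "v > 2" using x by (auto simp: xx)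
      then have "s * v \<le> n" "u * r \<le> n - v * s" by (auto simp: quads_def algebra_simps)
      then show "(case x of (u, v, r, s) \<Rightarrow> (v, s, r, u)) \<in> (SIGMA v:{3..n}. SIGMA s:{1..n div v}. SIGMA r:R s. U v s r)"
        using q quads_bounds[OF q(1)] by (auto simp: xx R_def U_def quads_def less_eq_div_iff_mult_less_eq)
    next
      fix x assume x: "x \<in> (SIGMA v:{3..n}. SIGMA s:{1..n div v}. SIGMA r:R s. U v s r)"
      obtain v s r u where xx: "x = (v, s, r, u)" by (cases x)
      have *: "v \<ge> 3" "s \<ge> 1" "s * v \<le> n" "1 \<le> r" "r \<le> s" "coprime r s" "1 \<le> u" "u * r \<le> n - v * s" "coprime u v"
        using x by (auto simp: xx R_def U_def less_eq_div_iff_mult_less_eq)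
      then have "u * r + v * s \<le> n" by (simp add: mult.commute)
      then show "(case x of (v, s, r, u) \<Rightarrow> (u, v, r, s)) \<in> ?V" using * by (auto simp: xx quads_def)
    qed auto
    also have "\<dots> = (\<Sum>v\<in>{3..n}. \<Sum>(s, r, u)\<in>(SIGMA s:{1..n div v}. SIGMA r:R s. U v s r). inverse_sign u v)"
      by (rule sum.Sigma[symmetric]) (auto simp: fin)
    also have "\<dots> = (\<Sum>v\<in>{3..n}. \<Sum>s\<in>{1..n div v}. \<Sum>(r, u)\<in>(SIGMA r:R s. U v s r). inverse_sign u v)"
      by (intro sum.cong refl sum.Sigma[symmetric]) (auto simp: fin)
    also have "\<dots> = (\<Sum>v\<in>{3..n}. \<Sum>s\<in>{1..n div v}. \<Sum>r\<in>R s. W v s r)"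
      unfolding W_def by (intro sum.cong refl sum.Sigma[symmetric]) (auto simp: fin)
    finally have "\<bar>\<Sum>(u, v, r, s)\<in>?V. inverse_sign u v\<bar> = \<bar>\<Sum>v\<in>{3..n}. \<Sum>s\<in>{1..n div v}. \<Sum>r\<in>R s. W v s r\<bar>"
      by simp
    also have "\<dots> \<le> (\<Sum>v\<in>{3..n}. \<Sum>s\<in>{1..n div v}. \<Sum>r\<in>R s. kloosterman_error v)"
    proof (intro order.trans[OF sum_abs] sum_mono)
      fix v s r assume "v \<in> {3..n}"
      then show "\<bar>W v s r\<bar> \<le> kloosterman_error v"
        unfolding W_def U_def by (intro half_sign_sum_bound) auto
    qed
    also have "\<dots> \<le> (\<Sum>v\<in>{3..n}. (real n)\<^sup>2 * (kloosterman_error v / (real v)\<^sup>2))"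
    proof (rule sum_mono)
      fix v assume v: "v \<in> {3..n}"
      have q: "real (n div v) \<le> real n / real v" using div_bounds[of v n] v by auto
      have "(\<Sum>s\<in>{1..n div v}. \<Sum>r\<in>R s. kloosterman_error v) \<le> (\<Sum>s\<in>{1..n div v}. real (n div v) * kloosterman_error v)"
      proof (rule sum_mono)
        fix s assume s: "s \<in> {1..n div v}"
        have "card (R s) \<le> card {1..s}" unfolding R_def by (rule card_mono) auto
        then have "real (card (R s)) \<le> real (n div v)" using s by simp
        then show "(\<Sum>r\<in>R s. kloosterman_error v) \<le> real (n div v) * kloosterman_error v"
          using kloosterman_error_nonneg[of v] by (simp add: mult_right_mono)
      qed
      also have "\<dots> = real (n div v) * real (n div v) * kloosterman_error v" by simp
      also have "\<dots> \<le> (real n / real v) * (real n / real v) * kloosterman_error v"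
        using q kloosterman_error_nonneg[of v] by (intro mult_right_mono mult_mono) auto
      finally show "(\<Sum>s\<in>{1..n div v}. \<Sum>r\<in>R s. kloosterman_error v) \<le> (real n)\<^sup>2 * (kloosterman_error v / (real v)\<^sup>2)"
        by (simp add: power2_eq_square)
    qed
    also have "\<dots> = (real n)\<^sup>2 * (\<Sum>v\<in>{3..n}. kloosterman_error v / (real v)\<^sup>2)"
      by (simp add: sum_distrib_left)
    also have "\<dots> \<le> (real n)\<^sup>2 * (\<Sum>v=1..n. kloosterman_error v / (real v)\<^sup>2)"
      by (intro mult_left_mono sum_mono2) (auto simp: kloosterman_error_nonneg)
    also have "\<dots> \<le> (real n)\<^sup>2 * K" by (intro mult_left_mono K) auto
    finally show ?thesis by (simp add: mult.commute)
  qed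
  then show ?thesis by blast
qed

definition total_steps :: "nat \<Rightarrow> real" where
  "total_steps n = (\<Sum>(m, k)\<in>small_pairs n. real (low_steps m k))"

text \<open>Twice the indicator of \<open>left_half\<close> is 1 + 1 for v = 1, 1 - 1 for v = 2, and
  1 minus the sign for v > 2. The tolerance 2 pays for the deleted quadruple (1, 1, 1, 1).\<close>

lemma total_steps_split:
  fixes n :: nat
  defines "Q0 \<equiv> quads coprime coprime_le n"
  shows "\<bar>2 * total_steps n - (real (card Q0)
      + quad_count (\<lambda>u v. v = 1) coprime_le n
      - quad_count odd_and_two coprime_le n
      - (\<Sum>(u, v, r, s)\<in>{(u, v, r, s). (u, v, r, s) \<in> Q0 \<and> v > 2}.
           inverse_sign u v))\<bar> \<le> 2"
proof -
  define X where "X = quads (\<lambda>u v. coprime u v \<and> left_half u v) coprime_le n"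
  define V1 where "V1 = quads (\<lambda>u v. v = 1) coprime_le n"
  define V2 where "V2 = quads odd_and_two coprime_le n"
  define V3 where "V3 = {(u, v, r, s). (u, v, r, s) \<in> Q0 \<and> v > 2}"
  define wt :: "nat \<times> nat \<times> nat \<times> nat \<Rightarrow> real"
    where "wt = (\<lambda>(u, v, r, s). 2 * (if left_half u v then 1 else 0))"
  have fQ: "finite Q0" by (simp add: Q0_def)
  have fV: "finite V1" "finite V2" "finite V3"
    unfolding V1_def V2_def V3_def by (auto intro: finite_subset[OF _ fQ])
  have "total_steps n = real (card (X - {(1, 1, 1, 1)}))"
    unfolding total_steps_def X_def sum_low_steps[symmetric] by (simp add: case_prod_unfold)
  moreover have "card (X - {(1, 1, 1, 1)}) \<le> card X" "card X \<le> card (X - {(1, 1, 1, 1)}) + 1"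
    by (auto simp: X_def card_Diff_singleton_if intro: card_mono)
  ultimately have 1: "\<bar>2 * total_steps n - 2 * real (card X)\<bar> \<le> 2" by linarith
  have "2 * real (card X) = (\<Sum>x\<in>X. wt x)"
    by (subst sum.cong[OF refl, of X wt "\<lambda>x. 2"]) (auto simp: X_def quads_def wt_def)
  also have "\<dots> = (\<Sum>x\<in>Q0. wt x)"
    by (rule sum.mono_neutral_left[OF fQ]) (auto simp: X_def Q0_def quads_def wt_def split: if_splits)
  also have "Q0 = V1 \<union> (V2 \<union> V3)"
  proof (intro equalityI subsetI)
    fix x assume x: "x \<in> Q0"
    obtain u v r s where xx: "x = (u, v, r, s)" by (cases x)
    have "v \<ge> 1" using x by (auto simp: xx Q0_def quads_def)
    then consider "v = 1" | "v = 2" | "v > 2" by linarith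
    then show "x \<in> V1 \<union> (V2 \<union> V3)"
      using x by cases (auto simp: xx V1_def V2_def V3_def Q0_def quads_def coprime_commute)
  qed (auto simp: V1_def V2_def V3_def Q0_def quads_def coprime_commute)
  also have "(\<Sum>x\<in>V1 \<union> (V2 \<union> V3). wt x) = (\<Sum>x\<in>V1. wt x) + ((\<Sum>x\<in>V2. wt x) + (\<Sum>x\<in>V3. wt x))"
  proof -
    have "(\<Sum>x\<in>V2 \<union> V3. wt x) = (\<Sum>x\<in>V2. wt x) + (\<Sum>x\<in>V3. wt x)"
      by (rule sum.union_disjoint) (use fV in \<open>auto simp: V2_def V3_def quads_def\<close>)
    moreover have "(\<Sum>x\<in>V1 \<union> (V2 \<union> V3). wt x) = (\<Sum>x\<in>V1. wt x) + (\<Sum>x\<in>V2 \<union> V3. wt x)"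
      by (rule sum.union_disjoint) (use fV in \<open>auto simp: V1_def V2_def V3_def quads_def\<close>)
    ultimately show ?thesis by simp
  qed
  also have "(\<Sum>x\<in>V1. wt x) = (\<Sum>x\<in>V1. 2)"
    by (intro sum.cong refl) (auto simp: V1_def quads_def wt_def left_half_def)
  also have "(\<Sum>x\<in>V2. wt x) = (\<Sum>x\<in>V2. 0)"
    by (intro sum.cong refl) (auto simp: V2_def quads_def wt_def left_half_def)
  also have "(\<Sum>x\<in>V3. wt x) = (\<Sum>(u, v, r, s)\<in>V3. 1 - inverse_sign u v)"
    by (intro sum.cong refl) (auto simp: V3_def Q0_def quads_def wt_def left_half_half_sign simp del: mult_eq_1_iff)
  also have "\<dots> = real (card V3) - (\<Sum>(u, v, r, s)\<in>V3. inverse_sign u v)"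
    by (simp add: case_prod_unfold sum_subtractf)
  finally have "2 * real (card X) = 2 * real (card V1) + real (card V3) - (\<Sum>(u, v, r, s)\<in>V3. inverse_sign u v)" by simp
  moreover have "card Q0 = card V1 + (card V2 + card V3)"
  proof -
    have "card (V2 \<union> V3) = card V2 + card V3"
      by (rule card_Un_disjoint) (use fV in \<open>auto simp: V2_def V3_def quads_def\<close>)
    moreover have "card (V1 \<union> (V2 \<union> V3)) = card V1 + card (V2 \<union> V3)"
      by (rule card_Un_disjoint) (use fV in \<open>auto simp: V1_def V2_def V3_def quads_def\<close>)
    ultimately show ?thesis using \<open>Q0 = V1 \<union> (V2 \<union> V3)\<close> by simp
  qed
  ultimately have "2 * real (card X) = real (card Q0) + real (card V1) - real (card V2) - (\<Sum>(u, v, r, s)\<in>V3. inverse_sign u v)" by simp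
  then show ?thesis using 1 unfolding V1_def V2_def V3_def by simp
qed

text \<open>The factor 4 clears the weight 1/2 of the condition on inverses and the 1/2 from r <= s.
  The additional coefficient is 2 (1/2 - 1/8) / zeta(2).\<close>

lemma total_steps_asymptotics:
  "has_quad_log (\<lambda>n. 4 * total_steps n) (1 / (2 * (zeta 2)\<^sup>2)) (coprime_const + 3 / (4 * zeta 2))"
proof -
  obtain K1 where K1: "\<And>n. n \<ge> 1 \<Longrightarrow> \<bar>quad_count coprime coprime n - quad_log (1 / (2 * (zeta 2)\<^sup>2)) coprime_const (real n)\<bar> \<le> K1 * (real n)\<^sup>2"
    using has_quad_logE[OF coprime_quads_asymptotics] by blast
  obtain K2 where K2: "\<And>n. n \<ge> 1 \<Longrightarrow> \<bar>quad_count (\<lambda>u v. v = 1) coprime_le n - quad_log 0 (1 / (2 * zeta 2)) (real n)\<bar> \<le> K2 * (real n)\<^sup>2"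
    using has_quad_logE[OF quads_v1_coprime] by blast
  obtain K3 where K3: "\<And>n. n \<ge> 1 \<Longrightarrow> \<bar>quad_count odd_and_two coprime_le n - quad_log 0 (1 / (8 * zeta 2)) (real n)\<bar> \<le> K3 * (real n)\<^sup>2"
    using has_quad_logE[OF quads_v2_coprime] by blast
  obtain K4 where K4: "\<And>n. \<bar>\<Sum>(u, v, r, s)\<in>{(u, v, r, s). (u, v, r, s) \<in> quads coprime coprime_le n \<and> v > 2}.
      inverse_sign u v\<bar> \<le> K4 * (real n)\<^sup>2"
    using half_sign_quads_bound by blast
  have "\<bar>4 * total_steps n - quad_log (1 / (2 * (zeta 2)\<^sup>2)) (coprime_const + 3 / (4 * zeta 2)) (real n)\<bar> \<le> (5 + K1 + 2 * K2 + 2 * K3 + 2 * K4) * (real n)\<^sup>2"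
    if n: "n \<ge> 1" for n
  proof -
    have z: "zeta 2 > 0" using zeta_2_ge_1 by simp
    have q: "quad_log (1 / (2 * (zeta 2)\<^sup>2)) (coprime_const + 3 / (4 * zeta 2)) (real n) =
       quad_log (1 / (2 * (zeta 2)\<^sup>2)) coprime_const (real n) + 2 * quad_log 0 (1 / (2 * zeta 2)) (real n) - 2 * quad_log 0 (1 / (8 * zeta 2)) (real n)"
      using z by (simp add: quad_log_def field_simps)
    have "1 \<le> (real n)\<^sup>2" using n by simp
    then show ?thesis
      using total_steps_split[of n] coprime_quads_le[of n] K1[OF n] K2[OF n] K3[OF n] K4[of n]
      unfolding q abs_le_iff distrib_right by linarith
  qed
  then show ?thesis by (rule has_quad_logI)
qed

section \<open>The number of Farey fractions\<close>

definition coprime_pairs :: "nat \<Rightarrow> (nat \<times> nat) set" where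
  "coprime_pairs n = {(m, k). 1 \<le> m \<and> 1 \<le> k \<and> coprime m k \<and> m + k \<le> n}"

lemma finite_coprime_pairs [simp]: "finite (coprime_pairs n)"
  by (rule finite_subset[of _ "{..n} \<times> {..n}"]) (auto simp: coprime_pairs_def)

text \<open>Reading pairs as quadruples with u = v = 1 makes \<open>card_quads_coprime\<close>
  available.\<close>

lemma card_coprime_pairs: "card (coprime_pairs n) = card (quads (\<lambda>u v. u = 1 \<and> v = 1) (\<lambda>r s. True \<and> coprime r s) n)"
  by (rule bij_betw_same_card[of "\<lambda>(m, k). (1, 1, m, k)"], rule bij_betw_byWitness[of _ "\<lambda>(u, v, r, s). (r, s)"])
     (auto simp: coprime_pairs_def quads_def)

lemma card_quads_1_1: "quad_count (\<lambda>u v. u = 1 \<and> v = 1) any_pair n = (real n)\<^sup>2 / 2 - real n / 2"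
proof -
  let ?T = "SIGMA r:{1..n}. {1..n - r}"
  have "bij_betw (\<lambda>(r, s). (1, 1, r, s)) ?T (quads (\<lambda>u v. u = 1 \<and> v = 1) any_pair n)"
    by (rule bij_betw_byWitness[of _ "\<lambda>(u, v, r, s). (r, s)"]) (auto simp: quads_def)
  then have "card (quads (\<lambda>u v. u = 1 \<and> v = 1) any_pair n) = card ?T" by (simp add: bij_betw_same_card)
  also have "\<dots> = (\<Sum>r=1..n. n - r)" by (simp add: card_SigmaI)
  finally have "quad_count (\<lambda>u v. u = 1 \<and> v = 1) any_pair n = (\<Sum>r=1..n. real n - real r)"
    by (simp add: of_nat_diff)
  also have "\<dots> = real n * real n - (\<Sum>r=1..n. real r)" by (simp add: sum_subtractf)
  also have "(\<Sum>r=1..n. real r) = real n * (real n + 1) / 2" by (induction n) (auto simp: field_simps)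
  finally show ?thesis by (simp add: power2_eq_square field_simps)
qed

text \<open>The estimate is multiplied by the squared logarithm, so nothing is divided by ln 1 = 0.
  The saving comes from \<open>moebius_log_partial_sum\<close> with j = 2 and matches the size of
  the average by which the count will be multiplied.\<close>

lemma card_coprime_pairs_bound:
  assumes n: "n \<ge> 1"
  shows "(ln (real n))\<^sup>2 * \<bar>real (card (coprime_pairs n)) - (real n)\<^sup>2 / (2 * zeta 2)\<bar>
     \<le> 2 * real n * (1 + ln (real n)) * (ln (real n))\<^sup>2 + suminf (zeta_log_term 2) * (real n)\<^sup>2"
proof -
  let ?S = "(\<Sum>d=1..n. moebius_log_term 0 d)"
  define L where "L = ln (real n)"
  define G where "G n = quad_count (\<lambda>u v. u = 1 \<and> v = 1) any_pair n" for n
  have L: "L \<ge> 0" using n by (simp add: L_def)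
  have G: "G n = (\<Sum>d=1..n. real (card (coprime_pairs (n div d))))" for n
    unfolding G_def card_coprime_pairs by (subst card_quads_coprime) simp_all
  have "real (card (coprime_pairs n)) = (\<Sum>d=1..n. moebius_mu d * G (n div d))"
    using moebius_inversion_floor[of G "\<lambda>n. real (card (coprime_pairs n))", OF G] n by simp
  moreover have "\<bar>(\<Sum>d=1..n. moebius_mu d * G (n div d)) - (\<Sum>d=1..n. moebius_mu d * ((real n / real d)\<^sup>2 / 2))\<bar> \<le> (\<Sum>d=1..n. 1 * (2 * (real n / real d)))"
    unfolding sum_subtractf[symmetric] right_diff_distrib[symmetric]
  proof (intro order.trans[OF sum_abs] sum_mono)
    fix d assume d: "d \<in> {1..n}"
    define q where "q = real (n div d)"
    define x where "x = real n / real d"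
    have b: "1 \<le> q" "q \<le> x" "x \<le> q + 1" unfolding q_def x_def by (rule floor_div_bounds; use d in simp)+
    \<comment> \<open>The triangular count q (q - 1) / 2 is compared with x^2 / 2 by x - 1 <= q <=
      x.\<close>
    have "q * q \<le> x * x" "(x - 1) * (x - 1) \<le> q * q" using b by (auto intro: mult_mono)
    then have "\<bar>(q\<^sup>2 / 2 - q / 2) - x\<^sup>2 / 2\<bar> \<le> 2 * x" using b unfolding power2_eq_square abs_le_iff by (simp add: algebra_simps)
    then have "\<bar>G (n div d) - (real n / real d)\<^sup>2 / 2\<bar> \<le> 2 * (real n / real d)"
      unfolding G_def card_quads_1_1 q_def[symmetric] x_def[symmetric] .
    then show "\<bar>moebius_mu d * (G (n div d) - (real n / real d)\<^sup>2 / 2)\<bar> \<le> 1 * (2 * (real n / real d))"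
      unfolding abs_mult by (intro mult_mono abs_moebius_le) auto
  qed
  moreover have "(\<Sum>d=1..n. 1 * (2 * (real n / real d))) = 2 * real n * harm n"
    by (simp add: harm_def sum_distrib_left divide_inverse mult.assoc)
  moreover have "2 * real n * harm n \<le> 2 * real n * (1 + L)"
    using harm_bounds(1)[of n] n by (intro mult_left_mono) (auto simp: L_def)
  moreover have "(\<Sum>d=1..n. moebius_mu d * ((real n / real d)\<^sup>2 / 2)) = (real n)\<^sup>2 / 2 * ?S"
    by (simp add: sum_distrib_left moebius_log_term_def zeta_log_term_def power_divide mult_ac)
  ultimately have 1: "\<bar>real (card (coprime_pairs n)) - (real n)\<^sup>2 / 2 * ?S\<bar> \<le> 2 * real n * (1 + L)"
    by linarith
  have r: "L\<^sup>2 * \<bar>1 / zeta 2 - ?S\<bar> \<le> suminf (zeta_log_term 2)"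
    using moebius_log_partial_sum[of 0 2 n] n unfolding suminf_moebius_0 L_def by (simp only: add_0 order.refl)
  have "(real n)\<^sup>2 / 2 * ?S - (real n)\<^sup>2 / (2 * zeta 2) = - ((real n)\<^sup>2 / 2 * (1 / zeta 2 - ?S))"
    by (simp add: algebra_simps)
  then have "\<bar>(real n)\<^sup>2 / 2 * ?S - (real n)\<^sup>2 / (2 * zeta 2)\<bar> = (real n)\<^sup>2 / 2 * \<bar>1 / zeta 2 - ?S\<bar>"
    by (simp add: abs_mult)
  then have "L\<^sup>2 * \<bar>(real n)\<^sup>2 / 2 * ?S - (real n)\<^sup>2 / (2 * zeta 2)\<bar> = (real n)\<^sup>2 / 2 * (L\<^sup>2 * \<bar>1 / zeta 2 - ?S\<bar>)"
    by simp
  also have "\<dots> \<le> (real n)\<^sup>2 / 2 * suminf (zeta_log_term 2)" by (intro mult_left_mono r) simp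
  also have "\<dots> \<le> (real n)\<^sup>2 * suminf (zeta_log_term 2)"
    using suminf_nonneg[OF summable_zeta_log[of 2]] zeta_log_term_nonneg by (intro mult_right_mono) auto
  finally have 2: "L\<^sup>2 * \<bar>(real n)\<^sup>2 / 2 * ?S - (real n)\<^sup>2 / (2 * zeta 2)\<bar> \<le> suminf (zeta_log_term 2) * (real n)\<^sup>2"
    by (simp only: mult.commute)
  have "L\<^sup>2 * \<bar>real (card (coprime_pairs n)) - (real n)\<^sup>2 / (2 * zeta 2)\<bar>
     \<le> L\<^sup>2 * (\<bar>real (card (coprime_pairs n)) - (real n)\<^sup>2 / 2 * ?S\<bar> + \<bar>(real n)\<^sup>2 / 2 * ?S - (real n)\<^sup>2 / (2 * zeta 2)\<bar>)"
    by (intro mult_left_mono abs_triangle_two) simp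
  also have "\<dots> \<le> L\<^sup>2 * (2 * real n * (1 + L)) + suminf (zeta_log_term 2) * (real n)\<^sup>2"
    by (subst distrib_left, intro add_mono mult_left_mono 1 2) simp
  finally show ?thesis by (simp add: L_def mult_ac)
qed

subsection \<open>Farey fractions\<close>

definition pair_ratio :: "nat \<times> nat \<Rightarrow> rat" where
  "pair_ratio p = of_nat (fst p) / of_nat (fst p + snd p)"

lemma pair_ratio_inj: "inj_on pair_ratio (coprime_pairs n)"
proof (rule inj_onI, clarify)
  fix m k m' k' assume H: "(m, k) \<in> coprime_pairs n" "(m', k') \<in> coprime_pairs n" "pair_ratio (m, k) = pair_ratio (m', k')"
  then have pos: "m \<ge> 1" "k \<ge> 1" "m' \<ge> 1" "k' \<ge> 1" and c: "coprime m k" "coprime m' k'" by (auto simp: coprime_pairs_def)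
  have "of_nat m * of_nat (m' + k') = (of_nat m' * of_nat (m + k) :: rat)"
    using H(3) pos by (simp add: pair_ratio_def field_simps)
  then have "m * (m' + k') = m' * (m + k)" by (metis of_nat_eq_iff of_nat_mult)
  then have e: "m * k' = m' * k" by (simp add: algebra_simps)
  have "m dvd m' * k" "m' dvd m * k'" using e by (metis dvd_triv_left)+
  then have "m dvd m'" "m' dvd m" using c by (simp_all add: coprime_dvd_mult_left_iff)
  then have "m = m'" by (rule dvd_antisym)
  then show "m = m' \<and> k = k'" using e pos by simp
qed

lemma farey_eq:
  assumes "n \<ge> 1"
  shows "farey (real n) = {0, 1} \<union> pair_ratio ` coprime_pairs n"
proof (intro equalityI subsetI)
  fix x assume "x \<in> farey (real n)"
  then obtain a b :: int where x: "x = of_int a / of_int b" "gcd a b = 1" "0 \<le> a" "a \<le> b" "of_int b \<le> real n"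
    by (auto simp: farey_def)
  consider "a = 0" | "a = b" | "0 < a" "a < b" using x by linarith
  then show "x \<in> {0, 1} \<union> pair_ratio ` coprime_pairs n"
  proof cases
    case 3
    have "coprime (nat a) (nat (b - a))"
    proof -
      have "gcd (b - a) a = gcd b a" by (rule gcd_diff1)
      then have "coprime a (b - a)" using x(2) by (simp add: coprime_iff_gcd_eq_1 gcd.commute)
      then have "coprime (int (nat a)) (int (nat (b - a)))" using 3 by simp
      then show ?thesis by (simp only: coprime_int_iff)
    qed
    moreover have "b \<le> int n" using x(5) by linarith
    ultimately have "(nat a, nat (b - a)) \<in> coprime_pairs n"
      using 3 by (auto simp: coprime_pairs_def)
    moreover have "pair_ratio (nat a, nat (b - a)) = x"
    proof -
      have "nat a + nat (b - a) = nat b" using 3 by simp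
      then show ?thesis using 3 by (simp add: pair_ratio_def x(1))
    qed
    ultimately show ?thesis by (metis UnI2 image_eqI)
  qed (use x in auto)
next
  fix x assume "x \<in> {0, 1} \<union> pair_ratio ` coprime_pairs n"
  then consider "x = 0" | "x = 1" | m k where "(m, k) \<in> coprime_pairs n" "x = pair_ratio (m, k)" by auto
  then show "x \<in> farey (real n)"
  proof cases
    case 1
    show ?thesis unfolding farey_def mem_Collect_eq
      by (rule exI[of _ "0::int"], rule exI[of _ "1::int"]) (use 1 assms in simp)
  next
    case 2
    show ?thesis unfolding farey_def mem_Collect_eq
      by (rule exI[of _ "1::int"], rule exI[of _ "1::int"]) (use 2 assms in simp)
  next
    case 3
    then have *: "1 \<le> m" "1 \<le> k" "coprime m k" "m + k \<le> n" by (auto simp: coprime_pairs_def)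
    have "coprime m (m + k)" using *(3) gcd_add2[of m k] by (metis coprime_iff_gcd_eq_1)
    then have "gcd (int m) (int (m + k)) = 1" by (simp only: coprime_iff_gcd_eq_1[symmetric] coprime_int_iff)
    moreover have "x = of_int (int m) / of_int (int (m + k))" using 3 by (simp add: pair_ratio_def)
    moreover have "of_int (int (m + k)) \<le> real n" using *(4) by linarith
    ultimately show ?thesis unfolding farey_def mem_Collect_eq by (intro exI[of _ "int m"] exI[of _ "int (m + k)"]) auto
  qed
qed

lemma pair_ratio_bounds:
  assumes "(m, k) \<in> coprime_pairs n"
  shows "0 < pair_ratio (m, k)" "pair_ratio (m, k) < 1" "pair_ratio (m, k) < 1/2 \<longleftrightarrow> m < k"
  using assms by (auto simp: pair_ratio_def coprime_pairs_def field_simps)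

lemma card_farey:
  assumes "n \<ge> 1"
  shows "real (card (farey (real n))) = real (card (coprime_pairs n)) + 2"
proof -
  have "card ({0, 1} \<union> pair_ratio ` coprime_pairs n) = card {0, 1 :: rat} + card (pair_ratio ` coprime_pairs n)"
    by (rule card_Un_disjoint) (auto dest: pair_ratio_bounds)
  also have "\<dots> = 2 + card (coprime_pairs n)" by (simp add: card_image[OF pair_ratio_inj])
  finally show ?thesis by (simp add: farey_eq[OF assms])
qed

lemma farey0_eq:
  assumes "n \<ge> 1"
  shows "farey0 (real n) = insert 0 (pair_ratio ` small_pairs n)"
proof -
  have "pair_ratio ` coprime_pairs n \<inter> {0..<1/2} = pair_ratio ` small_pairs n"
  proof (intro equalityI subsetI)
    fix x assume "x \<in> pair_ratio ` coprime_pairs n \<inter> {0..<1/2}"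
    then obtain m k where mk: "(m, k) \<in> coprime_pairs n" "x = pair_ratio (m, k)" "x < 1/2" by auto
    then have "m < k" using pair_ratio_bounds(3) by blast
    then have "(m, k) \<in> small_pairs n" using mk by (auto simp: coprime_pairs_def small_pairs_def)
    then show "x \<in> pair_ratio ` small_pairs n" using mk by blast
  next
    fix x assume "x \<in> pair_ratio ` small_pairs n"
    then obtain m k where mk: "(m, k) \<in> small_pairs n" "x = pair_ratio (m, k)" by auto
    then have c: "(m, k) \<in> coprime_pairs n" "m < k" by (auto simp: coprime_pairs_def small_pairs_def)
    then show "x \<in> pair_ratio ` coprime_pairs n \<inter> {0..<1/2}"
      using pair_ratio_bounds[OF c(1)] mk(2) by (auto intro: less_imp_le)
  qed
  then show ?thesis unfolding farey0_def farey_eq[OF assms] by auto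
qed

lemma sum_mcf_length:
  assumes "n \<ge> 1"
  shows "(\<Sum>x\<in>farey0 (real n). real (mcf_length x)) = real (mcf_length 0) + total_steps n"
proof -
  have sub: "small_pairs n \<subseteq> coprime_pairs n" by (auto simp: coprime_pairs_def small_pairs_def)
  have inj: "inj_on pair_ratio (small_pairs n)" by (rule inj_on_subset[OF pair_ratio_inj sub])
  have "0 \<notin> pair_ratio ` small_pairs n" using sub by (fastforce dest: pair_ratio_bounds)
  then have "(\<Sum>x\<in>farey0 (real n). real (mcf_length x)) = real (mcf_length 0) + (\<Sum>x\<in>pair_ratio ` small_pairs n. real (mcf_length x))"
    unfolding farey0_eq[OF assms] by simp
  also have "(\<Sum>x\<in>pair_ratio ` small_pairs n. real (mcf_length x)) = (\<Sum>p\<in>small_pairs n. real (mcf_length (pair_ratio p)))"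
    by (rule sum.reindex_cong[OF inj]) auto
  also have "\<dots> = total_steps n"
    unfolding total_steps_def
  proof (intro sum.cong refl)
    fix p assume p: "p \<in> small_pairs n"
    obtain m k where pp: "p = (m, k)" by (cases p)
    have "m > 0" "k > 0" using p by (auto simp: pp small_pairs_def)
    then show "real (mcf_length (pair_ratio p)) = (case p of (m, k) \<Rightarrow> real (low_steps m k))"
      using mcf_length_pair[of m k] by (simp add: pp pair_ratio_def)
  qed
  finally show ?thesis .
qed

section \<open>The quotient, and the passage from integers to real Q\<close>

lemma farey_floor:
  assumes "Q \<ge> 1"
  shows "farey Q = farey (real (nat \<lfloor>Q\<rfloor>))"
proof -
  have "of_int b \<le> Q \<longleftrightarrow> of_int b \<le> real (nat \<lfloor>Q\<rfloor>)" for b :: int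
    using assms by (simp add: le_floor_iff[symmetric])
  then show ?thesis by (simp add: farey_def)
qed

lemma cmult_in_bigo:
  fixes f g :: "'a \<Rightarrow> real"
  assumes "f \<in> O[F](g)"
  shows "(\<lambda>x. c * f x) \<in> O[F](g)"
  using assms by (cases "c = 0") simp_all

text \<open>With P = n^2 / (2 zeta(2)), the difference T - N M equals (T - P M) - (N - P) M. The
  first part is O(n^2) by \<open>total_steps_asymptotics\<close>, the second because N - P is O(n^2
  / (ln n)^2) and M is O((ln n)^2). Dividing by N, which is at least of order n^2, leaves
  O(1).\<close>

lemma farey_average_nat:
  fixes c1 c2 :: real
  assumes c1: "c1 = 1 / (4 * zeta 2)"
    and c2: "c2 = 1 / (2 * zeta 2) *
           (2 * euler_mascheroni - 3 / 2 - 2 * (deriv zeta 2 / zeta 2) + 3 * zeta 2 / 4)"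
  shows "(\<lambda>n. 1 / real (card (farey (real n))) * (\<Sum>x\<in>farey0 (real n). real (mcf_length x))
      - (c1 * (ln (real n))\<^sup>2 + c2 * ln (real n))) \<in> O(\<lambda>_. 1)"
proof -
  let ?h = "(\<lambda>n. (real n)\<^sup>2 / (ln (real n))\<^sup>2)"
  let ?sq = "(\<lambda>n. (real n)\<^sup>2)"
  let ?l2 = "(\<lambda>n. (ln (real n))\<^sup>2)"
  define z where "z = zeta 2"
  have z: "z \<ge> 1" unfolding z_def by (rule zeta_2_ge_1)
  define N where "N n = real (card (coprime_pairs n)) + 2" for n
  define T where "T n = real (mcf_length 0) + total_steps n" for n
  define M where "M n = c1 * (ln (real n))\<^sup>2 + c2 * ln (real n)" for n :: nat
  obtain K where K: "\<And>n. n \<ge> 1 \<Longrightarrow> \<bar>4 * total_steps n - quad_log (1 / (2 * (zeta 2)\<^sup>2)) (coprime_const + 3 / (4 * zeta 2)) (real n)\<bar> \<le> K * (real n)\<^sup>2"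
    using has_quad_logE[OF total_steps_asymptotics] by blast
  \<comment> \<open>This is where \<open>c1\<close> and \<open>c2\<close> come from: the main term
    of 4 T is divided by 4 and by n^2 / (2 zeta(2)).\<close>
  have main: "quad_log (1 / (2 * (zeta 2)\<^sup>2)) (coprime_const + 3 / (4 * zeta 2)) (real n) = 4 * ((real n)\<^sup>2 / (2 * z) * M n)" for n
    using z unfolding quad_log_def M_def c1 c2 coprime_const_def z_def[symmetric]
    by (simp add: field_simps power2_eq_square power3_eq_cube)
  have T: "(\<lambda>n. T n - (real n)\<^sup>2 / (2 * z) * M n) \<in> O(?sq)"
  proof (rule bigoI[of _ "real (mcf_length 0) + K"])
    show "\<forall>\<^sub>F n in sequentially. norm (T n - (real n)\<^sup>2 / (2 * z) * M n) \<le> (real (mcf_length 0) + K) * norm ((real n)\<^sup>2)"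
      using eventually_ge_at_top[of 1]
    proof eventually_elim
      case (elim n)
      have "1 \<le> (real n)\<^sup>2" using elim by simp
      then have "real (mcf_length 0) * 1 \<le> real (mcf_length 0) * (real n)\<^sup>2" by (intro mult_left_mono) auto
      moreover have "0 \<le> K * (real n)\<^sup>2" using K[OF elim] by (meson abs_ge_zero order_trans)
      moreover have "norm ((real n)\<^sup>2) = (real n)\<^sup>2" by simp
      ultimately show ?case using K[OF elim] unfolding main T_def real_norm_def distrib_right by linarith
    qed
  qed
  define Z where "Z = suminf (zeta_log_term 2)"
  have N: "(\<lambda>n. N n - (real n)\<^sup>2 / (2 * z)) \<in> O(?h)"
  proof -
    have "(\<lambda>n. real (card (coprime_pairs n)) - (real n)\<^sup>2 / (2 * z)) \<in> O(\<lambda>n. 2 * real n * (1 + ln (real n)) + Z * ((real n)\<^sup>2 / (ln (real n))\<^sup>2))"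
    proof (rule bigoI[of _ 1])
      show "\<forall>\<^sub>F n in sequentially. norm (real (card (coprime_pairs n)) - (real n)\<^sup>2 / (2 * z)) \<le> 1 * norm (2 * real n * (1 + ln (real n)) + Z * ((real n)\<^sup>2 / (ln (real n))\<^sup>2))"
        using eventually_ge_at_top[of 2]
      proof eventually_elim
        case (elim n)
        then have L: "(ln (real n))\<^sup>2 > 0" by simp
        have "\<bar>real (card (coprime_pairs n)) - (real n)\<^sup>2 / (2 * z)\<bar> \<le> (2 * real n * (1 + ln (real n)) * (ln (real n))\<^sup>2 + Z * (real n)\<^sup>2) / (ln (real n))\<^sup>2"
          using card_coprime_pairs_bound[of n] elim L by (simp add: z_def Z_def pos_le_divide_eq mult.commute)
        also have "\<dots> = 2 * real n * (1 + ln (real n)) + Z * ((real n)\<^sup>2 / (ln (real n))\<^sup>2)"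
          using L by (simp add: add_divide_distrib)
        finally show ?case by simp
      qed
    qed
    also have "(\<lambda>n. 2 * real n * (1 + ln (real n)) + Z * ((real n)\<^sup>2 / (ln (real n))\<^sup>2)) \<in> O(?h)"
    proof (rule sum_in_bigo)
      show "(\<lambda>n. 2 * real n * (1 + ln (real n))) \<in> O(?h)" by real_asymp
      show "(\<lambda>n. Z * ((real n)\<^sup>2 / (ln (real n))\<^sup>2)) \<in> O(?h)"
        by (rule cmult_in_bigo) (rule landau_o.big_refl)
    qed
    finally have 1: "(\<lambda>n. real (card (coprime_pairs n)) - (real n)\<^sup>2 / (2 * z)) \<in> O(?h)" .
    have 2: "(\<lambda>_. 2) \<in> O(?h)" by real_asymp
    have "(\<lambda>n. N n - (real n)\<^sup>2 / (2 * z)) = (\<lambda>n. (real (card (coprime_pairs n)) - (real n)\<^sup>2 / (2 * z)) + 2)"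
      by (simp add: N_def fun_eq_iff)
    then show ?thesis using sum_in_bigo(1)[OF 1 2] by (simp only:)
  qed
  have M: "M \<in> O(?l2)"
    unfolding M_def[abs_def]
  proof (rule sum_in_bigo)
    have "(\<lambda>n. ln (real n)) \<in> O(?l2)" by real_asymp
    then show "(\<lambda>n. c2 * ln (real n)) \<in> O(?l2)" by (rule cmult_in_bigo)
    show "(\<lambda>n. c1 * (ln (real n))\<^sup>2) \<in> O(?l2)"
      by (rule cmult_in_bigo) (rule landau_o.big_refl)
  qed
  have NM: "(\<lambda>n. (N n - (real n)\<^sup>2 / (2 * z)) * M n) \<in> O(?sq)"
  proof -
    have "(\<lambda>n. (N n - (real n)\<^sup>2 / (2 * z)) * M n) \<in> O(\<lambda>n. (real n)\<^sup>2 / (ln (real n))\<^sup>2 * (ln (real n))\<^sup>2)"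
      by (rule landau_o.big.mult[OF N M])
    also have "(\<lambda>n. (real n)\<^sup>2 / (ln (real n))\<^sup>2 * (ln (real n))\<^sup>2) \<in> O(?sq)" by real_asymp
    finally show ?thesis .
  qed
  have top: "(\<lambda>n. T n - N n * M n) \<in> O(?sq)"
  proof -
    have "(\<lambda>n. T n - N n * M n) = (\<lambda>n. (T n - (real n)\<^sup>2 / (2 * z) * M n) - (N n - (real n)\<^sup>2 / (2 * z)) * M n)"
      by (simp add: fun_eq_iff left_diff_distrib)
    then show ?thesis using sum_in_bigo(2)[OF T NM] by (simp only:)
  qed
  have "(\<lambda>n. N n - (real n)\<^sup>2 / (2 * z)) \<in> o(?sq)"
  proof -
    have "(?h) \<in> o(?sq)" by real_asymp
    then show ?thesis by (rule landau_o.big_small_trans[OF N])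
  qed
  \<comment> \<open>The error is kept below half of the main term n^2 / (2 z), so the other half
    remains as a lower bound for \<open>N\<close>.\<close>
  then have "\<forall>\<^sub>F n in sequentially. norm (N n - (real n)\<^sup>2 / (2 * z)) \<le> 1 / (4 * z) * norm ((real n)\<^sup>2)"
    by (rule landau_o.smallD) (use z in simp)
  then have Nlow: "\<forall>\<^sub>F n in sequentially. (real n)\<^sup>2 / (4 * z) \<le> N n"
  proof eventually_elim
    case (elim n)
    have "(real n)\<^sup>2 / (2 * z) - (real n)\<^sup>2 / (4 * z) = (real n)\<^sup>2 / (4 * z)" using z by (simp add: field_simps)
    then show ?case using elim by (simp add: abs_le_iff)
  qed
  have inv: "(\<lambda>n. 1 / N n) \<in> O(\<lambda>n. 1 / (real n)\<^sup>2)"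
  proof (rule bigoI[of _ "4 * z"])
    show "\<forall>\<^sub>F n in sequentially. norm (1 / N n) \<le> 4 * z * norm (1 / (real n)\<^sup>2)"
      using Nlow eventually_ge_at_top[of 1]
    proof eventually_elim
      case (elim n)
      have p: "0 < (real n)\<^sup>2 / (4 * z)" using elim z by simp
      have "1 / N n \<le> 1 / ((real n)\<^sup>2 / (4 * z))" using elim p by (intro frac_le) auto
      moreover have "N n > 0" using elim p by linarith
      ultimately show ?case by simp
    qed
  qed
  have "(\<lambda>n. 1 / N n * (T n - N n * M n)) \<in> O(\<lambda>n. 1 / (real n)\<^sup>2 * (real n)\<^sup>2)"
    by (rule landau_o.big.mult[OF inv top])
  also have "(\<lambda>n. 1 / (real n)\<^sup>2 * (real n)\<^sup>2) \<in> O(\<lambda>_. 1)" by real_asymp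
  finally have *: "(\<lambda>n. 1 / N n * (T n - N n * M n)) \<in> O(\<lambda>_. 1)" .
  have "\<forall>\<^sub>F n in sequentially. 1 / N n * (T n - N n * M n) =
       1 / real (card (farey (real n))) * (\<Sum>x\<in>farey0 (real n). real (mcf_length x)) - (c1 * (ln (real n))\<^sup>2 + c2 * ln (real n))"
    using eventually_ge_at_top[of 1]
  proof eventually_elim
    case (elim n)
    have "N n > 0" by (simp add: N_def add_nonneg_pos)
    then have "1 / N n * (T n - N n * M n) = 1 / N n * T n - M n" by (simp add: field_simps)
    then show ?case using elim by (simp only: card_farey sum_mcf_length N_def T_def M_def)
  qed
  from landau_o.big.in_cong[OF this] * show ?thesis by simp
qed

lemma quad_ln_floor_diff:
  fixes Q c1 c2 :: real
  assumes "Q \<ge> 1"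
  defines "n \<equiv> real (nat \<lfloor>Q\<rfloor>)"
  shows "\<bar>(c1 * (ln n)\<^sup>2 + c2 * ln n) - (c1 * (ln Q)\<^sup>2 + c2 * ln Q)\<bar> \<le> 3 * \<bar>c1\<bar> + \<bar>c2\<bar>"
proof -
  have n: "1 \<le> n" "n \<le> Q" "Q \<le> n + 1"
    using assms by (auto simp: n_def le_nat_iff le_floor_iff of_nat_nat)
  have l: "0 \<le> ln n" "ln n \<le> ln Q" "ln n \<le> n" using n ln_le_minus_one[of n] by auto
  have "ln Q - ln n = ln (Q / n)" using n by (simp add: ln_div)
  also have "\<dots> \<le> Q / n - 1" using n by (intro ln_le_minus_one) simp
  also have "\<dots> = (Q - n) / n" using n by (simp add: diff_divide_distrib)
  also have "\<dots> \<le> 1 / n" using n by (intro divide_right_mono) auto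
  finally have d: "ln Q - ln n \<le> 1 / n" .
  have "1 / n \<le> 1" using n by simp
  then have d1: "\<bar>ln n - ln Q\<bar> \<le> 1" using d l by linarith
  \<comment> \<open>Here ln Q <= ln n + 1 <= n + 1 <= 2 n and ln n <= n, so the sum of the
    logarithms is at most 3 n, which the factor 1 / n compensates.\<close>
  have "(ln Q - ln n) * (ln Q + ln n) \<le> 1 / n * (3 * n)"
    using d d1 l n by (intro mult_mono) auto
  then have "(ln Q - ln n) * (ln Q + ln n) \<le> 3" using n by simp
  moreover have "0 \<le> (ln Q - ln n) * (ln Q + ln n)" using l by simp
  moreover have "(ln n)\<^sup>2 - (ln Q)\<^sup>2 = - ((ln Q - ln n) * (ln Q + ln n))" by (simp add: power2_eq_square algebra_simps)
  ultimately have d2: "\<bar>(ln n)\<^sup>2 - (ln Q)\<^sup>2\<bar> \<le> 3" by simp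
  have "(c1 * (ln n)\<^sup>2 + c2 * ln n) - (c1 * (ln Q)\<^sup>2 + c2 * ln Q) = c1 * ((ln n)\<^sup>2 - (ln Q)\<^sup>2) + c2 * (ln n - ln Q)"
    by (simp add: algebra_simps)
  also have "\<bar>\<dots>\<bar> \<le> \<bar>c1\<bar> * \<bar>(ln n)\<^sup>2 - (ln Q)\<^sup>2\<bar> + \<bar>c2\<bar> * \<bar>ln n - ln Q\<bar>"
    by (rule order.trans[OF abs_triangle_ineq]) (simp add: abs_mult)
  also have "\<dots> \<le> \<bar>c1\<bar> * 3 + \<bar>c2\<bar> * 1" using d1 d2 by (intro add_mono mult_left_mono) auto
  finally show ?thesis by simp
qed

theorem theorem2p2:
  fixes c1 c2 C1 C2 :: real
  assumes "c1 = 1 / (4 * zeta 2)"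
    and "c2 = 1 / (2 * zeta 2) *
           (2 * euler_mascheroni - 3 / 2 - 2 * (deriv zeta 2 / zeta 2) + 3 * zeta 2 / 4)"
    and "C1 = 1 / (2 * zeta 2)"
    and "C2 = 1 / zeta 2 * (2 * euler_mascheroni - 3 / 2 - 2 * (deriv zeta 2 / zeta 2))"
  shows "(\<lambda>Q. 1 / real (card (farey Q)) * (\<Sum>x\<in>farey0 Q. real (mcf_length x))
              - (c1 * (ln Q)\<^sup>2 + c2 * ln Q)) \<in> O[at_top](\<lambda>_. 1) \<and>
         2 * c1 = C1 \<and> c2 = C2 / 2 + 3 / 8 \<and> 2 * c2 > C2"
proof -
  let ?f = "\<lambda>Q. 1 / real (card (farey Q)) * (\<Sum>x\<in>farey0 Q. real (mcf_length x))"
  let ?M = "\<lambda>Q. c1 * (ln Q)\<^sup>2 + c2 * ln Q"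
  let ?n = "\<lambda>Q::real. nat \<lfloor>Q\<rfloor>"
  have z: "zeta 2 > 0" using zeta_2_ge_1 by simp
  have fl: "farey (real (nat \<lfloor>Q\<rfloor>)) = farey Q" if "1 \<le> Q" for Q
    using farey_floor[OF that] by (rule sym)
  \<comment> \<open>The average depends on Q only through its integer part, and the main terms
    change by O(1) when Q is replaced by it, so the result for integers is composed with the
    floor.\<close>
  have lim: "filterlim ?n sequentially at_top"
    by (rule filterlim_compose[OF filterlim_nat_sequentially filterlim_floor_sequentially])
  have 1: "(\<lambda>Q. ?f (real (?n Q)) - ?M (real (?n Q))) \<in> O[at_top](\<lambda>_. 1)"
    by (rule landau_o.big.compose[OF farey_average_nat[OF assms(1,2)] lim])
  have 2: "(\<lambda>Q. ?M (real (?n Q)) - ?M Q) \<in> O[at_top](\<lambda>_. 1)"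
  proof (rule bigoI[of _ "3 * \<bar>c1\<bar> + \<bar>c2\<bar>"])
    show "\<forall>\<^sub>F Q in at_top. norm (?M (real (?n Q)) - ?M Q) \<le> (3 * \<bar>c1\<bar> + \<bar>c2\<bar>) * norm (1 :: real)"
      using eventually_ge_at_top[of 1] by eventually_elim (use quad_ln_floor_diff in simp)
  qed
  have 3: "(\<lambda>Q. ?f (real (?n Q)) - ?M Q) \<in> O[at_top](\<lambda>_. 1)"
  proof -
    have "(\<lambda>Q. ?f (real (?n Q)) - ?M Q) = (\<lambda>Q. (?f (real (?n Q)) - ?M (real (?n Q))) + (?M (real (?n Q)) - ?M Q))"
      by (simp add: fun_eq_iff)
    then show ?thesis using sum_in_bigo(1)[OF 1 2] by (simp only:)
  qed
  have "\<forall>\<^sub>F Q in at_top. ?f (real (?n Q)) - ?M Q = ?f Q - ?M Q"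
    using eventually_ge_at_top[of 1] by eventually_elim (simp only: farey0_def fl)
  then have "(\<lambda>Q. ?f Q - ?M Q) \<in> O[at_top](\<lambda>_. 1)"
    by (subst landau_o.big.in_cong[symmetric]) (use 3 in auto)
  moreover have "2 * c1 = C1" using z by (simp add: assms(1,3))
  moreover have "c2 = C2 / 2 + 3 / 8" using z by (simp add: assms(2,4) field_simps)
  ultimately show ?thesis by simp
qed

end
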